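(* Let $(k;k_0,\dots,k_4;\lambda)$ be one of $(5;1,1,1,1,1;1)$, $(6;2,1,1,1,1;4)$, $(8;4,1,1,1,1;256)$, $(10;5,2,1,1,1;12500)$, put $d_j=k/k_j$, and let $$Q(x,\psi)=\sum_{j=0}^4 x_j^{d_j}-k\psi\prod_{j=0}^4x_j .$$ For $\ell\ge1$ let $$\omega_\ell=\frac{(-1)^{\ell-1}(\ell-1)!\,\psi^\ell\bigl(\prod_{i=0}^4 x_i^{\ell-1}\bigr)\Omega}{Q(x,\psi)^\ell},$$ and set $z=\psi^{-k}$. Then, modulo exact forms, $$\omega_5\equiv\varepsilon_1(z)\,\omega_1+\varepsilon_2(z)\,\omega_2+\varepsilon_3(z)\,\omega_3+\varepsilon_4(z)\,\omega_4,$$ where the coefficients are as follows. For $k=5$: $\varepsilon_1=\frac{1}{625(z-1)}$, $\varepsilon_2=\frac{-3}{25(z-1)}$, $\varepsilon_3=\frac{1}{z-1}$, $\varepsilon_4=\frac{-2}{z-1}$. For $k=6$: $\varepsilon_1=\frac{1}{324(z-4)}$, $\varepsilon_2=\frac{-5}{18(z-4)}$, $\varepsilon_3=\frac{-(z-50)}{18(z-4)}$, $\varepsilon_4=\frac{-(z+20)}{3(z-4)}$. For $k=8$: $\varepsilon_1=\frac{1}{16(z-256)}$, $\varepsilon_2=\frac{-15(z+256)}{512(z-256)}$, $\varepsilon_3=\frac{-5(3z-1280)}{64(z-256)}$, $\varepsilon_4=\frac{-(3z+1280)}{4(z-256)}$. For $k=10$: $\varepsilon_1=\frac{5}{4(z-12500)}$,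 $\varepsilon_2=\frac{-(7z+37500)}{200(z-12500)}$, $\varepsilon_3=\frac{-(7z-62500)}{20(z-12500)}$, $\varepsilon_4=\frac{-(z+12500)}{z-12500}$. Consequently, with $\vartheta=z\frac{d}{dz}=-\frac1k\psi\frac{d}{d\psi}$ (acting on forms by differentiating coefficients with respect to the parameter), $$\bigl(\vartheta^4+B_3(z)\vartheta^3+B_2(z)\vartheta^2+B_1(z)\vartheta+B_0(z)\bigr)\omega_1\equiv0$$ modulo exact forms, where $$\begin{aligned} B_0&=-\varepsilon_1-\tfrac1k\varepsilon_2-\tfrac2{k^2}\varepsilon_3-\tfrac6{k^3}\varepsilon_4+\tfrac{24}{k^4},\\ B_1&=-\varepsilon_2-\tfrac3k\varepsilon_3-\tfrac{11}{k^2}\varepsilon_4+\tfrac{50}{k^3},\\ B_2&=-\varepsilon_3-\tfrac6k\varepsilon_4+\tfrac{35}{k^2},\\ B_3&=-\varepsilon_4+\tfrac{10}{k}. \end{aligned}$$ Moreover, in each of the four cases $B_3(z)=\frac{2z}{z-\lambda}$ and $B_0(0)=B_1(0)=B_2(0)=B_3(0)=0$, and the monodromy at $z=0$ of the equation $(\vartheta^4+\sum_{j=0}^3B_j\vartheta^j)f=0$ is maximally unipotent.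
   Context: The variables $x_0,\dots,x_4$ have weights $k_0,\dots,k_4$ and are coordinates on the weighted projective space $\mathbb P^{(k_0,\dots,k_4)}$; note $k=\sum_j k_j$ and $Q$ is weighted homogeneous of degree $k$ in $x$. The form $\Omega$ is $$\Omega=\sum_{j=0}^4(-1)^jk_jx_j\,dx_0\wedge\dots\wedge\widehat{dx_j}\wedge\dots\wedge dx_4 .$$ Forms are taken with coefficients in the field $\mathbb C(\psi)$, with $\psi$ a parameter; $d$ denotes the exterior derivative in the $x$-variables only. "Modulo exact forms" means: the difference of the two sides is $d\varphi$ for some finite sum $\varphi$ of rational $3$-forms of the type $$\frac1{Q^\ell}\sum_{i<j}(k_ix_iA_j-k_jx_jA_i)\,dx_0\wedge\dots\wedge\widehat{dx_i}\wedge\dots\wedge\widehat{dx_j}\wedge\dots\wedge dx_4,$$ where $\ell\ge1$ and $A_0,\dots,A_4\in\mathbb C(\psi)[x_0,\dots,x_4]$ are weighted homogeneous with $\deg A_j=\ell k+k_j-k$. The monodromy at $z=0$ is the linear automorphism $T$ of the 4-dimensional space of local solutions, near a point $z\neq0$ close to $0$, given by analytic continuation once counterclockwise around $z=0$. "Maximally unipotent" means $(T-I)^3\ne0$ and $(T-I)^4=0$.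
   Formalization: The generating 3-forms defining "modulo exact forms" carry the extra sign (-1)^{i+j} in front of (k_i x_i A_j - k_j x_j A_i); without it their derivatives are not suitable multiples of Ω and the claimed equivalence for ω_5 is false. *)

theory Defs
  imports
    "HOL-Complex_Analysis.Complex_Analysis"
    "HOL-Computational_Algebra.Computational_Algebra"
    "HOL-Library.Poly_Mapping"
    "HOL-Library.Function_Algebras"
begin

section \<open>Derivations and their extension to the field of fractions\<close>

definition derivation :: "('a::comm_ring_1 \<Rightarrow> 'a) \<Rightarrow> bool" where
  "derivation D \<longleftrightarrow>
     (\<forall>a b. D (a + b) = D a + D b) \<and> (\<forall>a b. D (a * b) = D a * b + a * D b)"

text \<open>The quotient rule; well defined for every derivation, see \<open>fract_deriv_Fract\<close>.\<close>

definition fract_deriv :: "('a::idom \<Rightarrow> 'a) \<Rightarrow> 'a fract \<Rightarrow> 'a fract" where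
  "fract_deriv D q =
     (THE r. \<forall>a b. b \<noteq> 0 \<and> q = Fract a b \<longrightarrow> r = Fract (D a * b - a * D b) (b * b))"

lemma fract_deriv_Fract:
  assumes D: "derivation D" and b: "b \<noteq> 0"
  shows "fract_deriv D (Fract a b) = Fract (D a * b - a * D b) (b * b)"
proof -
  have eq: "Fract (D a * b - a * D b) (b * b) = Fract (D a' * b' - a' * D b') (b' * b')"
    if b': "b' \<noteq> 0" and q: "Fract a b = Fract a' b'" for a' b'
  proof -
    have e: "a * b' = a' * b"
      using q b b' by (simp add: eq_fract)
    have "D (a * b') = D (a' * b)"
      using e by simp
    then have f: "D a * b' + a * D b' = D a' * b + a' * D b"
      using D by (simp add: derivation_def)
    have "(D a * b - a * D b) * (b' * b') = (D a' * b' - a' * D b') * (b * b)"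
    proof -
      have "(D a * b - a * D b) * (b' * b') - (D a' * b' - a' * D b') * (b * b)
          = (D a * b' + a * D b' - (D a' * b + a' * D b)) * (b * b')
            - (a * b' - a' * b) * (D b * b' + b * D b')"
        by (simp add: algebra_simps)
      then show ?thesis
        using e f by simp
    qed
    then show ?thesis
      using b b' by (simp add: eq_fract)
  qed
  show ?thesis
    unfolding fract_deriv_def
  proof (rule the_equality)
    show "\<forall>a' b'. b' \<noteq> 0 \<and> Fract a b = Fract a' b' \<longrightarrow>
        Fract (D a * b - a * D b) (b * b) = Fract (D a' * b' - a' * D b') (b' * b')"
      using eq by blast
  qed (use b in blast)
qed

lemma derivation_fract_deriv:
  assumes D: "derivation D"
  shows "derivation (fract_deriv D)"
proof -
  have add: "D (a + b) = D a + D b" and mult: "D (a * b) = D a * b + a * D b" for a b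
    using D by (simp_all add: derivation_def)
  have "fract_deriv D (p + q) = fract_deriv D p + fract_deriv D q" for p q
    by (cases p; cases q) (simp add: fract_deriv_Fract[OF D] add mult eq_fract algebra_simps)
  moreover have "fract_deriv D (p * q) = fract_deriv D p * q + p * fract_deriv D q" for p q
    by (cases p; cases q) (simp add: fract_deriv_Fract[OF D] add mult eq_fract algebra_simps)
  ultimately show ?thesis
    by (simp add: derivation_def)
qed

section \<open>The coefficient field\<close>

text \<open>
  \<open>Cpsi\<close> is \<open>C(psi)\<close>, \<open>Cpsi_poly\<close> the polynomial ring over it in variables indexed by the
  natural numbers (only \<open>x_0, ..., x_4\<close> are used), and \<open>rat_fun\<close> its field of fractions.
\<close>

type_synonym Cpsi = "complex poly fract"
type_synonym Cpsi_poly = "(nat \<Rightarrow>\<^sub>0 nat) \<Rightarrow>\<^sub>0 Cpsi"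
type_synonym rat_fun = "Cpsi_poly fract"

definition xvar :: "nat \<Rightarrow> rat_fun" where
  "xvar i = to_fract (Poly_Mapping.single (Poly_Mapping.single i 1) 1)"

definition psi :: rat_fun where
  "psi = to_fract (Poly_Mapping.single 0 (to_fract [:0, 1:]))"

definition diff_poly :: "nat \<Rightarrow> Cpsi_poly \<Rightarrow> Cpsi_poly" where
  "diff_poly i p = (\<Sum>m\<in>Poly_Mapping.keys p.
     Poly_Mapping.single (m - Poly_Mapping.single i 1)
       (of_nat (Poly_Mapping.lookup m i) * Poly_Mapping.lookup p m))"

definition diff_x :: "nat \<Rightarrow> rat_fun \<Rightarrow> rat_fun" where
  "diff_x i = fract_deriv (diff_poly i)"

definition diff_psi :: "rat_fun \<Rightarrow> rat_fun" where
  "diff_psi = fract_deriv (Poly_Mapping.map (fract_deriv pderiv))"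

lemma derivation_pderiv: "derivation (pderiv :: complex poly \<Rightarrow> _)"
  by (simp add: derivation_def pderiv_add pderiv_mult algebra_simps)

lemma derivation_0: "derivation D \<Longrightarrow> D 0 = 0"
  by (metis add_cancel_right_right add_0 derivation_def)

lemma update_eq_add_single:
  "a \<notin> Poly_Mapping.keys f \<Longrightarrow> Poly_Mapping.update a b f = f + Poly_Mapping.single a b"
  for f :: "'a \<Rightarrow>\<^sub>0 'b::comm_monoid_add"
  by (rule poly_mapping_eqI)
    (auto simp: lookup_update lookup_add lookup_single when_def in_keys_iff)

lemma add_single_induct [case_names zero add]:
  fixes f :: "'a \<Rightarrow>\<^sub>0 'b::comm_monoid_add"
  assumes "P 0" "\<And>f a b. P f \<Longrightarrow> P (f + Poly_Mapping.single a b)"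
  shows "P f"
  by (induction f rule: update_induct) (auto simp: assms update_eq_add_single)

text \<open>The Leibniz rule need only be checked on monomials.\<close>

lemma derivation_if_monomials:
  fixes D :: "('a::comm_monoid_add \<Rightarrow>\<^sub>0 'b::comm_ring_1) \<Rightarrow> ('a \<Rightarrow>\<^sub>0 'b)"
  assumes add: "\<And>p q. D (p + q) = D p + D q"
    and mono: "\<And>m n a b. D (Poly_Mapping.single m a * Poly_Mapping.single n b)
      = D (Poly_Mapping.single m a) * Poly_Mapping.single n b
        + Poly_Mapping.single m a * D (Poly_Mapping.single n b)"
  shows "derivation D"
proof -
  have zero: "D 0 = 0"
    using add[of 0 0] by simp
  have 1: "D (Poly_Mapping.single m a * q)
      = D (Poly_Mapping.single m a) * q + Poly_Mapping.single m a * D q" for m a q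
    by (induction q rule: add_single_induct)
      (simp_all add: zero add mono distrib_left algebra_simps)
  have "D (p * q) = D p * q + p * D q" for p q
  proof (induction p rule: add_single_induct)
    case (add f m a)
    have "D ((f + Poly_Mapping.single m a) * q) = D (f * q) + D (Poly_Mapping.single m a * q)"
      by (simp only: distrib_right assms(1))
    also have "\<dots> = D f * q + f * D q
        + (D (Poly_Mapping.single m a) * q + Poly_Mapping.single m a * D q)"
      by (simp only: add 1)
    finally show ?case
      by (simp add: assms(1) algebra_simps)
  qed (simp add: zero)
  then show ?thesis
    by (simp add: derivation_def add)
qed

lemma lookup_diff_poly:
  "Poly_Mapping.lookup (diff_poly i p) m
     = of_nat (Poly_Mapping.lookup m i + 1) * Poly_Mapping.lookup p (m + Poly_Mapping.single i 1)"
proof -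
  let ?e = "Poly_Mapping.single i (1::nat)"
  have "(of_nat (Poly_Mapping.lookup n i) * Poly_Mapping.lookup p n when n - ?e = m)
      = (of_nat (Poly_Mapping.lookup m i + 1) * Poly_Mapping.lookup p (m + ?e) when n = m + ?e)" for n
  proof (cases "Poly_Mapping.lookup n i = 0")
    case True
    then have "n \<noteq> m + ?e"
      by (auto simp: lookup_add)
    with True show ?thesis
      by simp
  next
    case False
    then have "n = (n - ?e) + ?e"
      by (intro poly_mapping_eqI) (auto simp: lookup_add lookup_minus lookup_single when_def)
    then have "n - ?e = m \<longleftrightarrow> n = m + ?e"
      by (metis add_diff_cancel_right')
    then show ?thesis
      by (auto simp: when_def lookup_add)
  qed
  then have "Poly_Mapping.lookup (diff_poly i p) m
      = (\<Sum>n\<in>Poly_Mapping.keys p.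
          of_nat (Poly_Mapping.lookup m i + 1) * Poly_Mapping.lookup p (m + ?e) when n = m + ?e)"
    by (simp add: diff_poly_def lookup_sum lookup_single)
  also have "\<dots> = of_nat (Poly_Mapping.lookup m i + 1) * Poly_Mapping.lookup p (m + ?e)"
    by (cases "m + ?e \<in> Poly_Mapping.keys p") (auto simp: when_def in_keys_iff)
  finally show ?thesis .
qed

lemma diff_poly_add: "diff_poly i (p + q) = diff_poly i p + diff_poly i q"
  by (rule poly_mapping_eqI) (simp add: lookup_diff_poly lookup_add algebra_simps)

lemma diff_poly_single:
  "diff_poly i (Poly_Mapping.single m a)
     = Poly_Mapping.single (m - Poly_Mapping.single i 1)
         (of_nat (Poly_Mapping.lookup m i) * a)"
  by (cases "a = 0") (simp_all add: diff_poly_def)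

lemma derivation_diff_poly: "derivation (diff_poly i)"
proof (rule derivation_if_monomials, rule diff_poly_add)
  let ?e = "Poly_Mapping.single i (1::nat)"
  have shift: "m - ?e + n = m + n - ?e"
    if "Poly_Mapping.lookup m i \<noteq> 0" for m n :: "nat \<Rightarrow>\<^sub>0 nat"
    using that
    by (intro poly_mapping_eqI) (auto simp: lookup_add lookup_minus lookup_single when_def)
  fix m n :: "nat \<Rightarrow>\<^sub>0 nat" and a b :: Cpsi
  have "Poly_Mapping.single (m - ?e + n) (of_nat (Poly_Mapping.lookup m i) * a * b)
      = Poly_Mapping.single (m + n - ?e) (of_nat (Poly_Mapping.lookup m i) * a * b)"
    using shift[of m n] by (cases "Poly_Mapping.lookup m i = 0") simp_all
  moreover have "Poly_Mapping.single (m + (n - ?e)) (a * (of_nat (Poly_Mapping.lookup n i) * b))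
      = Poly_Mapping.single (m + n - ?e) (a * (of_nat (Poly_Mapping.lookup n i) * b))"
    using shift[of n m] by (cases "Poly_Mapping.lookup n i = 0") (simp_all add: add.commute)
  ultimately show "diff_poly i (Poly_Mapping.single m a * Poly_Mapping.single n b)
      = diff_poly i (Poly_Mapping.single m a) * Poly_Mapping.single n b
        + Poly_Mapping.single m a * diff_poly i (Poly_Mapping.single n b)"
    by (simp add: mult_single diff_poly_single lookup_add algebra_simps flip: single_add)
qed

lemma derivation_map_coeffs:
  fixes D :: "'b::comm_ring_1 \<Rightarrow> 'b"
  assumes D: "derivation D"
  shows "derivation (Poly_Mapping.map D :: ('a::comm_monoid_add \<Rightarrow>\<^sub>0 'b) \<Rightarrow> _)"
proof -
  have lookup: "Poly_Mapping.lookup (Poly_Mapping.map D p) m = D (Poly_Mapping.lookup p m)"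
    for p :: "'a \<Rightarrow>\<^sub>0 'b" and m
    by (simp add: Poly_Mapping.map.rep_eq when_def derivation_0[OF D])
  have single: "Poly_Mapping.map D (Poly_Mapping.single m a) = Poly_Mapping.single m (D a)"
    for m :: 'a and a
    by (rule poly_mapping_eqI) (simp add: lookup lookup_single when_def derivation_0[OF D])
  show ?thesis
  proof (rule derivation_if_monomials)
    show "Poly_Mapping.map D (p + q) = Poly_Mapping.map D p + Poly_Mapping.map D q"
      for p q :: "'a \<Rightarrow>\<^sub>0 'b"
      using D by (intro poly_mapping_eqI) (simp add: lookup lookup_add derivation_def)
  qed (use D in \<open>simp add: single mult_single derivation_def flip: single_add\<close>)
qed

lemma derivation_diff_x: "derivation (diff_x i)"
  by (simp add: diff_x_def derivation_fract_deriv derivation_diff_poly)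

lemma derivation_diff_psi: "derivation diff_psi"
  by (simp add: diff_psi_def derivation_fract_deriv derivation_map_coeffs derivation_pderiv)

section \<open>Rational differential forms\<close>

text \<open>
  A form is given by its coefficients: \<open>\<eta> {i_1 < ... < i_p}\<close> is the coefficient of
  \<open>dx_{i_1} \<and> ... \<and> dx_{i_p}\<close>. All forms below vanish on index sets not contained in \<open>{..<5}\<close>.
\<close>

type_synonym form = "nat set \<Rightarrow> rat_fun"

definition scale_form :: "rat_fun \<Rightarrow> form \<Rightarrow> form" (infixr "*\<^sub>F" 75) where
  "c *\<^sub>F \<eta> = (\<lambda>I. c * \<eta> I)"

definition basis_form :: "nat set \<Rightarrow> form" where
  "basis_form I = (\<lambda>J. if J = I then 1 else 0)"

definition ext_deriv :: "form \<Rightarrow> form" where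
  "ext_deriv \<eta> = (\<lambda>J. if J \<subseteq> {..<5}
     then \<Sum>i\<in>J. (-1) ^ card {j\<in>J. j < i} * diff_x i (\<eta> (J - {i})) else 0)"

text \<open>In what follows \<open>w ! j\<close> is the weight \<open>k_j\<close>.\<close>

definition Omega :: "nat list \<Rightarrow> form" where
  "Omega w = (\<Sum>j<5. ((-1) ^ j * of_nat (w ! j) * xvar j) *\<^sub>F basis_form ({..<5} - {j}))"

definition Q :: "nat \<Rightarrow> nat list \<Rightarrow> rat_fun" where
  "Q k w = (\<Sum>j<5. xvar j ^ (k div w ! j)) - of_nat k * psi * (\<Prod>j<5. xvar j)"

definition omega :: "nat \<Rightarrow> nat list \<Rightarrow> nat \<Rightarrow> form" where
  "omega k w l =
     ((-1) ^ (l - 1) * of_nat (fact (l - 1)) * psi ^ l * (\<Prod>i<5. xvar i ^ (l - 1)) / Q k w ^ l)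
       *\<^sub>F Omega w"

definition weighted_homogeneous :: "nat list \<Rightarrow> nat \<Rightarrow> Cpsi_poly \<Rightarrow> bool" where
  "weighted_homogeneous w n p \<longleftrightarrow>
     (\<forall>m\<in>Poly_Mapping.keys p. Poly_Mapping.keys m \<subseteq> {..<5} \<and>
       (\<Sum>i<5. w ! i * Poly_Mapping.lookup m i) = n)"

text \<open>
  The sign \<open>(-1)^(i+j)\<close> is the one of the interior product: up to an overall sign, this form is
  the contraction of \<open>dx_0 \<and> ... \<and> dx_4\<close> with \<open>\<Sum> k_i x_i \<partial>_i\<close> and \<open>\<Sum> A_j \<partial>_j\<close>, divided
  by \<open>Q^l\<close>. It is needed for the exterior derivative to be a multiple of \<open>\<Omega>\<close>.
\<close>

definition griffiths_form :: "nat \<Rightarrow> nat list \<Rightarrow> nat \<Rightarrow> (nat \<Rightarrow> Cpsi_poly) \<Rightarrow> form" where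
  "griffiths_form k w l A = (\<Sum>j<5. \<Sum>i<j.
     ((-1) ^ (i + j) *
       (of_nat (w ! i) * xvar i * to_fract (A j) - of_nat (w ! j) * xvar j * to_fract (A i))
       / Q k w ^ l) *\<^sub>F basis_form ({..<5} - {i, j}))"

definition griffiths_forms :: "nat \<Rightarrow> nat list \<Rightarrow> form set" where
  "griffiths_forms k w = {griffiths_form k w l A | l A.
     l \<ge> 1 \<and> (\<forall>j<5. weighted_homogeneous w (l * k + w ! j - k) (A j))}"

definition equiv_mod_exact :: "nat \<Rightarrow> nat list \<Rightarrow> form \<Rightarrow> form \<Rightarrow> bool" where
  "equiv_mod_exact k w \<eta> \<theta> \<longleftrightarrow>
     (\<exists>(n::nat) \<phi>. (\<forall>i<n. \<phi> i \<in> griffiths_forms k w) \<and> \<eta> - \<theta> = ext_deriv (\<Sum>i<n. \<phi> i))"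

text \<open>The operator \<open>z d/dz = -(1/k) psi d/dpsi\<close> acting on coefficients.\<close>

definition theta_form :: "nat \<Rightarrow> form \<Rightarrow> form" where
  "theta_form k \<eta> = (\<lambda>I. - (psi * diff_psi (\<eta> I)) / of_nat k)"

section \<open>The four families and their Picard--Fuchs equations\<close>

text \<open>The tuples \<open>(k; k_0, ..., k_4; \<lambda>)\<close>.\<close>

definition families :: "(nat \<times> nat list \<times> nat) set" where
  "families = {(5, [1, 1, 1, 1, 1], 1), (6, [2, 1, 1, 1, 1], 4),
               (8, [4, 1, 1, 1, 1], 256), (10, [5, 2, 1, 1, 1], 12500)}"

text \<open>
  \<open>eps k z l\<close> is \<open>\<epsilon>_l(z)\<close> for \<open>1 \<le> l \<le> 4\<close>, and \<open>B k z j\<close> is \<open>B_j(z)\<close> for \<open>j \<le> 3\<close>.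
  They are used both with \<open>z = psi^(-k)\<close> in the field of rational functions and with complex \<open>z\<close>.
\<close>

definition eps :: "nat \<Rightarrow> 'a::field \<Rightarrow> nat \<Rightarrow> 'a" where
  "eps k z l =
    (if k = 5 then
       [1 / (625 * (z - 1)), -3 / (25 * (z - 1)), 1 / (z - 1), -2 / (z - 1)]
     else if k = 6 then
       [1 / (324 * (z - 4)), -5 / (18 * (z - 4)),
        -(z - 50) / (18 * (z - 4)), -(z + 20) / (3 * (z - 4))]
     else if k = 8 then
       [1 / (16 * (z - 256)), -15 * (z + 256) / (512 * (z - 256)),
        -5 * (3 * z - 1280) / (64 * (z - 256)), -(3 * z + 1280) / (4 * (z - 256))]
     else
       [5 / (4 * (z - 12500)), -(7 * z + 37500) / (200 * (z - 12500)),
        -(7 * z - 62500) / (20 * (z - 12500)), -(z + 12500) / (z - 12500)]) ! (l - 1)"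

definition B :: "nat \<Rightarrow> 'a::field \<Rightarrow> nat \<Rightarrow> 'a" where
  "B k z j =
    [- eps k z 1 - 1 / of_nat k * eps k z 2 - 2 / of_nat k ^ 2 * eps k z 3
       - 6 / of_nat k ^ 3 * eps k z 4 + 24 / of_nat k ^ 4,
     - eps k z 2 - 3 / of_nat k * eps k z 3 - 11 / of_nat k ^ 2 * eps k z 4 + 50 / of_nat k ^ 3,
     - eps k z 3 - 6 / of_nat k * eps k z 4 + 35 / of_nat k ^ 2,
     - eps k z 4 + 10 / of_nat k] ! j"

section \<open>Local solutions and monodromy around zero\<close>

definition theta :: "(complex \<Rightarrow> complex) \<Rightarrow> complex \<Rightarrow> complex" where
  "theta f = (\<lambda>z. z * deriv f z)"

text \<open>
  Solutions on the disc \<open>ball z0 r\<close>; they are set to zero outside the disc so that two of them are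
  equal as functions iff they agree on the disc.
\<close>

definition local_solutions :: "nat \<Rightarrow> complex \<Rightarrow> real \<Rightarrow> (complex \<Rightarrow> complex) set" where
  "local_solutions k z0 r = {f. f holomorphic_on ball z0 r \<and>
     (\<forall>z\<in>ball z0 r. (theta ^^ 4) f z + (\<Sum>j<4. B k z j * (theta ^^ j) f z) = 0) \<and>
     (\<forall>z. z \<notin> ball z0 r \<longrightarrow> f z = 0)}"

text \<open>
  Analytic continuation along a path: \<open>F t\<close> is a function element at \<open>\<gamma> t\<close>, and nearby elements
  are direct continuations of each other.
\<close>

definition continues_along ::
    "(real \<Rightarrow> complex) \<Rightarrow> (complex \<Rightarrow> complex) \<Rightarrow> (complex \<Rightarrow> complex) \<Rightarrow> bool" where
  "continues_along \<gamma> f g \<longleftrightarrow> (\<exists>F :: real \<Rightarrow> complex \<Rightarrow> complex.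
     (\<forall>t\<in>{0..1}. F t analytic_on {\<gamma> t}) \<and>
     (\<forall>t\<in>{0..1}. \<forall>\<^sub>F s in at t within {0..1}. \<forall>\<^sub>F u in nhds (\<gamma> s). F s u = F t u) \<and>
     (\<forall>\<^sub>F u in nhds (\<gamma> 0). F 0 u = f u) \<and>
     (\<forall>\<^sub>F u in nhds (\<gamma> 1). F 1 u = g u))"

definition loop0 :: "complex \<Rightarrow> real \<Rightarrow> complex" where
  "loop0 z0 t = z0 * cis (2 * pi * t)"

definition monodromy :: "nat \<Rightarrow> complex \<Rightarrow> real \<Rightarrow> (complex \<Rightarrow> complex) \<Rightarrow> (complex \<Rightarrow> complex)" where
  "monodromy k z0 r f = (THE g. g \<in> local_solutions k z0 r \<and> continues_along (loop0 z0) f g)"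

definition scale_fun :: "complex \<Rightarrow> (complex \<Rightarrow> complex) \<Rightarrow> (complex \<Rightarrow> complex)" where
  "scale_fun c f = (\<lambda>z. c * f z)"

interpretation cfun: vector_space scale_fun
  by unfold_locales (simp_all add: scale_fun_def fun_eq_iff algebra_simps)

definition linear_automorphism ::
    "(complex \<Rightarrow> complex) set \<Rightarrow> ((complex \<Rightarrow> complex) \<Rightarrow> (complex \<Rightarrow> complex)) \<Rightarrow> bool" where
  "linear_automorphism V T \<longleftrightarrow> bij_betw T V V \<and>
     (\<forall>f\<in>V. \<forall>g\<in>V. T (f + g) = T f + T g) \<and> (\<forall>c. \<forall>f\<in>V. T (scale_fun c f) = scale_fun c (T f))"

definition maximally_unipotent ::
    "(complex \<Rightarrow> complex) set \<Rightarrow> ((complex \<Rightarrow> complex) \<Rightarrow> (complex \<Rightarrow> complex)) \<Rightarrow> bool" where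
  "maximally_unipotent V T \<longleftrightarrow>
     (\<exists>f\<in>V. ((\<lambda>g. T g - g) ^^ 3) f \<noteq> 0) \<and> (\<forall>f\<in>V. ((\<lambda>g. T g - g) ^^ 4) f = 0)"

end

(*
  Differentiating x^n / Q^l in the x_j-direction is exact, by Euler's relation, for monomials of the
  right degree; since x_j times the x_j-derivative of Q equals d_j x_j^(d_j) - k psi x_0 ... x_4, this
  rewrites a monomial at a high pole order in terms of monomials with fewer factors x_j^(d_j) and of
  lower pole order. Starting from (x_0 ... x_4)^4 one comes back to powers of x_0 ... x_4, which gives
  omega_5. As theta omega_l = omega_(l+1) - (l/k) omega_l, the differential equation is a formal
  consequence.

  In the variable s = log z the equation reads lam D^4 f = e^s P(D) f with D = d/ds. Solving the
  recursion of the Frobenius method with exponent eps over C[[eps]] gives a solution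
  e^(eps s) H(eps, e^s) modulo eps^4, whose four coefficients span the solutions. Going around zero is
  s -> s + 2 pi i, that is multiplication by e^(2 pi i eps), and e^(2 pi i eps) - 1 is eps times a unit.
*)
theory Submission
  imports Defs
begin

text \<open>The relation for x_j trades x_j^(d_j - 1) for k_j psi times the product of the other
  variables, plus a term of lower pole order. Using x_j exactly k_j times for each j removes x_j^k
  for every j and puts (x_0 ... x_4)^k back. So the leading branch returns to its starting monomial
  with the factor lam psi^k, where lam is the product of the k_j^(k_j), and one linear equation for
  omega_5 remains; it degenerates at z = lam. The obstacle is that for k > 5 some lower branches run
  into monomials all of whose exponents are below d_j - 1, which no relation lowers. They are found
  by dividing a relation by psi and starting from powers of x_0 ... x_4 of the same weight; hence
  the negative powers of psi. On the analytic side solutions are parametrised by C[eps]/eps^4.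
  Multiplying by a power of e^(2 pi i eps) - 1 isolates the leading coefficient times the
  holomorphic solution. This one computation gives both independence and (T - I)^3 nonzero, provided
  that the holomorphic solution has no zero, so the disc is shrunk. That there are no further
  solutions follows from uniqueness for given initial values.\<close>

instance fract :: ("{idom,ring_char_0}") field_char_0
proof
  show "inj (of_nat :: nat \<Rightarrow> 'a fract)"
    by (auto simp: inj_def of_nat_fract eq_fract)
qed

section \<open>Derivations on rational functions\<close>

lemma derivation_add: "derivation D \<Longrightarrow> D (a + b) = D a + D b"
  and derivation_mult: "derivation D \<Longrightarrow> D (a * b) = D a * b + a * D b"
  by (simp_all add: derivation_def)

lemma derivation_minus:
  assumes "derivation D"
  shows "D (- a) = - D a"
  using derivation_add[OF assms, of a "- a"] derivation_0[OF assms]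
  by (simp add: eq_neg_iff_add_eq_0 add.commute)

lemma derivation_diff: "derivation D \<Longrightarrow> D (a - b) = D a - D b"
  by (metis derivation_add derivation_minus diff_conv_add_uminus)

lemma derivation_sum: "derivation D \<Longrightarrow> D (sum f A) = (\<Sum>i\<in>A. D (f i))"
  by (induction A rule: infinite_finite_induct) (simp_all add: derivation_0 derivation_add)

lemma derivation_1:
  assumes "derivation D"
  shows "D 1 = 0"
  using derivation_mult[OF assms, of 1 1] by simp

lemma derivation_of_nat: "derivation D \<Longrightarrow> D (of_nat n) = 0"
  by (induction n) (simp_all add: derivation_0 derivation_1 derivation_add)

lemma derivation_power:
  "derivation D \<Longrightarrow> D (a ^ n) = of_nat n * a ^ (n - 1) * D a"
proof (induction n)
  case (Suc n)
  then show ?case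
    by (cases n) (simp_all add: derivation_mult algebra_simps)
qed (simp add: derivation_1)

lemma derivation_divide:
  fixes D :: "'a::field \<Rightarrow> 'a"
  assumes D: "derivation D" and b: "b \<noteq> 0"
  shows "D (a / b) = D a / b - a * D b / b\<^sup>2"
proof -
  have "D a = D (a / b * b)"
    using b by simp
  also have "\<dots> = D (a / b) * b + a / b * D b"
    by (rule derivation_mult[OF D])
  finally show ?thesis
    using b by (simp add: field_simps power2_eq_square)
qed

section \<open>Constants and generators of the function field\<close>

definition const_fun :: "Cpsi \<Rightarrow> rat_fun" where
  "const_fun c = to_fract (Poly_Mapping.single 0 c)"

text \<open>These are the scalars for working modulo exact forms: multiplication by them commutes
  with the exterior derivative in x.\<close>

definition is_const :: "rat_fun \<Rightarrow> bool" where
  "is_const x \<longleftrightarrow> (\<exists>c. x = const_fun c)"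

lemma const_fun_add: "const_fun (a + b) = const_fun a + const_fun b"
  and const_fun_mult: "const_fun (a * b) = const_fun a * const_fun b"
  and const_fun_uminus: "const_fun (- a) = - const_fun a"
  and const_fun_1: "const_fun 1 = 1"
  and const_fun_0: "const_fun 0 = 0"
  by (simp_all add: const_fun_def single_add mult_single single_uminus flip: to_fract_mult to_fract_add)

lemma const_fun_inverse: "const_fun (inverse a) = inverse (const_fun a)"
proof (cases "a = 0")
  case False
  then have "const_fun a * const_fun (inverse a) = 1"
    by (simp add: const_fun_1 flip: const_fun_mult)
  then show ?thesis
    by (rule inverse_unique[symmetric])
qed (simp add: const_fun_0)

lemma is_const_add [intro!]: "is_const a \<Longrightarrow> is_const b \<Longrightarrow> is_const (a + b)"
  unfolding is_const_def by (metis const_fun_add)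

lemma is_const_mult [intro!]: "is_const a \<Longrightarrow> is_const b \<Longrightarrow> is_const (a * b)"
  unfolding is_const_def by (metis const_fun_mult)

lemma is_const_uminus [intro!]: "is_const a \<Longrightarrow> is_const (- a)"
  unfolding is_const_def by (metis const_fun_uminus)

lemma is_const_inverse [intro!]: "is_const a \<Longrightarrow> is_const (inverse a)"
  unfolding is_const_def by (metis const_fun_inverse)

lemma is_const_1 [intro!]: "is_const 1" and is_const_0 [intro!]: "is_const 0"
  unfolding is_const_def by (metis const_fun_1, metis const_fun_0)

lemma is_const_psi [intro!]: "is_const psi"
  by (auto simp: is_const_def psi_def const_fun_def)

lemma is_const_diff [intro!]: "is_const a \<Longrightarrow> is_const b \<Longrightarrow> is_const (a - b)"
  by (metis diff_conv_add_uminus is_const_add is_const_uminus)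

lemma is_const_divide [intro!]: "is_const a \<Longrightarrow> is_const b \<Longrightarrow> is_const (a / b)"
  by (metis divide_inverse is_const_inverse is_const_mult)

lemma is_const_power [intro!]: "is_const a \<Longrightarrow> is_const (a ^ n)"
  by (induction n) auto

lemma is_const_of_nat [intro!]: "is_const (of_nat n)"
  by (induction n) auto

lemma diff_x_to_fract: "diff_x i (to_fract p) = to_fract (diff_poly i p)"
  by (simp add: diff_x_def to_fract_def fract_deriv_Fract derivation_diff_poly
      derivation_1[OF derivation_diff_poly])

lemma diff_x_const: "is_const c \<Longrightarrow> diff_x i c = 0"
  by (auto simp: is_const_def const_fun_def diff_x_to_fract diff_poly_single)

lemma diff_x_xvar: "diff_x i (xvar j) = (if i = j then 1 else 0)"
  by (simp add: xvar_def diff_x_to_fract diff_poly_single lookup_single when_def)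

lemma single_eq_0_iff [simp]: "Poly_Mapping.single m a = 0 \<longleftrightarrow> a = 0"
  by (metis lookup_single_eq lookup_zero single_zero)

lemma xvar_nonzero [simp]: "xvar i \<noteq> 0"
  by (simp add: xvar_def)

lemma psi_nonzero [simp]: "psi \<noteq> 0"
  by (simp add: psi_def)

lemma diff_psi_to_fract: "diff_psi (to_fract p) = to_fract (Poly_Mapping.map (fract_deriv pderiv) p)"
proof -
  have "derivation (Poly_Mapping.map (fract_deriv pderiv) :: Cpsi_poly \<Rightarrow> Cpsi_poly)"
    by (intro derivation_map_coeffs derivation_fract_deriv derivation_pderiv)
  then show ?thesis
    by (simp add: diff_psi_def to_fract_def fract_deriv_Fract derivation_1)
qed

lemma map_single_derivation:
  "derivation D \<Longrightarrow> Poly_Mapping.map D (Poly_Mapping.single m a) = Poly_Mapping.single m (D a)"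
  by (rule poly_mapping_eqI)
    (simp add: Poly_Mapping.map.rep_eq lookup_single when_def derivation_0)

lemma diff_psi_xvar: "diff_psi (xvar i) = 0"
  using derivation_fract_deriv[OF derivation_pderiv]
  by (simp add: xvar_def diff_psi_to_fract map_single_derivation derivation_1)

lemma diff_psi_psi: "diff_psi psi = 1"
proof -
  have "fract_deriv pderiv (to_fract [:0, 1::complex:]) = 1"
    by (simp add: to_fract_def fract_deriv_Fract[OF derivation_pderiv] pderiv_pCons One_fract_def eq_fract)
  then show ?thesis
    using derivation_fract_deriv[OF derivation_pderiv]
    by (simp add: psi_def diff_psi_to_fract map_single_derivation)
qed

text \<open>At psi = 0 the left side vanishes. Consequently z - lam and 1 - lam psi^k, by which the
  relations are divided, are nonzero.\<close>

lemma psi_power_times_of_nat_neq_1: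
  assumes "n > 0"
  shows "of_nat c * psi ^ n \<noteq> 1"
proof
  assume "of_nat c * psi ^ n = 1"
  moreover have "const_fun (to_fract (of_nat c)) = of_nat c"
    by (induction c) (simp_all add: const_fun_0 const_fun_1 const_fun_add)
  moreover have "const_fun (to_fract ([:0, 1:] ^ n)) = psi ^ n"
    by (induction n) (simp_all add: const_fun_1 const_fun_mult psi_def flip: const_fun_def del: mult_pCons_left mult_pCons_right)
  ultimately have "const_fun (to_fract (of_nat c * [:0, 1:] ^ n)) = const_fun (to_fract 1)"
    by (simp add: const_fun_mult const_fun_1)
  \<comment> \<open>Both embeddings, of C[psi] into C(psi) and of C(psi) into the rational
    functions, are injective.\<close>
  then have "of_nat c * [:0, 1:] ^ n = (1 :: complex poly)"
    unfolding const_fun_def to_fract_eq_iff by (metis lookup_single_eq to_fract_eq_iff)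
  then have "poly (of_nat c * [:0, 1:] ^ n) 0 = (1 :: complex)"
    by simp
  then show False
    using assms by (simp add: zero_power)
qed

section \<open>The exterior derivative of a Griffiths form\<close>

lemma sum_fun_apply: "sum f A x = (\<Sum>a\<in>A. f a x)" for f :: "'a \<Rightarrow> 'b \<Rightarrow> 'c::comm_monoid_add"
  by (induction A rule: infinite_finite_induct) simp_all

text \<open>The weighted Euler field: a weighted homogeneous function is an eigenvector, with its
  degree as eigenvalue.\<close>

definition euler_deriv :: "nat list \<Rightarrow> rat_fun \<Rightarrow> rat_fun" where
  "euler_deriv w F = (\<Sum>i<5. of_nat (w ! i) * xvar i * diff_x i F)"

lemma derivation_euler_deriv: "derivation (euler_deriv w)"
  unfolding derivation_def
proof (intro conjI allI)
  fix a b
  show "euler_deriv w (a + b) = euler_deriv w a + euler_deriv w b"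
    by (simp add: euler_deriv_def derivation_add[OF derivation_diff_x] distrib_left sum.distrib)
  have "euler_deriv w (a * b) = (\<Sum>i<5. of_nat (w ! i) * xvar i * diff_x i a * b
      + a * (of_nat (w ! i) * xvar i * diff_x i b))"
    unfolding euler_deriv_def
    by (intro sum.cong refl) (simp add: derivation_mult[OF derivation_diff_x] algebra_simps)
  then show "euler_deriv w (a * b) = euler_deriv w a * b + a * euler_deriv w b"
    by (simp add: euler_deriv_def sum.distrib sum_distrib_left sum_distrib_right)
qed

lemma griffiths_form_apply:
  assumes "a < b" "b < 5"
  shows "griffiths_form k w l A ({..<5} - {a, b}) = (-1) ^ (a + b) *
       (of_nat (w ! a) * xvar a * to_fract (A b) - of_nat (w ! b) * xvar b * to_fract (A a))
       / Q k w ^ l" (is "_ = ?c a b")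
proof -
  have *: "({..<5} - {a, b} = {..<5} - {i, j}) \<longleftrightarrow> i = a \<and> j = b" if "i < j" "j < 5" for i j :: nat
  proof
    assume "{..<5} - {a, b} = {..<5} - {i, j}"
    then have "{..<5} - ({..<5} - {a, b}) = {..<5} - ({..<5} - {i, j})"
      by simp
    then have "{a, b} = {i, j}"
      using that assms by (simp add: Diff_Diff_Int Int_absorb1)
    then show "i = a \<and> j = b"
      using that assms by (auto simp: doubleton_eq_iff)
  qed auto
  have "griffiths_form k w l A ({..<5} - {a, b})
      = (\<Sum>j<5. \<Sum>i<j. ?c i j * (if {..<5} - {a, b} = {..<5} - {i, j} then 1 else 0))"
    by (simp add: griffiths_form_def scale_form_def basis_form_def sum_fun_apply)
  also have "\<dots> = (\<Sum>j<5. \<Sum>i<j. if i = a then (if j = b then ?c i j else 0) else 0)"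
    by (intro sum.cong refl) (auto simp: *)
  also have "\<dots> = (\<Sum>j<5. if j = b then ?c a b else 0)"
    using assms by (intro sum.cong refl) (auto simp: if_distrib)
  also have "\<dots> = ?c a b"
    using assms by simp
  finally show ?thesis .
qed

lemma griffiths_form_eq_0:
  assumes "\<And>i j. i < j \<Longrightarrow> j < 5 \<Longrightarrow> I \<noteq> {..<5} - {i, j}"
  shows "griffiths_form k w l A I = 0"
  unfolding griffiths_form_def scale_form_def basis_form_def sum_fun_apply
  using assms by (intro sum.neutral ballI) auto

lemma Omega_apply:
  assumes "m < 5"
  shows "Omega w ({..<5} - {m}) = (-1) ^ m * of_nat (w ! m) * xvar m"
proof -
  have *: "({..<5} - {m} = {..<5} - {j}) \<longleftrightarrow> j = m" if "j < 5" for j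
    using that assms by auto
  have "Omega w ({..<5} - {m})
      = (\<Sum>j<5. ((-1) ^ j * of_nat (w ! j) * xvar j) * (if {..<5} - {m} = {..<5} - {j} then 1 else 0))"
    by (simp add: Omega_def scale_form_def basis_form_def sum_fun_apply)
  also have "\<dots> = (\<Sum>j<5. if j = m then (-1) ^ m * of_nat (w ! m) * xvar m else 0)"
    by (intro sum.cong refl) (auto simp: *)
  finally show ?thesis
    using assms by simp
qed

lemma Omega_eq_0: "(\<And>j. j < 5 \<Longrightarrow> I \<noteq> {..<5} - {j}) \<Longrightarrow> Omega w I = 0"
  unfolding Omega_def scale_form_def basis_form_def sum_fun_apply
  by (intro sum.neutral ballI) auto

lemma card_less_Diff:
  fixes i m :: nat
  assumes "i < 5" "m < 5" "i \<noteq> m"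
  shows "card {j \<in> {..<5} - {m}. j < i} = (if m < i then i - 1 else i)"
proof -
  have "{j \<in> {..<5} - {m}. j < i} = {..<i} - {m}"
    using assms by auto
  then show ?thesis
    by (simp add: card_Diff_singleton_if)
qed

text \<open>With F_i = A_i / Q^l, the component belonging to m is, up to sign, the sum over i of the
  x_i-derivatives of k_m x_m F_i - k_i x_i F_m. It equals k_m x_m times the divergence of F plus
  (k_m - k) F_m minus the Euler derivative of F_m, and the last two cancel by the hypothesis on
  degrees.\<close>

lemma ext_deriv_griffiths_form:
  assumes k: "k = (\<Sum>i<5. w ! i)"
    and A: "\<And>j. j < 5 \<Longrightarrow>
      euler_deriv w (to_fract (A j) / Q k w ^ l)
        = (of_nat (w ! j) - of_nat k) * (to_fract (A j) / Q k w ^ l)"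
  shows "ext_deriv (griffiths_form k w l A)
    = - (\<Sum>i<5. diff_x i (to_fract (A i) / Q k w ^ l)) *\<^sub>F Omega w"
proof (rule ext)
  fix J :: "nat set"
  define F where "F i = to_fract (A i) / Q k w ^ l" for i
  define K where "K m i = of_nat (w ! m) * xvar m * F i - of_nat (w ! i) * xvar i * F m" for m i
  note D = derivation_diff_x
  show "ext_deriv (griffiths_form k w l A) J
    = (- (\<Sum>i<5. diff_x i (to_fract (A i) / Q k w ^ l)) *\<^sub>F Omega w) J"
  proof (cases "\<exists>m<5. J = {..<5} - {m}")
    case False
    \<comment> \<open>Adding one index to the complement of a pair gives the complement of a single
      index, which is excluded here.\<close>
    have "griffiths_form k w l A (J - {i}) = 0" if J: "J \<subseteq> {..<5}" "i \<in> J" for i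
    proof (rule griffiths_form_eq_0, rule notI)
      fix a b :: nat
      assume ab: "a < b" "b < 5" "J - {i} = {..<5} - {a, b}"
      have "i = a \<or> i = b"
        using J ab(3) by auto
      have "J = insert i ({..<5} - {a, b})"
        using ab(3) J(2) by (metis insert_Diff)
      moreover have "insert a ({..<5} - {a, b}) = {..<5} - {b}"
        "insert b ({..<5} - {a, b}) = {..<5} - {a}"
        using ab(1,2) by auto
      moreover have "a < 5"
        using ab(1,2) by simp
      ultimately show False
        using False ab(2) \<open>i = a \<or> i = b\<close> by metis
    qed
    then have "ext_deriv (griffiths_form k w l A) J = 0"
      by (simp add: ext_deriv_def derivation_0[OF D])
    moreover have "Omega w J = 0"
      using False by (intro Omega_eq_0) blast
    ultimately show ?thesis
      by (simp add: scale_form_def)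
  next
    case True
    then obtain m where m: "m < 5" and J: "J = {..<5} - {m}"
      by blast
    \<comment> \<open>The sign is the same on both sides of m: for i > m the missing index m shifts
      the position of i by one, while for i < m the antisymmetry of \<open>K\<close> supplies the
      minus sign.\<close>
    have comp: "(-1) ^ card {j\<in>J. j < i} * diff_x i (griffiths_form k w l A (J - {i}))
        = - ((-1) ^ m * diff_x i (K m i))" if i: "i \<in> J" for i
    proof -
      have i': "i < 5" "i \<noteq> m"
        using i J by auto
      have sgn: "diff_x i ((-1) ^ n * G) = (-1) ^ n * diff_x i G" for n G
        by (cases "even n") (simp_all add: derivation_minus[OF D])
      have sq: "(-1) ^ n * ((-1) ^ n * a) = a" for n and a :: rat_fun
        by (cases "even n") simp_all
      show ?thesis
      proof (cases "m < i")
        case True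
        have "J - {i} = {..<5} - {m, i}"
          using J by auto
        then have eq: "griffiths_form k w l A (J - {i}) = (-1) ^ (m + i) * K m i"
          using griffiths_form_apply[OF True i'(1), of k w l A]
          by (simp add: K_def F_def algebra_simps diff_divide_distrib)
        have crd: "card {j\<in>J. j < i} = i - 1"
          using card_less_Diff[OF i'(1) m i'(2)] J True by simp
        have neg: "(-1) ^ (i - 1) * (-1) ^ i = (-1 :: rat_fun)"
          using True by (cases i; cases "even i") simp_all
        have "(-1) ^ card {j\<in>J. j < i} * diff_x i (griffiths_form k w l A (J - {i}))
            = (-1) ^ (i - 1) * ((-1) ^ m * ((-1) ^ i * diff_x i (K m i)))"
          by (simp only: eq crd sgn power_add mult.assoc)
        also have "\<dots> = (-1) ^ m * ((-1) ^ (i - 1) * (-1) ^ i) * diff_x i (K m i)"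
          by (simp only: mult_ac)
        finally show ?thesis
          by (simp only: neg) simp
      next
        case False
        then have "i < m"
          using i' by simp
        have "J - {i} = {..<5} - {i, m}"
          using J by auto
        then have eq: "griffiths_form k w l A (J - {i}) = (-1) ^ (i + m) * (- K m i)"
          using griffiths_form_apply[OF \<open>i < m\<close> m, of k w l A]
          by (simp add: K_def F_def algebra_simps diff_divide_distrib)
        have crd: "card {j\<in>J. j < i} = i"
          using card_less_Diff[OF i'(1) m i'(2)] J False by simp
        show ?thesis
          unfolding eq crd
          by (simp only: sgn power_add derivation_minus[OF D] sq mult.assoc mult_minus_right)
      qed
    qed
    have "ext_deriv (griffiths_form k w l A) J = (\<Sum>i\<in>J. - ((-1) ^ m * diff_x i (K m i)))"
      using comp J by (simp add: ext_deriv_def)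
    also have "\<dots> = (\<Sum>i<5. - ((-1) ^ m * diff_x i (K m i)))"
      using m J by (intro sum.mono_neutral_left) (auto simp: K_def derivation_0[OF D])
    also have "\<dots> = - ((-1) ^ m * (\<Sum>i<5. diff_x i (K m i)))"
      by (simp add: sum_negf sum_distrib_left)
    also have "(\<Sum>i<5. diff_x i (K m i))
        = (\<Sum>i<5. (if i = m then of_nat (w ! m) * F m else 0) + of_nat (w ! m) * xvar m * diff_x i (F i)
            - of_nat (w ! i) * F m - of_nat (w ! i) * xvar i * diff_x i (F m))"
      unfolding K_def
      by (intro sum.cong refl)
        (auto simp: derivation_diff[OF D] derivation_mult[OF D] derivation_of_nat[OF D] diff_x_xvar)
    also have "\<dots> = of_nat (w ! m) * F m + of_nat (w ! m) * xvar m * (\<Sum>i<5. diff_x i (F i))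
        - of_nat k * F m - euler_deriv w (F m)"
      using m by (simp add: sum.distrib sum_subtractf euler_deriv_def k sum_distrib_left sum_distrib_right)
    also have "\<dots> = of_nat (w ! m) * xvar m * (\<Sum>i<5. diff_x i (F i))"
      using A[OF m, folded F_def] by (simp add: algebra_simps)
    finally show ?thesis
      using m by (simp add: scale_form_def J Omega_apply F_def)
  qed
qed

section \<open>Exact multiples of \<open>\<Omega>\<close>\<close>

text \<open>All forms to be compared are multiples of \<open>Omega\<close>, so working modulo exact
  forms becomes linear algebra over C(psi) with their coefficients.\<close>

definition exact :: "nat \<Rightarrow> nat list \<Rightarrow> rat_fun \<Rightarrow> bool" where
  "exact k w F \<longleftrightarrow> equiv_mod_exact k w (F *\<^sub>F Omega w) 0"

lemma ext_deriv_0: "ext_deriv 0 = 0"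
  by (simp add: ext_deriv_def fun_eq_iff derivation_0[OF derivation_diff_x])

lemma ext_deriv_add: "ext_deriv (\<eta> + \<theta>) = ext_deriv \<eta> + ext_deriv \<theta>"
  by (simp add: ext_deriv_def fun_eq_iff derivation_add[OF derivation_diff_x] distrib_left sum.distrib)

lemma ext_deriv_scale: "is_const c \<Longrightarrow> ext_deriv (c *\<^sub>F \<eta>) = c *\<^sub>F ext_deriv \<eta>"
  by (simp add: ext_deriv_def scale_form_def fun_eq_iff derivation_mult[OF derivation_diff_x]
      diff_x_const sum_distrib_left mult.left_commute)

lemma scale_form_add_left: "(c + d) *\<^sub>F \<eta> = c *\<^sub>F \<eta> + d *\<^sub>F \<eta>"
  and scale_form_scale: "c *\<^sub>F d *\<^sub>F \<eta> = (c * d) *\<^sub>F \<eta>"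
  by (simp_all add: scale_form_def fun_eq_iff algebra_simps)

lemma scale_form_sum: "c *\<^sub>F sum f A = (\<Sum>i\<in>A. c *\<^sub>F f i)"
  by (simp add: scale_form_def fun_eq_iff sum_fun_apply sum_distrib_left)

lemma scale_form_sum_left: "sum c A *\<^sub>F \<eta> = (\<Sum>i\<in>A. c i *\<^sub>F \<eta>)"
  by (simp add: scale_form_def fun_eq_iff sum_fun_apply sum_distrib_right)

lemma weighted_homogeneous_scale:
  assumes "weighted_homogeneous w n p"
  shows "weighted_homogeneous w n (Poly_Mapping.single 0 c * p)"
proof -
  have "Poly_Mapping.keys (Poly_Mapping.single 0 c * p) \<subseteq> Poly_Mapping.keys p"
    using keys_mult[of "Poly_Mapping.single 0 c" p] by (auto split: if_splits)
  with assms show ?thesis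
    by (auto simp: weighted_homogeneous_def)
qed

text \<open>A scalar from C(psi) can be absorbed into the A_j without changing their weighted
  degrees.\<close>

lemma griffiths_forms_scale:
  assumes "\<phi> \<in> griffiths_forms k w" "is_const c"
  shows "c *\<^sub>F \<phi> \<in> griffiths_forms k w"
proof -
  obtain l A where \<phi>: "\<phi> = griffiths_form k w l A" "l \<ge> 1"
    and A: "\<forall>j<5. weighted_homogeneous w (l * k + w ! j - k) (A j)"
    using assms(1) by (auto simp: griffiths_forms_def)
  obtain c' where c: "c = const_fun c'"
    using assms(2) by (auto simp: is_const_def)
  have "c *\<^sub>F \<phi> = griffiths_form k w l (\<lambda>j. Poly_Mapping.single 0 c' * A j)"
    unfolding \<phi>(1) griffiths_form_def scale_form_sum scale_form_scale
    by (intro sum.cong refl arg_cong2[where f = "(*\<^sub>F)"])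
      (simp add: c algebra_simps flip: const_fun_def)
  with \<phi> A show ?thesis
    by (auto simp: griffiths_forms_def intro!: weighted_homogeneous_scale)
qed

lemma exact_add:
  assumes "exact k w F" "exact k w G"
  shows "exact k w (F + G)"
proof -
  obtain n \<phi> where \<phi>: "\<forall>i<n. \<phi> i \<in> griffiths_forms k w"
    and F: "F *\<^sub>F Omega w = ext_deriv (\<Sum>i<(n::nat). \<phi> i)"
    using assms(1) by (auto simp: exact_def equiv_mod_exact_def)
  obtain m \<tau> where \<tau>: "\<forall>i<m. \<tau> i \<in> griffiths_forms k w"
    and G: "G *\<^sub>F Omega w = ext_deriv (\<Sum>i<(m::nat). \<tau> i)"
    using assms(2) by (auto simp: exact_def equiv_mod_exact_def)
  define \<xi> where "\<xi> i = (if i < n then \<phi> i else \<tau> (i - n))" for i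
  have "(\<Sum>i<n + m. \<xi> i) = (\<Sum>i<n. \<xi> i) + (\<Sum>i\<in>{n..<n + m}. \<xi> i)"
    using sum.atLeastLessThan_concat[of 0 n "n + m" \<xi>] by (simp add: atLeast0LessThan)
  also have "(\<Sum>i\<in>{n..<n + m}. \<xi> i) = (\<Sum>i<m. \<xi> (i + n))"
    using sum.shift_bounds_nat_ivl[of \<xi> 0 n m] by (simp add: atLeast0LessThan add.commute)
  finally have "(\<Sum>i<n + m. \<xi> i) = (\<Sum>i<n. \<phi> i) + (\<Sum>i<m. \<tau> i)"
    by (simp add: \<xi>_def plus_fun_def)
  then have "(F + G) *\<^sub>F Omega w = ext_deriv (\<Sum>i<n + m. \<xi> i)"
    by (simp add: scale_form_add_left F G ext_deriv_add)
  moreover have "\<forall>i<n + m. \<xi> i \<in> griffiths_forms k w"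
    using \<phi> \<tau> by (auto simp: \<xi>_def)
  ultimately show ?thesis
    unfolding exact_def equiv_mod_exact_def diff_0_right by blast
qed

lemma exact_scale:
  assumes "exact k w F" "is_const c"
  shows "exact k w (c * F)"
proof -
  obtain n \<phi> where \<phi>: "\<forall>i<n. \<phi> i \<in> griffiths_forms k w"
    and F: "F *\<^sub>F Omega w = ext_deriv (\<Sum>i<(n::nat). \<phi> i)"
    using assms(1) by (auto simp: exact_def equiv_mod_exact_def)
  have "(c * F) *\<^sub>F Omega w = ext_deriv (\<Sum>i<n. c *\<^sub>F \<phi> i)"
    by (simp only: F ext_deriv_scale[OF assms(2)] scale_form_scale[symmetric] scale_form_sum[symmetric])
  moreover have "\<forall>i<n. c *\<^sub>F \<phi> i \<in> griffiths_forms k w"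
    using \<phi> assms(2) griffiths_forms_scale by blast
  ultimately show ?thesis
    unfolding exact_def equiv_mod_exact_def diff_0_right
    by (intro exI[of _ n] exI[of _ "\<lambda>i. c *\<^sub>F \<phi> i"] conjI)
qed

lemma exact_0: "exact k w 0"
proof -
  have "0 *\<^sub>F Omega w = ext_deriv (\<Sum>i<(0::nat). 0)"
    by (simp add: ext_deriv_0) (simp add: scale_form_def fun_eq_iff)
  then show ?thesis
    unfolding exact_def equiv_mod_exact_def diff_0_right by blast
qed

lemma exact_diff:
  assumes "exact k w F" "exact k w G"
  shows "exact k w (F - G)"
proof -
  have "is_const (- 1)"
    by (intro is_const_uminus is_const_1)
  then show ?thesis
    using exact_add[OF assms(1) exact_scale[OF assms(2)], of "- 1"] by simp
qed

text \<open>The condition on the sum is the Calabi-Yau condition: x_0 ... x_4 then has the degree k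
  of Q, and so has \<open>Omega\<close>. Divisibility makes the d_j integers.\<close>

definition admissible :: "nat \<Rightarrow> nat list \<Rightarrow> bool" where
  "admissible k w \<longleftrightarrow> k = (\<Sum>i<5. w ! i) \<and> (\<forall>i<5. w ! i > 0 \<and> w ! i dvd k)"

lemma admissible_pos: "admissible k w \<Longrightarrow> k > 0"
  using member_le_sum[of 0 "{..<5}" "(!) w"] unfolding admissible_def
  by (metis finite_lessThan lessThan_iff less_le_trans zero_le zero_less_numeral)

section \<open>Monomials and logarithmic derivations\<close>

definition xmon :: "nat list \<Rightarrow> rat_fun" where
  "xmon ns = (\<Prod>i<5. xvar i ^ (ns ! i))"

lemma derivation_xdiff: "derivation (\<lambda>F. xvar j * diff_x j F)"
  by (simp add: derivation_def derivation_add[OF derivation_diff_x]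
      derivation_mult[OF derivation_diff_x] algebra_simps)

text \<open>Monomials are eigenvectors of x_j d/dx_j, of the Euler field and later of theta.
  Eigenvalues add up over products, which avoids the exponents n - 1 of ordinary
  derivatives.\<close>

lemma derivation_prod_eigen:
  assumes D: "derivation D" and "finite I" "\<And>i. i \<in> I \<Longrightarrow> D (f i) = c i * f i"
  shows "D (prod f I) = sum c I * prod f I"
  using assms(2,3)
  by (induction I rule: finite_induct)
    (simp_all add: derivation_1[OF D] derivation_mult[OF D] algebra_simps)

lemma derivation_power_eigen:
  assumes D: "derivation D" and "D f = c * f"
  shows "D (f ^ n) = of_nat n * c * f ^ n"
proof (cases n)
  case (Suc m)
  have "D (f ^ n) = of_nat n * c * (f ^ m * f)"
    by (simp only: derivation_power[OF D] assms(2) Suc diff_Suc_1 mult_ac)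
  then show ?thesis
    by (simp add: Suc mult_ac)
qed (simp add: derivation_1[OF D])

lemma add_eq_imp_diff_eq: "a + b = c + d \<Longrightarrow> a - c = d - b" for a :: "'a::ab_group_add"
  by (simp add: algebra_simps)

lemma derivation_divide_eigen:
  fixes D :: "'a::field \<Rightarrow> 'a"
  assumes D: "derivation D" and "D a = c * a" "D b = d * b" "b \<noteq> 0"
  shows "D (a / b) = (c - d) * (a / b)"
  using assms(4) by (simp add: derivation_divide[OF D] assms(2,3) field_simps power2_eq_square)

lemma xdiff_xmon:
  assumes "j < 5"
  shows "xvar j * diff_x j (xmon ns) = of_nat (ns ! j) * xmon ns"
proof -
  have "xvar j * diff_x j (xvar i ^ (ns ! i)) = (if i = j then of_nat (ns ! j) else 0) * xvar i ^ (ns ! i)" for i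
    by (subst derivation_power_eigen[OF derivation_xdiff, where c = "if i = j then 1 else 0"])
      (auto simp: diff_x_xvar)
  then have "xvar j * diff_x j (xmon ns) = (\<Sum>i<5. if i = j then of_nat (ns ! j) else 0) * xmon ns"
    unfolding xmon_def by (intro derivation_prod_eigen[OF derivation_xdiff]) auto
  then show ?thesis
    using assms by simp
qed

lemma euler_deriv_eq: "euler_deriv w F = (\<Sum>i<5. of_nat (w ! i) * (xvar i * diff_x i F))"
  by (simp add: euler_deriv_def mult.assoc)

lemma euler_deriv_xmon: "euler_deriv w (xmon ns) = of_nat (\<Sum>i<5. w ! i * ns ! i) * xmon ns"
  by (simp add: euler_deriv_eq xdiff_xmon sum_distrib_right mult.assoc)

lemma xvar_power_eq: "xvar i ^ n = to_fract (Poly_Mapping.single (Poly_Mapping.single i n) 1)"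
  by (induction n) (simp_all add: xvar_def mult_single flip: to_fract_mult single_add)

lemma prod_single:
  "finite I \<Longrightarrow> (\<Prod>i\<in>I. Poly_Mapping.single (f i) 1) = Poly_Mapping.single (sum f I) (1::'b::comm_semiring_1)"
  by (induction I rule: finite_induct) (simp_all add: mult_single)

lemma to_fract_prod: "to_fract (prod f I) = (\<Prod>i\<in>I. to_fract (f i))"
  by (induction I rule: infinite_finite_induct) simp_all

lemma xmon_eq: "xmon ns = to_fract (Poly_Mapping.single (\<Sum>i<5. Poly_Mapping.single i (ns ! i)) 1)"
  by (simp add: xmon_def xvar_power_eq flip: prod_single to_fract_prod)

lemma weighted_homogeneous_xmon:
  "weighted_homogeneous w (\<Sum>i<5. w ! i * ns ! i)
     (Poly_Mapping.single (\<Sum>i<5. Poly_Mapping.single i (ns ! i)) 1)"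
proof -
  have *: "Poly_Mapping.lookup (\<Sum>i<5. Poly_Mapping.single i (ns ! i)) j = (if j < 5 then ns ! j else 0)" for j
    by (simp add: lookup_sum lookup_single when_def)
  then have "Poly_Mapping.keys (\<Sum>i<5. Poly_Mapping.single i (ns ! i)) \<subseteq> {..<5}"
    by (auto simp: in_keys_iff split: if_splits)
  then show ?thesis
    by (simp add: weighted_homogeneous_def * del: sum.lessThan_Suc)
qed

lemma xdiff_Q:
  assumes "j < 5"
  shows "xvar j * diff_x j (Q k w)
    = of_nat (k div w ! j) * xvar j ^ (k div w ! j) - of_nat k * psi * (\<Prod>i<5. xvar i)"
proof -
  note D = derivation_xdiff[of j]
  have pw: "xvar j * diff_x j (xvar i ^ n) = (if i = j then of_nat n * xvar j ^ n else 0)" for i n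
    by (subst derivation_power_eigen[OF derivation_xdiff, where c = "if i = j then 1 else 0"])
      (auto simp: diff_x_xvar)
  have "xvar j * diff_x j (\<Prod>i<5. xvar i) = (\<Prod>i<5. xvar i)"
    using xdiff_xmon[OF assms, of "replicate 5 1"] assms by (simp add: xmon_def)
  moreover have "xvar j * diff_x j (of_nat k * psi) = 0"
    by (subst diff_x_const) auto
  ultimately show ?thesis
    unfolding Q_def derivation_diff[OF D] derivation_sum[OF D] derivation_mult[OF D, of "of_nat k * psi" "\<Prod>i<5. xvar i"] pw
    using assms by simp
qed

lemma euler_deriv_Q:
  assumes "admissible k w"
  shows "euler_deriv w (Q k w) = of_nat k * Q k w"
proof -
  have *: "w ! i * (k div w ! i) = k" if "i < 5" for i
    using assms that unfolding admissible_def by (metis dvd_mult_div_cancel)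
  have "euler_deriv w (Q k w) = (\<Sum>i<5. of_nat k * xvar i ^ (k div w ! i)
      - of_nat (w ! i) * (of_nat k * psi * (\<Prod>i<5. xvar i)))"
    unfolding euler_deriv_eq
    by (intro sum.cong refl)
      (simp add: xdiff_Q right_diff_distrib * flip: of_nat_mult mult.assoc)
  also have "\<dots> = of_nat k * (\<Sum>i<5. xvar i ^ (k div w ! i)) - of_nat k * (of_nat k * psi * (\<Prod>i<5. xvar i))"
    using assms by (simp add: sum_subtractf admissible_def flip: sum_distrib_left sum_distrib_right of_nat_sum)
  finally show ?thesis
    by (simp add: Q_def algebra_simps)
qed

text \<open>Applying x_0 d/dx_0 and then x_1 d/dx_1 to Q kills every pure power and leaves - k psi
  x_0 ... x_4, which is not zero.\<close>

lemma Q_nonzero: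
  assumes "admissible k w"
  shows "Q k w \<noteq> 0"
proof
  assume "Q k w = 0"
  moreover have "k > 0"
    using assms by (rule admissible_pos)
  define d where "d = k div w ! 0"
  define p :: rat_fun where "p = (\<Prod>i<5. xvar i)"
  ultimately have "of_nat d * xvar 0 ^ d - of_nat k * psi * p = 0"
    using xdiff_Q[of 0 k w] by (simp add: derivation_0[OF derivation_diff_x] d_def p_def)
  then have "xvar 1 * diff_x 1 (of_nat d * xvar 0 ^ d - of_nat k * psi * p) = 0"
    by (simp add: derivation_0[OF derivation_diff_x])
  moreover have "xvar 1 * diff_x 1 p = p"
    using xdiff_xmon[of 1 "replicate 5 1"] by (simp add: xmon_def p_def)
  moreover have "diff_x 1 psi = 0"
    by (rule diff_x_const) auto
  ultimately have "of_nat k * psi * p = 0"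
    by (simp add: derivation_diff[OF derivation_diff_x] derivation_mult[OF derivation_diff_x]
        derivation_power[OF derivation_diff_x] diff_x_xvar derivation_of_nat[OF derivation_diff_x] algebra_simps)
  then show False
    using \<open>k > 0\<close> by (simp add: p_def)
qed


text \<open>A Griffiths form with a single nonzero entry A_j = x^n has the x_j-derivative of x^n /
  Q^l as its whole divergence. The degree condition is exactly what makes A_j of the prescribed
  degree and x^n / Q^l an Euler eigenvector with eigenvalue k_j - k.\<close>

lemma exact_monomial:
  assumes kw: "admissible k w" and j: "j < 5" and l: "l \<ge> 1"
    and deg: "(\<Sum>i<5. w ! i * ns ! i) + k = l * k + w ! j"
  shows "exact k w (diff_x j (xmon ns / Q k w ^ l))"
proof -
  define A where "A i = (if i = j then Poly_Mapping.single (\<Sum>i<5. Poly_Mapping.single i (ns ! i)) 1 else 0 :: Cpsi_poly)" for i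
  have A: "to_fract (A i) = (if i = j then xmon ns else 0)" for i
    by (simp add: A_def xmon_eq)
  have "euler_deriv w (Q k w ^ l) = of_nat (l * k) * Q k w ^ l"
    using derivation_power_eigen[OF derivation_euler_deriv euler_deriv_Q[OF kw]] by simp
  then have "euler_deriv w (xmon ns / Q k w ^ l)
      = (of_nat (\<Sum>i<5. w ! i * ns ! i) - of_nat (l * k)) * (xmon ns / Q k w ^ l)"
    using Q_nonzero[OF kw]
    by (intro derivation_divide_eigen[OF derivation_euler_deriv] euler_deriv_xmon) simp_all
  \<comment> \<open>The eigenvalue k_j - k is negative, so the degree condition is carried over as a
    sum before anything is subtracted.\<close>
  moreover have "of_nat (\<Sum>i<5. w ! i * ns ! i) + of_nat k = of_nat (l * k) + (of_nat (w ! j) :: rat_fun)"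
    using arg_cong[OF deg, of "of_nat :: nat \<Rightarrow> rat_fun"] by (simp only: of_nat_add)
  then have "of_nat (\<Sum>i<5. w ! i * ns ! i) - of_nat (l * k) = of_nat (w ! j) - (of_nat k :: rat_fun)"
    by (rule add_eq_imp_diff_eq)
  ultimately have eigen: "euler_deriv w (xmon ns / Q k w ^ l)
      = (of_nat (w ! j) - of_nat k) * (xmon ns / Q k w ^ l)"
    by (simp only:)
  have "ext_deriv (griffiths_form k w l A)
      = - (\<Sum>i<5. diff_x i (to_fract (A i) / Q k w ^ l)) *\<^sub>F Omega w"
  proof (rule ext_deriv_griffiths_form)
    show "k = (\<Sum>i<5. w ! i)"
      using kw by (simp only: admissible_def)
    show "euler_deriv w (to_fract (A i) / Q k w ^ l)
        = (of_nat (w ! i) - of_nat k) * (to_fract (A i) / Q k w ^ l)" for i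
      by (cases "i = j") (simp_all add: A eigen derivation_0[OF derivation_euler_deriv] del: times_divide_eq_right)
  qed
  also have "(\<Sum>i<5. diff_x i (to_fract (A i) / Q k w ^ l))
      = (\<Sum>i<5. if i = j then diff_x j (xmon ns / Q k w ^ l) else 0)"
    by (intro sum.cong refl) (simp add: A derivation_0[OF derivation_diff_x])
  also have "\<dots> = diff_x j (xmon ns / Q k w ^ l)"
    using j by simp
  finally have form: "- diff_x j (xmon ns / Q k w ^ l) *\<^sub>F Omega w
      = ext_deriv (\<Sum>i<(1::nat). griffiths_form k w l A)"
    by simp
  have "weighted_homogeneous w (l * k + w ! i - k) (A i)" for i
  proof (cases "i = j")
    case True
    have "(\<Sum>i<5. w ! i * ns ! i) = l * k + w ! j - k"
      using deg by simp
    with True show ?thesis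
      using weighted_homogeneous_xmon[of w ns] by (simp add: A_def)
  qed (simp add: A_def weighted_homogeneous_def)
  then have "griffiths_form k w l A \<in> griffiths_forms k w"
    using l by (auto simp: griffiths_forms_def)
  then have "exact k w (- diff_x j (xmon ns / Q k w ^ l))"
    unfolding exact_def equiv_mod_exact_def diff_0_right form
    by (intro exI[of _ 1] exI[of _ "\<lambda>_. griffiths_form k w l A"]) simp
  from exact_diff[OF exact_0 this] show ?thesis
    by simp
qed

section \<open>Reduction of the pole order\<close>

text \<open>Since \<open>Omega\<close> has weight k, a monomial of weight n k needs the pole order n
  + 1 to give a form of degree zero. The weight therefore determines the pole order.\<close>

definition wdeg :: "nat list \<Rightarrow> nat list \<Rightarrow> nat" where
  "wdeg w ns = (\<Sum>i<5. w ! i * ns ! i)"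

text \<open>The factorial makes the reduction rules independent of the pole order.\<close>

definition bracket :: "nat \<Rightarrow> nat list \<Rightarrow> nat list \<Rightarrow> rat_fun" where
  "bracket k w ns = of_nat (fact (wdeg w ns div k)) * xmon ns / Q k w ^ (wdeg w ns div k + 1)"

text \<open>Stated with a power of x_j on both sides, the change of one exponent needs neither
  quotients nor a comparison of exponents.\<close>

lemma xmon_update:
  assumes "j < 5" "length ns = 5"
  shows "xmon (ns[j := a]) * xvar j ^ (ns ! j) = xmon ns * xvar j ^ a"
proof -
  have "xmon ms = xvar j ^ (ms ! j) * (\<Prod>i\<in>{..<5} - {j}. xvar i ^ (ms ! i))" for ms
    unfolding xmon_def using assms(1) by (intro prod.remove) auto
  moreover have "(\<Prod>i\<in>{..<5} - {j}. xvar i ^ (ns[j := a] ! i)) = (\<Prod>i\<in>{..<5} - {j}. xvar i ^ (ns ! i))"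
    by (intro prod.cong) auto
  ultimately show ?thesis
    using assms by (simp add: mult_ac)
qed

lemma xmon_map_Suc:
  assumes "length ns = 5"
  shows "xmon (map Suc ns) = xmon ns * (\<Prod>i<5. xvar i)"
proof -
  have "xmon (map Suc ns) = (\<Prod>i<5. xvar i ^ (ns ! i) * xvar i)"
    unfolding xmon_def using assms by (intro prod.cong) (auto simp: mult.commute)
  then show ?thesis
    by (simp only: xmon_def prod.distrib)
qed

lemma wdeg_update:
  assumes "j < 5" "length ns = 5"
  shows "wdeg w (ns[j := a]) + w ! j * ns ! j = wdeg w ns + w ! j * a"
proof -
  have "wdeg w ms = w ! j * ms ! j + (\<Sum>i\<in>{..<5} - {j}. w ! i * ms ! i)" for ms
    unfolding wdeg_def using assms(1) by (intro sum.remove) auto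
  moreover have "(\<Sum>i\<in>{..<5} - {j}. w ! i * ns[j := a] ! i) = (\<Sum>i\<in>{..<5} - {j}. w ! i * ns ! i)"
    by (intro sum.cong) auto
  ultimately show ?thesis
    using assms by simp
qed

lemma wdeg_map_Suc: "length ns = 5 \<Longrightarrow> wdeg w (map Suc ns) = wdeg w ns + (\<Sum>i<5. w ! i)"
proof -
  assume "length ns = 5"
  then have "wdeg w (map Suc ns) = (\<Sum>i<5. w ! i * ns ! i + w ! i)"
    unfolding wdeg_def by (intro sum.cong) auto
  then show ?thesis
    by (simp only: wdeg_def sum.distrib)
qed

lemma wdeg_reduction:
  assumes kw: "admissible k w" and j: "j < 5" and ns: "length ns = 5"
    and deg: "wdeg w ns = n * k + w ! j"
  shows "wdeg w (ns[j := ns ! j + k div w ! j - 1]) = Suc n * k"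
    and "wdeg w ((map Suc ns)[j := ns ! j]) = Suc n * k"
    and "ns ! j > 0 \<Longrightarrow> wdeg w (ns[j := ns ! j - 1]) = n * k"
proof -
  have wj: "w ! j > 0" "w ! j * (k div w ! j) = k"
    using kw j unfolding admissible_def by (blast, metis dvd_mult_div_cancel)
  then have "k div w ! j > 0"
    using admissible_pos[OF kw] by (metis mult_0_right neq0_conv)
  then obtain d where d: "k div w ! j = Suc d"
    by (metis gr0_implies_Suc)
  then have k: "k = w ! j + w ! j * d"
    using wj by simp
  show "wdeg w (ns[j := ns ! j + k div w ! j - 1]) = Suc n * k"
    using wdeg_update[OF j ns, of w "ns ! j + d"] deg k wj(1) by (simp add: d algebra_simps)
  show "wdeg w ((map Suc ns)[j := ns ! j]) = Suc n * k"
    using wdeg_update[OF j, of "map Suc ns" w "ns ! j"] wdeg_map_Suc[OF ns, of w] deg j ns kw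
    by (simp add: admissible_def)
  show "wdeg w (ns[j := ns ! j - 1]) = n * k" if pos: "ns ! j > 0"
  proof -
    obtain m where "ns ! j = Suc m"
      using pos gr0_implies_Suc by blast
    then show ?thesis
      using wdeg_update[OF j ns, of w m] deg wj(1) by simp
  qed
qed

text \<open>This is \<open>exact_monomial\<close> at pole order n + 1, multiplied by - n! / d_j. The
  derivative of 1 / Q^(n + 1) brings in x_j^(d_j) and psi x_0 ... x_4 at pole order n + 2, the
  derivative of the monomial stays at n + 1, and k / d_j = k_j gives the coefficients.\<close>

lemma exact_reduction:
  assumes kw: "admissible k w" and j: "j < 5" and ns: "length ns = 5"
    and deg: "wdeg w ns = n * k + w ! j"
  shows "exact k w (bracket k w (ns[j := ns ! j + k div w ! j - 1])
    - (of_nat (w ! j) * psi * bracket k w ((map Suc ns)[j := ns ! j])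
       + of_nat (w ! j) * of_nat (ns ! j) / of_nat k * bracket k w (ns[j := ns ! j - 1])))"
proof -
  define d X Y Z where "d = k div w ! j" and "X = xmon (ns[j := ns ! j + d - 1])"
    and "Y = xmon ((map Suc ns)[j := ns ! j])" and "Z = xmon (ns[j := ns ! j - 1])"
  define M q x where "M = xmon ns" and "q = Q k w" and "x = xvar j"
  note wdeg = wdeg_reduction[OF assms]
  have k: "k > 0"
    using kw by (rule admissible_pos)
  have q: "q \<noteq> 0" and x: "x \<noteq> 0"
    using Q_nonzero[OF kw] by (simp_all add: q_def x_def)
  have wj: "w ! j > 0" "w ! j * d = k"
    using kw j unfolding admissible_def d_def by (blast, metis dvd_mult_div_cancel)
  then have "d > 0"
    using k by (metis mult_0_right neq0_conv)
  have X: "X * x = M * x ^ d"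
  proof -
    have "X * x ^ (ns ! j) * x = M * x ^ (ns ! j + d - 1) * x"
      using xmon_update[OF j ns] by (simp add: X_def M_def x_def)
    also have "\<dots> = (M * x ^ d) * x ^ (ns ! j)"
      using \<open>d > 0\<close> by (simp add: power_add mult_ac flip: power_Suc2 power_Suc)
    finally show ?thesis
      using x by (simp add: mult_ac)
  qed
  have Y: "Y * x = M * (\<Prod>i<5. xvar i)"
    using xmon_update[OF j, of "map Suc ns" "ns ! j"] ns j x xmon_map_Suc[OF ns]
    by (simp add: Y_def M_def x_def mult_ac)
  \<comment> \<open>For exponent zero the truncated \<open>ns ! j - 1\<close> gives the wrong
    monomial, but its coefficient vanishes; hence the factor on both sides.\<close>
  have Z: "of_nat (ns ! j) * Z * x = of_nat (ns ! j) * M"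
  proof (cases "ns ! j")
    case (Suc m)
    then show ?thesis
      using xmon_update[OF j ns, of m] x by (simp add: Z_def M_def x_def mult_ac)
  qed simp
  \<comment> \<open>The computation is made for x_j d/dx_j, of which monomials are eigenvectors; the
    factor x_j is cancelled at the end.\<close>
  have "x * diff_x j (M / q ^ (n + 1)) = x * diff_x j M / q ^ (n + 1)
      - M * (of_nat (n + 1) * q ^ n * (x * diff_x j q)) / (q ^ (n + 1))\<^sup>2"
    using derivation_divide[OF derivation_xdiff[of j], of "q ^ (n + 1)" M] q
    by (simp only: derivation_power[OF derivation_xdiff] x_def add_diff_cancel_right') simp
  also have "x * diff_x j M = of_nat (ns ! j) * M"
    using j by (simp add: x_def M_def xdiff_xmon)
  also have "x * diff_x j q = of_nat d * x ^ d - of_nat k * psi * (\<Prod>i<5. xvar i)"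
    using j by (simp add: x_def q_def d_def xdiff_Q)
  also have "M * (of_nat (n + 1) * q ^ n * \<dots>) / (q ^ (n + 1))\<^sup>2
      = of_nat (n + 1) * (of_nat d * (M * x ^ d) - of_nat k * psi * (M * (\<Prod>i<5. xvar i))) / q ^ (n + 2)"
    using q by (simp add: power2_eq_square field_simps)
  also have "of_nat (ns ! j) * M / q ^ (n + 1) - \<dots> = x * (of_nat (ns ! j) * Z / q ^ (n + 1)
      - of_nat (n + 1) * (of_nat d * X - of_nat k * psi * Y) / q ^ (n + 2))"
    unfolding X[symmetric] Y[symmetric] Z[symmetric] by (simp only: algebra_simps times_divide_eq_right times_divide_eq_left)
  finally have "x * diff_x j (M / q ^ (n + 1)) = x * (of_nat (ns ! j) * Z / q ^ (n + 1)
      - of_nat (n + 1) * (of_nat d * X - of_nat k * psi * Y) / q ^ (n + 2))" .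
  then have diff: "diff_x j (M / q ^ (n + 1)) = of_nat (ns ! j) * Z / q ^ (n + 1)
      - of_nat (n + 1) * (of_nat d * X - of_nat k * psi * Y) / q ^ (n + 2)"
    using x by simp
  have bX: "bracket k w (ns[j := ns ! j + k div w ! j - 1]) = of_nat (n + 1) * of_nat (fact n) * X / q ^ (n + 2)"
    using wdeg(1) k by (simp add: bracket_def X_def q_def d_def distrib_right)
  have bY: "bracket k w ((map Suc ns)[j := ns ! j]) = of_nat (n + 1) * of_nat (fact n) * Y / q ^ (n + 2)"
    using wdeg(2) k by (simp add: bracket_def Y_def q_def distrib_right)
  have bZ: "of_nat (ns ! j) * bracket k w (ns[j := ns ! j - 1])
      = of_nat (ns ! j) * (of_nat (fact n) * Z / q ^ (n + 1))"
    using wdeg(3) k by (cases "ns ! j = 0") (simp_all add: bracket_def Z_def q_def)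
  have "exact k w (diff_x j (M / q ^ (n + 1)))"
    unfolding M_def q_def
    using deg j by (intro exact_monomial[OF kw]) (simp_all add: wdeg_def algebra_simps)
  then have "exact k w (- of_nat (fact n) / of_nat d * diff_x j (M / q ^ (n + 1)))"
    by (rule exact_scale) (intro is_const_divide is_const_uminus is_const_of_nat)
  also have "- of_nat (fact n) / of_nat d * diff_x j (M / q ^ (n + 1))
    = bracket k w (ns[j := ns ! j + k div w ! j - 1])
      - (of_nat k * psi * bracket k w ((map Suc ns)[j := ns ! j])
        + of_nat (ns ! j) * bracket k w (ns[j := ns ! j - 1])) / of_nat d"
    using \<open>d > 0\<close> unfolding diff bX bY bZ
    by (simp add: field_simps del: of_nat_Suc of_nat_fact) (simp add: diff_divide_distrib)
  also have "(of_nat k * psi * bracket k w ((map Suc ns)[j := ns ! j])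
        + of_nat (ns ! j) * bracket k w (ns[j := ns ! j - 1])) / of_nat d
     = of_nat (w ! j) * psi * bracket k w ((map Suc ns)[j := ns ! j])
       + of_nat (w ! j) * of_nat (ns ! j) / of_nat k * bracket k w (ns[j := ns ! j - 1])"
    using \<open>d > 0\<close> wj(1) by (simp add: field_simps flip: wj(2))
  finally show ?thesis .
qed

definition reduces :: "nat \<Rightarrow> nat list \<Rightarrow> nat list \<Rightarrow> rat_fun list \<Rightarrow> bool" where
  "reduces k w ns cs \<longleftrightarrow> length cs = 5 \<and> (\<forall>i<5. is_const (cs ! i))
     \<and> exact k w (bracket k w ns - (\<Sum>i<5. cs ! i * bracket k w (replicate 5 i)))"

lemma reduces_replicate:
  assumes "a < 5"
  shows "reduces k w (replicate 5 a) ((replicate 5 0)[a := 1])"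
proof -
  have "(\<Sum>i<5. (replicate 5 0)[a := 1] ! i * bracket k w (replicate 5 i))
      = (\<Sum>i<5. if i = a then bracket k w (replicate 5 a) else 0)"
    using assms by (intro sum.cong) (auto simp: nth_list_update)
  then show ?thesis
    using assms by (auto simp: reduces_def exact_0 nth_list_update)
qed

lemma reduces_comb:
  assumes "reduces k w Y cs" "reduces k w Z ds" "is_const \<alpha>" "is_const \<beta>"
    and X: "exact k w (bracket k w X - (\<alpha> * bracket k w Y + \<beta> * bracket k w Z))"
  shows "reduces k w X (map2 (\<lambda>c d. \<alpha> * c + \<beta> * d) cs ds)"
proof -
  let ?b = "\<lambda>i. bracket k w (replicate 5 i)"
  have len: "length cs = 5" "length ds = 5"
    and c: "\<forall>i<5. is_const (cs ! i)" "\<forall>i<5. is_const (ds ! i)"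
    and Y: "exact k w (bracket k w Y - (\<Sum>i<5. cs ! i * ?b i))"
    and Z: "exact k w (bracket k w Z - (\<Sum>i<5. ds ! i * ?b i))"
    using assms(1,2) by (auto simp: reduces_def)
  have "(\<Sum>i<5. map2 (\<lambda>c d. \<alpha> * c + \<beta> * d) cs ds ! i * ?b i)
      = (\<Sum>i<5. \<alpha> * (cs ! i * ?b i) + \<beta> * (ds ! i * ?b i))"
    using len by (intro sum.cong) (auto simp: algebra_simps)
  also have "\<dots> = \<alpha> * (\<Sum>i<5. cs ! i * ?b i) + \<beta> * (\<Sum>i<5. ds ! i * ?b i)"
    by (simp only: sum.distrib sum_distrib_left)
  finally have "bracket k w X - (\<Sum>i<5. map2 (\<lambda>c d. \<alpha> * c + \<beta> * d) cs ds ! i * ?b i)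
      = bracket k w X - (\<alpha> * bracket k w Y + \<beta> * bracket k w Z)
        + \<alpha> * (bracket k w Y - (\<Sum>i<5. cs ! i * ?b i))
        + \<beta> * (bracket k w Z - (\<Sum>i<5. ds ! i * ?b i))"
    by (simp add: algebra_simps)
  then have "exact k w (bracket k w X - (\<Sum>i<5. map2 (\<lambda>c d. \<alpha> * c + \<beta> * d) cs ds ! i * ?b i))"
    using X exact_scale[OF Y assms(3)] exact_scale[OF Z assms(4)] by (simp only:) (intro exact_add)
  then show ?thesis
    using len c assms(3,4) by (auto simp: reduces_def)
qed

lemma reduces_step:
  assumes kw: "admissible k w" "j < 5" "length ns = 5" "wdeg w ns = n * k + w ! j"
    and Y: "reduces k w ((map Suc ns)[j := ns ! j]) cs"
    and Z: "reduces k w (ns[j := ns ! j - 1]) ds"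
  shows "reduces k w (ns[j := ns ! j + k div w ! j - 1])
    (map2 (\<lambda>c d. of_nat (w ! j) * psi * c + of_nat (w ! j) * of_nat (ns ! j) / of_nat k * d) cs ds)"
  by (rule reduces_comb[OF Y Z _ _ exact_reduction[OF kw]])
    (intro is_const_mult is_const_divide is_const_of_nat is_const_psi)+

text \<open>If x_j is absent from the differentiated monomial, the term of lower pole order
  disappears and need not be reduced.\<close>

lemma reduces_step_0:
  assumes kw: "admissible k w" "j < 5" "length ns = 5" "wdeg w ns = n * k + w ! j" and "ns ! j = 0"
    and Y: "reduces k w ((map Suc ns)[j := ns ! j]) cs"
  shows "reduces k w (ns[j := ns ! j + k div w ! j - 1]) (map (\<lambda>c. of_nat (w ! j) * psi * c) cs)"
proof -
  have "reduces k w (ns[j := ns ! j + k div w ! j - 1])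
      (map2 (\<lambda>c d. of_nat (w ! j) * psi * c + 0 * d) cs cs)"
    using exact_reduction[OF kw] \<open>ns ! j = 0\<close>
    by (intro reduces_comb[OF Y Y]) (auto intro!: is_const_mult is_const_of_nat is_const_psi is_const_0)
  then show ?thesis
    by (simp add: zip_same_conv_map comp_def)
qed

text \<open>Read backwards, the relation reduces monomials outside the reach of \<open>exact_reduction\<close>
  by means of powers of \<open>x_0 x_1 x_2 x_3 x_4\<close> of the same weight.\<close>

lemma exact_solve:
  assumes kw: "admissible k w" "j < 5" "length ns = 5" "wdeg w ns = n * k + w ! j"
  shows "exact k w (bracket k w ((map Suc ns)[j := ns ! j])
     - (1 / (of_nat (w ! j) * psi) * bracket k w (ns[j := ns ! j + k div w ! j - 1])
       + (- of_nat (ns ! j) / (of_nat k * psi)) * bracket k w (ns[j := ns ! j - 1])))"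
proof -
  let ?c = "- 1 / (of_nat (w ! j) * psi)"
  have "w ! j > 0" "k > 0"
    using kw admissible_pos by (auto simp: admissible_def)
  have "exact k w (?c * (bracket k w (ns[j := ns ! j + k div w ! j - 1])
    - (of_nat (w ! j) * psi * bracket k w ((map Suc ns)[j := ns ! j])
       + of_nat (w ! j) * of_nat (ns ! j) / of_nat k * bracket k w (ns[j := ns ! j - 1]))))"
    by (rule exact_scale[OF exact_reduction[OF kw]]) auto
  also have "?c * (bracket k w (ns[j := ns ! j + k div w ! j - 1])
    - (of_nat (w ! j) * psi * bracket k w ((map Suc ns)[j := ns ! j])
       + of_nat (w ! j) * of_nat (ns ! j) / of_nat k * bracket k w (ns[j := ns ! j - 1])))
   = bracket k w ((map Suc ns)[j := ns ! j])
     - (1 / (of_nat (w ! j) * psi) * bracket k w (ns[j := ns ! j + k div w ! j - 1])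
       + (- of_nat (ns ! j) / (of_nat k * psi)) * bracket k w (ns[j := ns ! j - 1]))"
    using \<open>w ! j > 0\<close> \<open>k > 0\<close> by (simp add: field_simps)
  finally show ?thesis .
qed

lemma omega_eq_bracket:
  assumes "admissible k w"
  shows "omega k w (Suc l) = ((-1) ^ l * psi ^ Suc l * bracket k w (replicate 5 l)) *\<^sub>F Omega w"
proof -
  have "wdeg w (replicate 5 l) = l * (\<Sum>i<5. w ! i)"
    unfolding wdeg_def sum_distrib_left by (intro sum.cong) auto
  then have "wdeg w (replicate 5 l) div k = l"
    using assms admissible_pos[OF assms] by (simp add: admissible_def)
  moreover have "xmon (replicate 5 l) = (\<Prod>i<5. xvar i ^ l)"
    unfolding xmon_def by (intro prod.cong) auto
  ultimately show ?thesis
    by (simp add: omega_def bracket_def mult_ac)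
qed

lemma sum_upto_4: "(\<Sum>l = 1..4. f l) = (\<Sum>l<4::nat. f (Suc l))" for f :: "nat \<Rightarrow> 'a::comm_monoid_add"
  by (intro sum.reindex_bij_witness[of _ Suc "\<lambda>l. l - 1"]) auto

text \<open>The term with \<open>cs ! 4\<close> is moved to the left and the relation is divided by
  \<open>1 - cs ! 4\<close>. Since omega_(l+1) is (-1)^l psi^(l+1) times the bracket of the l-th
  power, the hypothesis on \<open>e\<close> is the comparison of coefficients, cleared of
  denominators.\<close>

lemma equiv_mod_exact_omega5:
  assumes kw: "admissible k w" and red: "reduces k w [4, 4, 4, 4, 4] cs" and c4: "cs ! 4 \<noteq> 1"
    and eps: "\<And>l. l < 4 \<Longrightarrow> e (Suc l) * ((-1) ^ l * psi ^ Suc l * (1 - cs ! 4)) = psi ^ 5 * cs ! l"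
  shows "equiv_mod_exact k w (omega k w 5) (\<Sum>l = 1..4. e l *\<^sub>F omega k w l)"
proof -
  let ?b = "\<lambda>i. bracket k w (replicate 5 i)"
  have five: "{..<5::nat} = insert 4 {..<4}" and r4: "[4, 4, 4, 4, 4] = replicate 5 (4::nat)"
    by (auto simp: eval_nat_numeral)
  have "exact k w (?b 4 - (\<Sum>i<5. cs ! i * ?b i))" and const: "is_const (cs ! 4)"
    using red unfolding reduces_def r4 by auto
  then have "exact k w (psi ^ 5 / (1 - cs ! 4) * (?b 4 - (\<Sum>i<5. cs ! i * ?b i)))"
    by (intro exact_scale is_const_divide is_const_power is_const_psi is_const_diff is_const_1)
  also have "?b 4 - (\<Sum>i<5. cs ! i * ?b i) = (1 - cs ! 4) * ?b 4 - (\<Sum>i<4. cs ! i * ?b i)"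
    unfolding five by (simp add: algebra_simps)
  also have "psi ^ 5 / (1 - cs ! 4) * \<dots>
      = psi ^ 5 * ?b 4 - (\<Sum>i<4. psi ^ 5 * cs ! i / (1 - cs ! 4) * ?b i)"
    using c4 by (simp add: right_diff_distrib sum_distrib_left mult.assoc)
  also have "(\<Sum>i<4. psi ^ 5 * cs ! i / (1 - cs ! 4) * ?b i)
      = (\<Sum>l<4. e (Suc l) * ((-1) ^ l * psi ^ Suc l * ?b l))"
  proof (intro sum.cong refl)
    fix l :: nat
    assume "l \<in> {..<4}"
    then have "psi ^ 5 * cs ! l = e (Suc l) * ((-1) ^ l * psi ^ Suc l) * (1 - cs ! 4)"
      using eps[of l] by (simp add: mult.assoc)
    then show "psi ^ 5 * cs ! l / (1 - cs ! 4) * ?b l = e (Suc l) * ((-1) ^ l * psi ^ Suc l * ?b l)"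
      using c4 by (simp add: mult.assoc)
  qed
  finally have "exact k w (psi ^ 5 * ?b 4 - (\<Sum>l<4. e (Suc l) * ((-1) ^ l * psi ^ Suc l * ?b l)))" .
  moreover have omega5: "omega k w 5 = (psi ^ 5 * ?b 4) *\<^sub>F Omega w"
    using omega_eq_bracket[OF kw, of 4] by (simp add: numeral_eq_Suc)
  moreover have "(psi ^ 5 * ?b 4 - (\<Sum>l<4. e (Suc l) * ((-1) ^ l * psi ^ Suc l * ?b l))) *\<^sub>F Omega w
      = omega k w 5 - (\<Sum>l = 1..4. e l *\<^sub>F omega k w l)"
    unfolding omega5 sum_upto_4 omega_eq_bracket[OF kw]
    by (simp add: scale_form_def fun_eq_iff sum_fun_apply left_diff_distrib sum_distrib_right mult.assoc)
  ultimately show ?thesis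
    by (simp add: exact_def equiv_mod_exact_def)
qed

lemma wdeg_list: "wdeg [a, b, c, d, e] [a', b', c', d', e'] = a * a' + b * b' + c * c' + d * d' + e * e'"
  by (simp add: wdeg_def eval_nat_numeral)

lemma admissible_list:
  "admissible k [a, b, c, d, e] \<longleftrightarrow> k = a + b + c + d + e \<and> a > 0 \<and> b > 0 \<and> c > 0 \<and> d > 0 \<and> e > 0
     \<and> a dvd k \<and> b dvd k \<and> c dvd k \<and> d dvd k \<and> e dvd k"
  by (auto simp: admissible_def eval_nat_numeral All_less_Suc)

text \<open>With the three monomials and the coefficients as variables of their own, the rule
  applies to explicit lists, and all side conditions become evaluations.\<close>

lemma reduces_stepI:
  assumes "admissible k w" "reduces k w Y cs" "reduces k w Z ds"
    and "j < 5" "length ns = 5" "wdeg w ns = n * k + w ! j"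
    and "Y = (map Suc ns)[j := ns ! j]" "Z = ns[j := ns ! j - 1]" "X = ns[j := ns ! j + k div w ! j - 1]"
    and "es = map2 (\<lambda>c d. of_nat (w ! j) * psi * c + of_nat (w ! j) * of_nat (ns ! j) / of_nat k * d) cs ds"
  shows "reduces k w X es"
  using reduces_step[of k w j ns n cs ds] assms by simp

lemma reduces_step_0I:
  assumes "admissible k w" "reduces k w Y cs"
    and "j < 5" "length ns = 5" "wdeg w ns = n * k + w ! j" "ns ! j = 0"
    and "Y = (map Suc ns)[j := ns ! j]" "X = ns[j := ns ! j + k div w ! j - 1]"
    and "es = map (\<lambda>c. of_nat (w ! j) * psi * c) cs"
  shows "reduces k w X es"
  using reduces_step_0[of k w j ns n cs] assms by simp

lemma reduces_solveI:
  assumes kw: "admissible k w" and X: "reduces k w X cs" and Z: "reduces k w Z ds"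
    and ns: "j < 5" "length ns = 5" "wdeg w ns = n * k + w ! j"
    and eqs: "X = ns[j := ns ! j + k div w ! j - 1]" "Z = ns[j := ns ! j - 1]" "Y = (map Suc ns)[j := ns ! j]"
    and "es = map2 (\<lambda>c d. 1 / (of_nat (w ! j) * psi) * c + (- of_nat (ns ! j) / (of_nat k * psi)) * d) cs ds"
  shows "reduces k w Y es"
  unfolding assms(10) using exact_solve[OF kw ns]
  by (intro reduces_comb[OF X Z]) (auto simp only: eqs intro!: is_const_mult is_const_divide
      is_const_uminus is_const_of_nat is_const_psi is_const_1)

lemma reduces_solve_0I:
  assumes kw: "admissible k w" and X: "reduces k w X cs"
    and ns: "j < 5" "length ns = 5" "wdeg w ns = n * k + w ! j" and "ns ! j = 0"
    and eqs: "X = ns[j := ns ! j + k div w ! j - 1]" "Y = (map Suc ns)[j := ns ! j]"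
    and "es = map (\<lambda>c. c / (of_nat (w ! j) * psi)) cs"
  shows "reduces k w Y es"
proof -
  have "reduces k w Y (map2 (\<lambda>c d. 1 / (of_nat (w ! j) * psi) * c + 0 * d) cs cs)"
    using exact_solve[OF kw ns] assms(6)
    by (intro reduces_comb[OF X X]) (auto simp: eqs intro!: is_const_mult is_const_divide
      is_const_of_nat is_const_psi is_const_1)
  then show ?thesis
    by (simp add: assms(9) zip_same_conv_map comp_def)
qed

section \<open>The explicit reductions in the four families\<close>

lemmas reduces_eval = wdeg_list numeral_2_eq_2[symmetric] field_simps power_numeral_reduce

lemma reduces_powers:
  "reduces k w [0, 0, 0, 0, 0] [1, 0, 0, 0, 0]"
  "reduces k w [1, 1, 1, 1, 1] [0, 1, 0, 0, 0]"
  "reduces k w [2, 2, 2, 2, 2] [0, 0, 1, 0, 0]"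
  "reduces k w [3, 3, 3, 3, 3] [0, 0, 0, 1, 0]"
  "reduces k w [4, 4, 4, 4, 4] [0, 0, 0, 0, 1]"
  using reduces_replicate[of 0 k w] reduces_replicate[of 1 k w] reduces_replicate[of 2 k w]
    reduces_replicate[of 3 k w] reduces_replicate[of 4 k w]
  by (simp_all add: numeral_eq_Suc)

text \<open>Best read from the bottom upwards: x_0, x_1, x_2, x_3, x_4 are used once each, in this
  order. All d_j are equal, and every branch ends in a power of x_0 ... x_4 by the forward rule
  alone.\<close>

lemma reduces_5: "reduces 5 [1, 1, 1, 1, 1] [4, 4, 4, 4, 4]
    [psi / 625, 3 * psi ^ 2 / 25, psi ^ 3, 2 * psi ^ 4, psi ^ 5]"
proof -
  let ?R = "reduces 5 [1, 1, 1, 1, 1]"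
  have kw: "admissible 5 [1, 1, 1, 1, 1]"
    by (simp add: admissible_list)
  note base0 = reduces_powers(1)[of 5 "[1, 1, 1, 1, 1]"]
    and base1 = reduces_powers(2)[of 5 "[1, 1, 1, 1, 1]"]
    and base2 = reduces_powers(3)[of 5 "[1, 1, 1, 1, 1]"]
    and base3 = reduces_powers(4)[of 5 "[1, 1, 1, 1, 1]"]
    and base4 = reduces_powers(5)[of 5 "[1, 1, 1, 1, 1]"]
  have r_3_3_3_3_8: "?R [3, 3, 3, 3, 8]
      [0, 0, 0, 4 / 5, psi]"
    by (rule reduces_stepI[OF kw base4 base3, of 4 "[3, 3, 3, 3, 4]" 3])
      (simp_all add: reduces_eval)
  have r_2_2_2_2_7: "?R [2, 2, 2, 2, 7]
      [0, 0, 3 / 5, psi, 0]"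
    by (rule reduces_stepI[OF kw base3 base2, of 4 "[2, 2, 2, 2, 3]" 2])
      (simp_all add: reduces_eval)
  have r_2_2_2_7_7: "?R [2, 2, 2, 7, 7]
      [0, 0, 9 / 25, 7 * psi / 5, psi ^ 2]"
    by (rule reduces_stepI[OF kw r_3_3_3_3_8 r_2_2_2_2_7, of 3 "[2, 2, 2, 3, 7]" 3])
      (simp_all add: reduces_eval)
  have r_1_1_1_1_6: "?R [1, 1, 1, 1, 6]
      [0, 2 / 5, psi, 0, 0]"
    by (rule reduces_stepI[OF kw base2 base1, of 4 "[1, 1, 1, 1, 2]" 1])
      (simp_all add: reduces_eval)
  have r_1_1_1_6_6: "?R [1, 1, 1, 6, 6]
      [0, 4 / 25, psi, psi ^ 2, 0]"
    by (rule reduces_stepI[OF kw r_2_2_2_2_7 r_1_1_1_1_6, of 3 "[1, 1, 1, 2, 6]" 2])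
      (simp_all add: reduces_eval)
  have r_1_1_6_6_6: "?R [1, 1, 6, 6, 6]
      [0, 8 / 125, 19 * psi / 25, 9 * psi ^ 2 / 5, psi ^ 3]"
    by (rule reduces_stepI[OF kw r_2_2_2_7_7 r_1_1_1_6_6, of 2 "[1, 1, 2, 6, 6]" 3])
      (simp_all add: reduces_eval)
  have r_0_0_0_0_5: "?R [0, 0, 0, 0, 5]
      [1 / 5, psi, 0, 0, 0]"
    by (rule reduces_stepI[OF kw base1 base0, of 4 "[0, 0, 0, 0, 1]" 0])
      (simp_all add: reduces_eval)
  have r_0_0_0_5_5: "?R [0, 0, 0, 5, 5]
      [1 / 25, 3 * psi / 5, psi ^ 2, 0, 0]"
    by (rule reduces_stepI[OF kw r_1_1_1_1_6 r_0_0_0_0_5, of 3 "[0, 0, 0, 1, 5]" 1])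
      (simp_all add: reduces_eval)
  have r_0_0_5_5_5: "?R [0, 0, 5, 5, 5]
      [1 / 125, 7 * psi / 25, 6 * psi ^ 2 / 5, psi ^ 3, 0]"
    by (rule reduces_stepI[OF kw r_1_1_1_6_6 r_0_0_0_5_5, of 2 "[0, 0, 1, 5, 5]" 2])
      (simp_all add: reduces_eval)
  have r_0_5_5_5_5: "?R [0, 5, 5, 5, 5]
      [1 / 625, 3 * psi / 25, psi ^ 2, 2 * psi ^ 3, psi ^ 4]"
    by (rule reduces_stepI[OF kw r_1_1_6_6_6 r_0_0_5_5_5, of 1 "[0, 1, 5, 5, 5]" 3])
      (simp_all add: reduces_eval)
  have top: "?R [4, 4, 4, 4, 4]
      [psi / 625, 3 * psi ^ 2 / 25, psi ^ 3, 2 * psi ^ 4, psi ^ 5]"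
    by (rule reduces_step_0I[OF kw r_0_5_5_5_5, of 0 "[0, 4, 4, 4, 4]" 3])
      (simp_all add: reduces_eval)
  show ?thesis
    by (rule top)
qed

text \<open>Here d_0 = 3, and x_0 is used twice before the other variables. This splits off x_0 (x_1
  ... x_4)^4, all of whose exponents are below d_j - 1. It is reached backwards, from the third and
  the second power of x_0 ... x_4.\<close>

lemma reduces_6: "reduces 6 [2, 1, 1, 1, 1] [4, 4, 4, 4, 4]
    [psi ^ 2 / 324, 5 * psi ^ 3 / 18, 25 * psi ^ 4 / 9 - 1 / (18 * psi ^ 2), 20 * psi ^ 5 / 3 + 1 / (3 * psi), 4 * psi ^ 6]"
proof -
  let ?R = "reduces 6 [2, 1, 1, 1, 1]"
  have kw: "admissible 6 [2, 1, 1, 1, 1]"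
    by (simp add: admissible_list)
  note base0 = reduces_powers(1)[of 6 "[2, 1, 1, 1, 1]"]
    and base1 = reduces_powers(2)[of 6 "[2, 1, 1, 1, 1]"]
    and base2 = reduces_powers(3)[of 6 "[2, 1, 1, 1, 1]"]
    and base3 = reduces_powers(4)[of 6 "[2, 1, 1, 1, 1]"]
    and base4 = reduces_powers(5)[of 6 "[2, 1, 1, 1, 1]"]
  have r_0_3_3_3_3: "?R [0, 3, 3, 3, 3]
      [0, 0, 1 / (2 * psi), 0, 0]"
    by (rule reduces_solve_0I[OF kw base2, of 0 "[0, 2, 2, 2, 2]" 1])
      (simp_all add: reduces_eval)
  have r_1_4_4_4_4: "?R [1, 4, 4, 4, 4]
      [0, 0, - 1 / (12 * psi ^ 2), 1 / (2 * psi), 0]"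
    by (rule reduces_solveI[OF kw base3 r_0_3_3_3_3, of 0 "[1, 3, 3, 3, 3]" 2])
      (simp_all add: reduces_eval)
  have r_3_3_3_3_9: "?R [3, 3, 3, 3, 9]
      [0, 0, 0, 2 / 3, psi]"
    by (rule reduces_stepI[OF kw base4 base3, of 4 "[3, 3, 3, 3, 4]" 3])
      (simp_all add: reduces_eval)
  have r_2_2_2_2_8: "?R [2, 2, 2, 2, 8]
      [0, 0, 1 / 2, psi, 0]"
    by (rule reduces_stepI[OF kw base3 base2, of 4 "[2, 2, 2, 2, 3]" 2])
      (simp_all add: reduces_eval)
  have r_2_2_2_8_8: "?R [2, 2, 2, 8, 8]
      [0, 0, 1 / 4, 7 * psi / 6, psi ^ 2]"
    by (rule reduces_stepI[OF kw r_3_3_3_3_9 r_2_2_2_2_8, of 3 "[2, 2, 2, 3, 8]" 3])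
      (simp_all add: reduces_eval)
  have r_1_1_1_1_7: "?R [1, 1, 1, 1, 7]
      [0, 1 / 3, psi, 0, 0]"
    by (rule reduces_stepI[OF kw base2 base1, of 4 "[1, 1, 1, 1, 2]" 1])
      (simp_all add: reduces_eval)
  have r_1_1_1_7_7: "?R [1, 1, 1, 7, 7]
      [0, 1 / 9, 5 * psi / 6, psi ^ 2, 0]"
    by (rule reduces_stepI[OF kw r_2_2_2_2_8 r_1_1_1_1_7, of 3 "[1, 1, 1, 2, 7]" 2])
      (simp_all add: reduces_eval)
  have r_1_1_7_7_7: "?R [1, 1, 7, 7, 7]
      [0, 1 / 27, 19 * psi / 36, 3 * psi ^ 2 / 2, psi ^ 3]"
    by (rule reduces_stepI[OF kw r_2_2_2_8_8 r_1_1_1_7_7, of 2 "[1, 1, 2, 7, 7]" 3])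
      (simp_all add: reduces_eval)
  have r_0_0_0_0_6: "?R [0, 0, 0, 0, 6]
      [1 / 6, psi, 0, 0, 0]"
    by (rule reduces_stepI[OF kw base1 base0, of 4 "[0, 0, 0, 0, 1]" 0])
      (simp_all add: reduces_eval)
  have r_0_0_0_6_6: "?R [0, 0, 0, 6, 6]
      [1 / 36, psi / 2, psi ^ 2, 0, 0]"
    by (rule reduces_stepI[OF kw r_1_1_1_1_7 r_0_0_0_0_6, of 3 "[0, 0, 0, 1, 6]" 1])
      (simp_all add: reduces_eval)
  have r_0_0_6_6_6: "?R [0, 0, 6, 6, 6]
      [1 / 216, 7 * psi / 36, psi ^ 2, psi ^ 3, 0]"
    by (rule reduces_stepI[OF kw r_1_1_1_7_7 r_0_0_0_6_6, of 2 "[0, 0, 1, 6, 6]" 2])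
      (simp_all add: reduces_eval)
  have r_0_6_6_6_6: "?R [0, 6, 6, 6, 6]
      [1 / 1296, 5 * psi / 72, 25 * psi ^ 2 / 36, 5 * psi ^ 3 / 3, psi ^ 4]"
    by (rule reduces_stepI[OF kw r_1_1_7_7_7 r_0_0_6_6_6, of 1 "[0, 1, 6, 6, 6]" 3])
      (simp_all add: reduces_eval)
  have r_2_5_5_5_5: "?R [2, 5, 5, 5, 5]
      [psi / 648, 5 * psi ^ 2 / 36, 25 * psi ^ 3 / 18, 10 * psi ^ 4 / 3, 2 * psi ^ 5]"
    by (rule reduces_step_0I[OF kw r_0_6_6_6_6, of 0 "[0, 5, 5, 5, 5]" 3])
      (simp_all add: reduces_eval)
  have top: "?R [4, 4, 4, 4, 4]
      [psi ^ 2 / 324, 5 * psi ^ 3 / 18, 25 * psi ^ 4 / 9 - 1 / (18 * psi ^ 2), 20 * psi ^ 5 / 3 + 1 / (3 * psi), 4 * psi ^ 6]"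
    by (rule reduces_stepI[OF kw r_2_5_5_5_5 r_1_4_4_4_4, of 0 "[2, 4, 4, 4, 4]" 3])
      (simp_all add: reduces_eval)
  show ?thesis
    by (rule top)
qed

text \<open>Here d_0 = 2, so that x_0 is traded for x_1 ... x_4 four times. The lower terms with
  exponents [2,4,4,4,4], [1,5,5,5,5] and [0,6,6,6,6] split off on the way and are computed
  beforehand by the backward rule.\<close>

lemma reduces_8: "reduces 8 [4, 1, 1, 1, 1] [4, 4, 4, 4, 4]
    [psi ^ 4 / 16, 15 * psi ^ 5 / 2 + 15 / (512 * psi ^ 3), 100 * psi ^ 6 - 15 / (64 * psi ^ 2), 320 * psi ^ 7 + 3 / (4 * psi), 256 * psi ^ 8]"
proof -
  let ?R = "reduces 8 [4, 1, 1, 1, 1]"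
  have kw: "admissible 8 [4, 1, 1, 1, 1]"
    by (simp add: admissible_list)
  note base0 = reduces_powers(1)[of 8 "[4, 1, 1, 1, 1]"]
    and base1 = reduces_powers(2)[of 8 "[4, 1, 1, 1, 1]"]
    and base2 = reduces_powers(3)[of 8 "[4, 1, 1, 1, 1]"]
    and base3 = reduces_powers(4)[of 8 "[4, 1, 1, 1, 1]"]
    and base4 = reduces_powers(5)[of 8 "[4, 1, 1, 1, 1]"]
  have r_0_2_2_2_2: "?R [0, 2, 2, 2, 2]
      [0, 1 / (4 * psi), 0, 0, 0]"
    by (rule reduces_solve_0I[OF kw base1, of 0 "[0, 1, 1, 1, 1]" 0])
      (simp_all add: reduces_eval)
  have r_1_3_3_3_3: "?R [1, 3, 3, 3, 3]
      [0, - 1 / (32 * psi ^ 2), 1 / (4 * psi), 0, 0]"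
    by (rule reduces_solveI[OF kw base2 r_0_2_2_2_2, of 0 "[1, 2, 2, 2, 2]" 1])
      (simp_all add: reduces_eval)
  have r_0_4_4_4_4: "?R [0, 4, 4, 4, 4]
      [0, - 1 / (128 * psi ^ 3), 1 / (16 * psi ^ 2), 0, 0]"
    by (rule reduces_solve_0I[OF kw r_1_3_3_3_3, of 0 "[0, 3, 3, 3, 3]" 1])
      (simp_all add: reduces_eval)
  have r_2_4_4_4_4: "?R [2, 4, 4, 4, 4]
      [0, 1 / (128 * psi ^ 3), - 1 / (16 * psi ^ 2), 1 / (4 * psi), 0]"
    by (rule reduces_solveI[OF kw base3 r_1_3_3_3_3, of 0 "[2, 3, 3, 3, 3]" 2])
      (simp_all add: reduces_eval)
  have r_1_5_5_5_5: "?R [1, 5, 5, 5, 5]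
      [0, 3 / (1024 * psi ^ 4), - 3 / (128 * psi ^ 3), 1 / (16 * psi ^ 2), 0]"
    by (rule reduces_solveI[OF kw r_2_4_4_4_4 r_0_4_4_4_4, of 0 "[1, 4, 4, 4, 4]" 2])
      (simp_all add: reduces_eval)
  have r_0_6_6_6_6: "?R [0, 6, 6, 6, 6]
      [0, 3 / (4096 * psi ^ 5), - 3 / (512 * psi ^ 4), 1 / (64 * psi ^ 3), 0]"
    by (rule reduces_solve_0I[OF kw r_1_5_5_5_5, of 0 "[0, 5, 5, 5, 5]" 2])
      (simp_all add: reduces_eval)
  have r_3_3_3_3_11: "?R [3, 3, 3, 3, 11]
      [0, 0, 0, 1 / 2, psi]"
    by (rule reduces_stepI[OF kw base4 base3, of 4 "[3, 3, 3, 3, 4]" 3])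
      (simp_all add: reduces_eval)
  have r_2_2_2_2_10: "?R [2, 2, 2, 2, 10]
      [0, 0, 3 / 8, psi, 0]"
    by (rule reduces_stepI[OF kw base3 base2, of 4 "[2, 2, 2, 2, 3]" 2])
      (simp_all add: reduces_eval)
  have r_2_2_2_10_10: "?R [2, 2, 2, 10, 10]
      [0, 0, 9 / 64, 7 * psi / 8, psi ^ 2]"
    by (rule reduces_stepI[OF kw r_3_3_3_3_11 r_2_2_2_2_10, of 3 "[2, 2, 2, 3, 10]" 3])
      (simp_all add: reduces_eval)
  have r_1_1_1_1_9: "?R [1, 1, 1, 1, 9]
      [0, 1 / 4, psi, 0, 0]"
    by (rule reduces_stepI[OF kw base2 base1, of 4 "[1, 1, 1, 1, 2]" 1])
      (simp_all add: reduces_eval)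
  have r_1_1_1_9_9: "?R [1, 1, 1, 9, 9]
      [0, 1 / 16, 5 * psi / 8, psi ^ 2, 0]"
    by (rule reduces_stepI[OF kw r_2_2_2_2_10 r_1_1_1_1_9, of 3 "[1, 1, 1, 2, 9]" 2])
      (simp_all add: reduces_eval)
  have r_1_1_9_9_9: "?R [1, 1, 9, 9, 9]
      [0, 1 / 64, 19 * psi / 64, 9 * psi ^ 2 / 8, psi ^ 3]"
    by (rule reduces_stepI[OF kw r_2_2_2_10_10 r_1_1_1_9_9, of 2 "[1, 1, 2, 9, 9]" 3])
      (simp_all add: reduces_eval)
  have r_0_0_0_0_8: "?R [0, 0, 0, 0, 8]
      [1 / 8, psi, 0, 0, 0]"
    by (rule reduces_stepI[OF kw base1 base0, of 4 "[0, 0, 0, 0, 1]" 0])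
      (simp_all add: reduces_eval)
  have r_0_0_0_8_8: "?R [0, 0, 0, 8, 8]
      [1 / 64, 3 * psi / 8, psi ^ 2, 0, 0]"
    by (rule reduces_stepI[OF kw r_1_1_1_1_9 r_0_0_0_0_8, of 3 "[0, 0, 0, 1, 8]" 1])
      (simp_all add: reduces_eval)
  have r_0_0_8_8_8: "?R [0, 0, 8, 8, 8]
      [1 / 512, 7 * psi / 64, 3 * psi ^ 2 / 4, psi ^ 3, 0]"
    by (rule reduces_stepI[OF kw r_1_1_1_9_9 r_0_0_0_8_8, of 2 "[0, 0, 1, 8, 8]" 2])
      (simp_all add: reduces_eval)
  have r_0_8_8_8_8: "?R [0, 8, 8, 8, 8]
      [1 / 4096, 15 * psi / 512, 25 * psi ^ 2 / 64, 5 * psi ^ 3 / 4, psi ^ 4]"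
    by (rule reduces_stepI[OF kw r_1_1_9_9_9 r_0_0_8_8_8, of 1 "[0, 1, 8, 8, 8]" 3])
      (simp_all add: reduces_eval)
  have r_1_7_7_7_7: "?R [1, 7, 7, 7, 7]
      [psi / 1024, 15 * psi ^ 2 / 128, 25 * psi ^ 3 / 16, 5 * psi ^ 4, 4 * psi ^ 5]"
    by (rule reduces_step_0I[OF kw r_0_8_8_8_8, of 0 "[0, 7, 7, 7, 7]" 3])
      (simp_all add: reduces_eval)
  have r_2_6_6_6_6: "?R [2, 6, 6, 6, 6]
      [psi ^ 2 / 256, 15 * psi ^ 3 / 32 + 3 / (8192 * psi ^ 5), 25 * psi ^ 4 / 4 - 3 / (1024 * psi ^ 4), 20 * psi ^ 5 + 1 / (128 * psi ^ 3), 16 * psi ^ 6]"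
    by (rule reduces_stepI[OF kw r_1_7_7_7_7 r_0_6_6_6_6, of 0 "[1, 6, 6, 6, 6]" 3])
      (simp_all add: reduces_eval)
  have r_3_5_5_5_5: "?R [3, 5, 5, 5, 5]
      [psi ^ 3 / 64, 15 * psi ^ 4 / 8 + 9 / (2048 * psi ^ 4), 25 * psi ^ 5 - 9 / (256 * psi ^ 3), 80 * psi ^ 6 + 3 / (32 * psi ^ 2), 64 * psi ^ 7]"
    by (rule reduces_stepI[OF kw r_2_6_6_6_6 r_1_5_5_5_5, of 0 "[2, 5, 5, 5, 5]" 3])
      (simp_all add: reduces_eval)
  have top: "?R [4, 4, 4, 4, 4]
      [psi ^ 4 / 16, 15 * psi ^ 5 / 2 + 15 / (512 * psi ^ 3), 100 * psi ^ 6 - 15 / (64 * psi ^ 2), 320 * psi ^ 7 + 3 / (4 * psi), 256 * psi ^ 8]"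
    by (rule reduces_stepI[OF kw r_3_5_5_5_5 r_2_4_4_4_4, of 0 "[3, 4, 4, 4, 4]" 3])
      (simp_all add: reduces_eval)
  show ?thesis
    by (rule top)
qed

text \<open>The order is x_1 once, x_0 five times, x_1 again, then x_2, x_3, x_4. Starting with x_1
  is convenient because its exponent 4 is d_1 - 1, which leaves no lower term. The lower terms of
  the last four of the x_0-steps read from the top that have one come from the backward
  rule.\<close>

lemma reduces_10: "reduces 10 [5, 2, 1, 1, 1] [4, 4, 4, 4, 4]
    [5 * psi ^ 6 / 4, 375 * psi ^ 7 / 2 + 7 / (200 * psi ^ 3), 3125 * psi ^ 8 - 7 / (20 * psi ^ 2), 12500 * psi ^ 9 + 1 / psi, 12500 * psi ^ 10]"
proof -
  let ?R = "reduces 10 [5, 2, 1, 1, 1]"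
  have kw: "admissible 10 [5, 2, 1, 1, 1]"
    by (simp add: admissible_list)
  note base0 = reduces_powers(1)[of 10 "[5, 2, 1, 1, 1]"]
    and base1 = reduces_powers(2)[of 10 "[5, 2, 1, 1, 1]"]
    and base2 = reduces_powers(3)[of 10 "[5, 2, 1, 1, 1]"]
    and base3 = reduces_powers(4)[of 10 "[5, 2, 1, 1, 1]"]
    and base4 = reduces_powers(5)[of 10 "[5, 2, 1, 1, 1]"]
  have r_0_2_2_2_2: "?R [0, 2, 2, 2, 2]
      [0, 1 / (5 * psi), 0, 0, 0]"
    by (rule reduces_solve_0I[OF kw base1, of 0 "[0, 1, 1, 1, 1]" 0])
      (simp_all add: reduces_eval)
  have r_1_3_3_3_3: "?R [1, 3, 3, 3, 3]
      [0, - 1 / (50 * psi ^ 2), 1 / (5 * psi), 0, 0]"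
    by (rule reduces_solveI[OF kw base2 r_0_2_2_2_2, of 0 "[1, 2, 2, 2, 2]" 1])
      (simp_all add: reduces_eval)
  have r_0_4_4_4_4: "?R [0, 4, 4, 4, 4]
      [0, - 1 / (250 * psi ^ 3), 1 / (25 * psi ^ 2), 0, 0]"
    by (rule reduces_solve_0I[OF kw r_1_3_3_3_3, of 0 "[0, 3, 3, 3, 3]" 1])
      (simp_all add: reduces_eval)
  have r_1_0_5_5_5: "?R [1, 0, 5, 5, 5]
      [0, - 1 / (500 * psi ^ 4), 1 / (50 * psi ^ 3), 0, 0]"
    by (rule reduces_solve_0I[OF kw r_0_4_4_4_4, of 1 "[0, 0, 4, 4, 4]" 1])
      (simp_all add: reduces_eval)
  have r_2_4_4_4_4: "?R [2, 4, 4, 4, 4]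
      [0, 1 / (250 * psi ^ 3), - 1 / (25 * psi ^ 2), 1 / (5 * psi), 0]"
    by (rule reduces_solveI[OF kw base3 r_1_3_3_3_3, of 0 "[2, 3, 3, 3, 3]" 2])
      (simp_all add: reduces_eval)
  have r_3_0_5_5_5: "?R [3, 0, 5, 5, 5]
      [0, 1 / (500 * psi ^ 4), - 1 / (50 * psi ^ 3), 1 / (10 * psi ^ 2), 0]"
    by (rule reduces_solve_0I[OF kw r_2_4_4_4_4, of 1 "[2, 0, 4, 4, 4]" 2])
      (simp_all add: reduces_eval)
  have r_0_1_6_6_6: "?R [0, 1, 6, 6, 6]
      [0, - 1 / (2500 * psi ^ 5), 1 / (250 * psi ^ 4), 0, 0]"
    by (rule reduces_solve_0I[OF kw r_1_0_5_5_5, of 0 "[0, 0, 5, 5, 5]" 1])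
      (simp_all add: reduces_eval)
  have r_2_1_6_6_6: "?R [2, 1, 6, 6, 6]
      [0, 1 / (1250 * psi ^ 5), - 1 / (125 * psi ^ 4), 1 / (50 * psi ^ 3), 0]"
    by (rule reduces_solveI[OF kw r_3_0_5_5_5 r_1_0_5_5_5, of 0 "[2, 0, 5, 5, 5]" 2])
      (simp_all add: reduces_eval)
  have r_1_2_7_7_7: "?R [1, 2, 7, 7, 7]
      [0, 1 / (5000 * psi ^ 6), - 1 / (500 * psi ^ 5), 1 / (250 * psi ^ 4), 0]"
    by (rule reduces_solveI[OF kw r_2_1_6_6_6 r_0_1_6_6_6, of 0 "[1, 1, 6, 6, 6]" 2])
      (simp_all add: reduces_eval)
  have r_0_3_8_8_8: "?R [0, 3, 8, 8, 8]
      [0, 1 / (25000 * psi ^ 7), - 1 / (2500 * psi ^ 6), 1 / (1250 * psi ^ 5), 0]"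
    by (rule reduces_solve_0I[OF kw r_1_2_7_7_7, of 0 "[0, 2, 7, 7, 7]" 2])
      (simp_all add: reduces_eval)
  have r_3_3_3_3_13: "?R [3, 3, 3, 3, 13]
      [0, 0, 0, 2 / 5, psi]"
    by (rule reduces_stepI[OF kw base4 base3, of 4 "[3, 3, 3, 3, 4]" 3])
      (simp_all add: reduces_eval)
  have r_2_2_2_2_12: "?R [2, 2, 2, 2, 12]
      [0, 0, 3 / 10, psi, 0]"
    by (rule reduces_stepI[OF kw base3 base2, of 4 "[2, 2, 2, 2, 3]" 2])
      (simp_all add: reduces_eval)
  have r_2_2_2_12_12: "?R [2, 2, 2, 12, 12]
      [0, 0, 9 / 100, 7 * psi / 10, psi ^ 2]"
    by (rule reduces_stepI[OF kw r_3_3_3_3_13 r_2_2_2_2_12, of 3 "[2, 2, 2, 3, 12]" 3])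
      (simp_all add: reduces_eval)
  have r_1_1_1_1_11: "?R [1, 1, 1, 1, 11]
      [0, 1 / 5, psi, 0, 0]"
    by (rule reduces_stepI[OF kw base2 base1, of 4 "[1, 1, 1, 1, 2]" 1])
      (simp_all add: reduces_eval)
  have r_1_1_1_11_11: "?R [1, 1, 1, 11, 11]
      [0, 1 / 25, psi / 2, psi ^ 2, 0]"
    by (rule reduces_stepI[OF kw r_2_2_2_2_12 r_1_1_1_1_11, of 3 "[1, 1, 1, 2, 11]" 2])
      (simp_all add: reduces_eval)
  have r_1_1_11_11_11: "?R [1, 1, 11, 11, 11]
      [0, 1 / 125, 19 * psi / 100, 9 * psi ^ 2 / 10, psi ^ 3]"
    by (rule reduces_stepI[OF kw r_2_2_2_12_12 r_1_1_1_11_11, of 2 "[1, 1, 2, 11, 11]" 3])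
      (simp_all add: reduces_eval)
  have r_0_0_0_0_10: "?R [0, 0, 0, 0, 10]
      [1 / 10, psi, 0, 0, 0]"
    by (rule reduces_stepI[OF kw base1 base0, of 4 "[0, 0, 0, 0, 1]" 0])
      (simp_all add: reduces_eval)
  have r_0_0_0_10_10: "?R [0, 0, 0, 10, 10]
      [1 / 100, 3 * psi / 10, psi ^ 2, 0, 0]"
    by (rule reduces_stepI[OF kw r_1_1_1_1_11 r_0_0_0_0_10, of 3 "[0, 0, 0, 1, 10]" 1])
      (simp_all add: reduces_eval)
  have r_0_0_10_10_10: "?R [0, 0, 10, 10, 10]
      [1 / 1000, 7 * psi / 100, 3 * psi ^ 2 / 5, psi ^ 3, 0]"
    by (rule reduces_stepI[OF kw r_1_1_1_11_11 r_0_0_0_10_10, of 2 "[0, 0, 1, 10, 10]" 2])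
      (simp_all add: reduces_eval)
  have r_0_5_10_10_10: "?R [0, 5, 10, 10, 10]
      [1 / 5000, 3 * psi / 100, psi ^ 2 / 2, 2 * psi ^ 3, 2 * psi ^ 4]"
    by (rule reduces_stepI[OF kw r_1_1_11_11_11 r_0_0_10_10_10, of 1 "[0, 1, 10, 10, 10]" 3])
      (simp_all add: reduces_eval)
  have r_1_4_9_9_9: "?R [1, 4, 9, 9, 9]
      [psi / 1000, 3 * psi ^ 2 / 20, 5 * psi ^ 3 / 2, 10 * psi ^ 4, 10 * psi ^ 5]"
    by (rule reduces_step_0I[OF kw r_0_5_10_10_10, of 0 "[0, 4, 9, 9, 9]" 3])
      (simp_all add: reduces_eval)
  have r_2_3_8_8_8: "?R [2, 3, 8, 8, 8]
      [psi ^ 2 / 200, 3 * psi ^ 3 / 4 + 1 / (50000 * psi ^ 7), 25 * psi ^ 4 / 2 - 1 / (5000 * psi ^ 6), 50 * psi ^ 5 + 1 / (2500 * psi ^ 5), 50 * psi ^ 6]"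
    by (rule reduces_stepI[OF kw r_1_4_9_9_9 r_0_3_8_8_8, of 0 "[1, 3, 8, 8, 8]" 3])
      (simp_all add: reduces_eval)
  have r_3_2_7_7_7: "?R [3, 2, 7, 7, 7]
      [psi ^ 3 / 40, 15 * psi ^ 4 / 4 + 3 / (10000 * psi ^ 6), 125 * psi ^ 5 / 2 - 3 / (1000 * psi ^ 5), 250 * psi ^ 6 + 3 / (500 * psi ^ 4), 250 * psi ^ 7]"
    by (rule reduces_stepI[OF kw r_2_3_8_8_8 r_1_2_7_7_7, of 0 "[2, 2, 7, 7, 7]" 3])
      (simp_all add: reduces_eval)
  have r_4_1_6_6_6: "?R [4, 1, 6, 6, 6]
      [psi ^ 4 / 8, 75 * psi ^ 5 / 4 + 27 / (10000 * psi ^ 5), 625 * psi ^ 6 / 2 - 27 / (1000 * psi ^ 4), 1250 * psi ^ 7 + 3 / (50 * psi ^ 3), 1250 * psi ^ 8]"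
    by (rule reduces_stepI[OF kw r_3_2_7_7_7 r_2_1_6_6_6, of 0 "[3, 1, 6, 6, 6]" 3])
      (simp_all add: reduces_eval)
  have r_5_0_5_5_5: "?R [5, 0, 5, 5, 5]
      [5 * psi ^ 5 / 8, 375 * psi ^ 6 / 4 + 7 / (400 * psi ^ 4), 3125 * psi ^ 7 / 2 - 7 / (40 * psi ^ 3), 6250 * psi ^ 8 + 1 / (2 * psi ^ 2), 6250 * psi ^ 9]"
    by (rule reduces_stepI[OF kw r_4_1_6_6_6 r_3_0_5_5_5, of 0 "[4, 0, 5, 5, 5]" 3])
      (simp_all add: reduces_eval)
  have top: "?R [4, 4, 4, 4, 4]
      [5 * psi ^ 6 / 4, 375 * psi ^ 7 / 2 + 7 / (200 * psi ^ 3), 3125 * psi ^ 8 - 7 / (20 * psi ^ 2), 12500 * psi ^ 9 + 1 / psi, 12500 * psi ^ 10]"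
    by (rule reduces_step_0I[OF kw r_5_0_5_5_5, of 1 "[4, 0, 4, 4, 4]" 3])
      (simp_all add: reduces_eval)
  show ?thesis
    by (rule top)
qed


section \<open>The coefficients of the four relations\<close>

text \<open>The coefficient lam psi^k is the product of the factors k_j psi along the leading
  branch, where x_j is used k_j times; thus lam is the product of the k_j^(k_j).\<close>

lemma reduces_families:
  assumes "(k, w, lam) \<in> families"
  shows "\<exists>cs. reduces k w [4, 4, 4, 4, 4] cs \<and> cs ! 4 = of_nat lam * psi ^ k \<and>
    (\<forall>l<4. eps k (inverse (psi ^ k)) (Suc l) * ((-1) ^ l * psi ^ Suc l * (1 - cs ! 4)) = psi ^ 5 * cs ! l)"
proof -
  \<comment> \<open>These are the denominators of the \<open>eps\<close> and the factor
    \<open>1 - cs ! 4\<close>, up to form.\<close>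
  have z: "inverse (psi ^ n) - of_nat m \<noteq> 0" "1 - of_nat m * psi ^ n \<noteq> 0" if "n > 0" for n m
    using psi_power_times_of_nat_neq_1[OF that, of m] by (auto simp: field_simps)
  consider "k = 5" "w = [1, 1, 1, 1, 1]" "lam = 1" | "k = 6" "w = [2, 1, 1, 1, 1]" "lam = 4"
    | "k = 8" "w = [4, 1, 1, 1, 1]" "lam = 256" | "k = 10" "w = [5, 2, 1, 1, 1]" "lam = 12500"
    using assms by (auto simp: families_def)
  then show ?thesis
  proof cases
    case 1
    show ?thesis
      unfolding 1
      by (rule exI, rule conjI[OF reduces_5])
        (use z[of 5 1] in \<open>simp add: eval_nat_numeral All_less_Suc eps_def; simp add: field_simps\<close>)
  next
    case 2
    show ?thesis
      unfolding 2
      by (rule exI, rule conjI[OF reduces_6])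
        (use z[of 6 4] in \<open>simp add: eval_nat_numeral All_less_Suc eps_def; simp add: field_simps\<close>)
  next
    case 3
    show ?thesis
      unfolding 3
      by (rule exI, rule conjI[OF reduces_8])
        (use z[of 8 256] in \<open>simp add: eval_nat_numeral All_less_Suc eps_def; simp add: field_simps\<close>)
  next
    case 4
    show ?thesis
      unfolding 4
      by (rule exI, rule conjI[OF reduces_10])
        (use z[of 10 12500] in \<open>simp add: eval_nat_numeral All_less_Suc eps_def; simp add: field_simps\<close>)
  qed
qed

section \<open>Differentiation with respect to the parameter\<close>

definition theta_coeff :: "nat \<Rightarrow> rat_fun \<Rightarrow> rat_fun" where
  "theta_coeff k F = - (psi * diff_psi F) / of_nat k"

lemma derivation_theta_coeff: "derivation (theta_coeff k)"
  by (auto simp: theta_coeff_def derivation_def derivation_add[OF derivation_diff_psi]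
      derivation_mult[OF derivation_diff_psi] divide_inverse algebra_simps)

lemma theta_coeff_xvar: "theta_coeff k (xvar i) = 0 * xvar i"
  by (simp add: theta_coeff_def diff_psi_xvar)

lemma theta_coeff_psi: "theta_coeff k psi = - 1 / of_nat k * psi"
  by (simp add: theta_coeff_def diff_psi_psi)

text \<open>\<open>Omega\<close> does not involve psi, so only the coefficient is
  differentiated.\<close>

lemma theta_form_scale_Omega: "theta_form k (F *\<^sub>F Omega w) = theta_coeff k F *\<^sub>F Omega w"
proof -
  have "diff_psi (Omega w I) = 0" for I
  proof (cases "\<exists>m<5. I = {..<5} - {m}")
    case True
    then obtain m where m: "m < 5" "I = {..<5} - {m}"
      by blast
    have "diff_psi ((-1) ^ m) = 0"
      by (cases "even m")
        (simp_all add: derivation_minus[OF derivation_diff_psi] derivation_1[OF derivation_diff_psi])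
    then show ?thesis
      using m by (simp add: Omega_apply derivation_mult[OF derivation_diff_psi]
          derivation_of_nat[OF derivation_diff_psi] diff_psi_xvar mult.assoc)
  next
    case False
    then have "Omega w I = 0"
      by (intro Omega_eq_0) blast
    then show ?thesis
      by (simp add: derivation_0[OF derivation_diff_psi])
  qed
  then show ?thesis
    by (simp add: theta_form_def theta_coeff_def scale_form_def fun_eq_iff
        derivation_mult[OF derivation_diff_psi])
qed

lemma theta_form_power_scale_Omega:
  "(theta_form k ^^ n) (F *\<^sub>F Omega w) = (theta_coeff k ^^ n) F *\<^sub>F Omega w"
  by (induction n) (simp_all add: theta_form_scale_Omega)

text \<open>The index is shifted: this is the coefficient of omega_(l+1), which removes the
  predecessors l - 1.\<close>

definition omega_coeff :: "nat \<Rightarrow> nat list \<Rightarrow> nat \<Rightarrow> rat_fun" where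
  "omega_coeff k w l = (-1) ^ l * of_nat (fact l) * psi ^ Suc l * (\<Prod>i<5. xvar i) ^ l / Q k w ^ Suc l"

lemma omega_eq_omega_coeff: "omega k w (Suc l) = omega_coeff k w l *\<^sub>F Omega w"
  by (simp add: omega_def omega_coeff_def prod_power_distrib)

text \<open>Since theta Q = psi x_0 ... x_4, differentiating Q^(-l-1) supplies exactly the factors
  that lead to the next form. The eigenvalue - (l + 1) / k of psi^(l+1) gives the other
  term.\<close>

lemma theta_coeff_omega_coeff:
  assumes kw: "admissible k w"
  shows "theta_coeff k (omega_coeff k w l)
    = omega_coeff k w (Suc l) - of_nat (Suc l) / of_nat k * omega_coeff k w l"
proof -
  note D = derivation_theta_coeff[of k]
  define p q where "p = (\<Prod>i<5. xvar i)" and "q = Q k w"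
  define a where "a = (-1) ^ l * of_nat (fact l) * psi ^ Suc l * p ^ l"
  have k: "(of_nat k :: rat_fun) \<noteq> 0" and q: "q \<noteq> 0"
    using admissible_pos[OF kw] Q_nonzero[OF kw] by (simp_all add: q_def)
  have dp: "theta_coeff k p = 0"
    unfolding p_def by (subst derivation_prod_eigen[OF D _ theta_coeff_xvar]) auto
  have dx: "theta_coeff k (xvar i ^ n) = 0" for i n
    by (subst derivation_power_eigen[OF D theta_coeff_xvar]) simp
  have dq: "theta_coeff k q = psi * p"
    using k by (simp add: q_def Q_def derivation_diff[OF D] derivation_sum[OF D] dx derivation_mult[OF D]
        derivation_of_nat[OF D] theta_coeff_psi dp flip: p_def)
  have dpsi: "theta_coeff k (psi ^ Suc l) = of_nat (Suc l) * (- 1 / of_nat k) * psi ^ Suc l"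
    by (rule derivation_power_eigen[OF D theta_coeff_psi])
  have c: "theta_coeff k ((-1) ^ l * b) = (-1) ^ l * theta_coeff k b" for b
    by (cases "even l") (simp_all add: derivation_minus[OF D])
  have "theta_coeff k (p ^ l) = of_nat l * 0 * p ^ l"
    by (rule derivation_power_eigen[OF D]) (simp add: dp)
  then have da: "theta_coeff k a = - of_nat (Suc l) / of_nat k * a"
    unfolding a_def mult.assoc[of "(-1) ^ l"] c
    by (simp add: derivation_mult[OF D] derivation_of_nat[OF D] dpsi del: power_Suc of_nat_Suc of_nat_fact)
  have "theta_coeff k (a / q ^ Suc l) = theta_coeff k a / q ^ Suc l
      - a * (of_nat (Suc l) * q ^ l * (psi * p)) / (q ^ Suc l)\<^sup>2"
    using q by (simp add: derivation_divide[OF D] derivation_power[OF D, of _ "Suc l"] dq del: power_Suc of_nat_Suc)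
  also have "\<dots> = - (of_nat (Suc l) * psi * p * a) / q ^ Suc (Suc l) - of_nat (Suc l) / of_nat k * (a / q ^ Suc l)"
    using q unfolding da by (simp add: field_simps power2_eq_square del: of_nat_Suc)
  also have "- (of_nat (Suc l) * psi * p * a) = (-1) ^ Suc l * of_nat (fact (Suc l)) * psi ^ Suc (Suc l) * p ^ Suc l"
    unfolding a_def fact_Suc by (simp add: algebra_simps)
  finally show ?thesis
    by (simp add: omega_coeff_def a_def p_def q_def)
qed

lemma sum_lessThan_4: "(\<Sum>j<4. g j) = g 0 + g 1 + g 2 + g (3::nat)" for g :: "nat \<Rightarrow> 'a::comm_monoid_add"
  by (simp add: eval_nat_numeral)

text \<open>The coefficient of omega_(i+1) in theta^n omega_1 is (-1/k)^(n-i) times the Stirling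
  number S(n+1, i+1) of the second kind, as in \<open>t1\<close> to \<open>t4\<close>. Inverting
  this triangular system produces the Stirling numbers of the first kind in \<open>B\<close>, such
  as 24, 50, 35, 10 and 6, 11, 6. It is an identity of forms for arbitrary \<open>z\<close>, because
  the \<open>eps\<close> are never differentiated.\<close>

lemma theta_form_omega1:
  assumes kw: "admissible k w"
  shows "(theta_form k ^^ 4) (omega k w 1) + (\<Sum>j<4. B k z j *\<^sub>F (theta_form k ^^ j) (omega k w 1))
    = omega k w 5 - (\<Sum>l = 1..4. eps k z l *\<^sub>F omega k w l)"
proof -
  note D = derivation_theta_coeff[of k]
  define u where "u = 1 / (of_nat k :: rat_fun)"
  define f where "f l = omega_coeff k w l" for l
  have u: "theta_coeff k u = 0"
    unfolding u_def
    by (cases "k = 0") (simp_all add: derivation_divide[OF D] derivation_0[OF derivation_theta_coeff] derivation_1[OF D] derivation_of_nat[OF D])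
  note [simp] = derivation_diff[OF D] derivation_add[OF D] derivation_mult[OF D] u derivation_power[OF D]
  have t: "theta_coeff k (f l) = f (Suc l) - of_nat (Suc l) * u * f l" for l
    using theta_coeff_omega_coeff[OF kw, of l] by (simp add: f_def u_def)
  have c: "theta_coeff k (numeral n) = 0" for n
    using derivation_of_nat[OF D, of "numeral n"] by simp
  have t1: "(theta_coeff k ^^ 1) (f 0) = f 1 - u * f 0"
    by (simp add: t)
  have t2: "(theta_coeff k ^^ 2) (f 0) = f 2 - 3 * u * f 1 + u ^ 2 * f 0"
    by (simp add: t c eval_nat_numeral) (simp add: algebra_simps)
  have t3: "(theta_coeff k ^^ 3) (f 0) = f 3 - 6 * u * f 2 + 7 * u ^ 2 * f 1 - u ^ 3 * f 0"
  proof -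
    have "(theta_coeff k ^^ 3) (f 0) = theta_coeff k ((theta_coeff k ^^ 2) (f 0))"
      by (simp add: eval_nat_numeral)
    then show ?thesis
      unfolding t2 by (simp add: t c eval_nat_numeral) (simp add: algebra_simps)
  qed
  have t4: "(theta_coeff k ^^ 4) (f 0) = f 4 - 10 * u * f 3 + 25 * u ^ 2 * f 2 - 15 * u ^ 3 * f 1 + u ^ 4 * f 0"
  proof -
    have "(theta_coeff k ^^ 4) (f 0) = theta_coeff k ((theta_coeff k ^^ 3) (f 0))"
      by (simp add: eval_nat_numeral)
    then show ?thesis
      unfolding t3 by (simp add: t c eval_nat_numeral) (simp add: algebra_simps)
  qed
  have om: "omega k w 1 = f 0 *\<^sub>F Omega w" "omega k w 5 = f 4 *\<^sub>F Omega w"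
    using omega_eq_omega_coeff[of k w 0] omega_eq_omega_coeff[of k w 4] by (simp_all add: f_def)
  have B: "B k z 0 = - eps k z 1 - u * eps k z 2 - 2 * u ^ 2 * eps k z 3 - 6 * u ^ 3 * eps k z 4 + 24 * u ^ 4"
    "B k z 1 = - eps k z 2 - 3 * u * eps k z 3 - 11 * u ^ 2 * eps k z 4 + 50 * u ^ 3"
    "B k z 2 = - eps k z 3 - 6 * u * eps k z 4 + 35 * u ^ 2"
    "B k z 3 = - eps k z 4 + 10 * u"
    by (simp_all add: B_def u_def power_one_over)
  have "(theta_coeff k ^^ 4) (f 0) + (\<Sum>j<4. B k z j * (theta_coeff k ^^ j) (f 0))
      = f 4 - (\<Sum>l<4. eps k z (Suc l) * f l)"
    unfolding sum_lessThan_4 B t1 t2 t3 t4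
    by (simp add: algebra_simps numeral_2_eq_2[symmetric] power2_eq_square power3_eq_cube power4_eq_xxxx)
  then show ?thesis
    unfolding sum_upto_4 omega_eq_omega_coeff om theta_form_power_scale_Omega f_def[symmetric]
    by (simp only: scale_form_scale flip: scale_form_sum_left scale_form_add_left)
      (simp add: scale_form_def fun_eq_iff left_diff_distrib)
qed

section \<open>The Frobenius method\<close>

text \<open>The l^1 seminorm modulo the fourth power of the variable. It is submultiplicative, so
  the Frobenius recursion can be estimated factor by factor.\<close>

definition trunc_norm :: "complex fps \<Rightarrow> real" where
  "trunc_norm F = (\<Sum>j<4. norm (F $ j))"

lemma trunc_norm_nonneg: "trunc_norm F \<ge> 0"
  by (simp add: trunc_norm_def sum_nonneg)

lemma norm_nth_le_trunc_norm: "j < 4 \<Longrightarrow> norm (F $ j) \<le> trunc_norm F"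
  unfolding trunc_norm_def by (rule member_le_sum) auto

lemma trunc_norm_add: "trunc_norm (F + G) \<le> trunc_norm F + trunc_norm G"
  by (simp add: trunc_norm_def norm_triangle_ineq sum_mono flip: sum.distrib)

lemma trunc_norm_sum: "trunc_norm (sum f A) \<le> (\<Sum>i\<in>A. trunc_norm (f i))"
proof (induction A rule: infinite_finite_induct)
  case (insert x A)
  then show ?case
    using trunc_norm_add[of "f x" "sum f A"] by simp
qed (simp_all add: trunc_norm_def)

lemma trunc_norm_mult: "trunc_norm (F * G) \<le> trunc_norm F * trunc_norm G"
proof -
  have "trunc_norm (F * G) \<le> (\<Sum>k<4. \<Sum>i\<le>k. norm (F $ i) * norm (G $ (k - i)))"
    unfolding trunc_norm_def fps_mult_nth atLeast0AtMost
    by (intro sum_mono order.trans[OF norm_sum]) (simp add: norm_mult)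
  also have "\<dots> = (\<Sum>(i, j)\<in>{(i, j). i + j < 4}. norm (F $ i) * norm (G $ j))"
    by (rule sum.triangle_reindex[symmetric])
  also have "\<dots> \<le> (\<Sum>(i, j)\<in>{..<4} \<times> {..<4}. norm (F $ i) * norm (G $ j))"
    by (rule sum_mono2) auto
  also have "\<dots> = trunc_norm F * trunc_norm G"
    by (simp add: trunc_norm_def sum_product sum.cartesian_product)
  finally show ?thesis .
qed

lemma trunc_norm_const: "trunc_norm (fps_const c) = norm c"
  by (simp add: trunc_norm_def eval_nat_numeral)

lemma trunc_norm_power: "trunc_norm (F ^ n) \<le> trunc_norm F ^ n"
proof (induction n)
  case 0
  then show ?case
    using trunc_norm_const[of 1] by simp
next
  case (Suc n)
  have "trunc_norm (F ^ Suc n) \<le> trunc_norm F * trunc_norm (F ^ n)"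
    using trunc_norm_mult by simp
  also have "\<dots> \<le> trunc_norm F * trunc_norm F ^ n"
    using Suc trunc_norm_nonneg by (rule mult_left_mono)
  finally show ?case
    by simp
qed

lemma trunc_norm_of_nat_plus_X: "trunc_norm (of_nat n + fps_X) = real (Suc n)"
  by (simp add: trunc_norm_def eval_nat_numeral fps_of_nat[symmetric])

text \<open>The series of 1 / (a + X) is geometric, and for a = n + 1 >= 1 each of its first four
  coefficients has modulus at most 1 / a.\<close>

lemma trunc_norm_inverse:
  "trunc_norm (inverse (of_nat (Suc n) + fps_X)) \<le> 4 / of_nat (Suc n)"
proof -
  define a :: complex where "a = of_nat (Suc n)"
  have a: "a \<noteq> 0" "norm a \<ge> 1"
    by (simp_all add: a_def norm_of_nat del: of_nat_Suc)
  define G where "G = Abs_fps (\<lambda>j. (-1) ^ j / a ^ Suc j)"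
  have "(fps_const a + fps_X) * G = 1"
  proof (rule fps_ext)
    fix j
    show "((fps_const a + fps_X) * G) $ j = 1 $ j"
      using a by (cases j) (simp_all add: G_def distrib_right fps_mult_left_const_nth)
  qed
  then have "inverse (fps_const a + fps_X) = G"
    by (rule fps_inverse_unique)
  moreover have "fps_const a = of_nat (Suc n)"
    unfolding a_def by (rule fps_of_nat)
  ultimately have "trunc_norm (inverse (of_nat (Suc n) + fps_X)) = trunc_norm G"
    by (simp only:)
  also have "\<dots> \<le> (\<Sum>j<(4::nat). 1 / norm a)"
    unfolding trunc_norm_def
  proof (rule sum_mono)
    fix j
    have "norm a * 1 \<le> norm a * norm a ^ j"
      using a by (intro mult_left_mono one_le_power) auto
    then show "norm (G $ j) \<le> 1 / norm a"
      using a by (simp add: G_def norm_divide norm_power norm_mult frac_le)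
  qed
  also have "\<dots> = 4 / of_nat (Suc n)"
    by (simp add: a_def norm_of_nat del: of_nat_Suc)
  finally show ?thesis .
qed

text \<open>
  The Frobenius solution \<open>\<Sum>n. frobenius p lam n z^(n + \<epsilon>)\<close> of
  \<open>lam \<theta>^4 f = z (\<Sum>i\<le>4. p i \<theta>^i) f\<close>, where the deformation parameter \<open>\<epsilon>\<close> is the
  variable of the power series.
\<close>

primrec frobenius :: "(nat \<Rightarrow> complex) \<Rightarrow> complex \<Rightarrow> nat \<Rightarrow> complex fps" where
  "frobenius p lam 0 = 1"
| "frobenius p lam (Suc n) = fps_const (1 / lam) * (\<Sum>i\<le>4. fps_const (p i) * (of_nat n + fps_X) ^ i)
     * frobenius p lam n * inverse (of_nat (Suc n) + fps_X) ^ 4"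

lemma frobenius_rec:
  assumes "lam \<noteq> 0"
  shows "fps_const lam * ((of_nat (Suc n) + fps_X) ^ 4 * frobenius p lam (Suc n))
    = (\<Sum>i\<le>4. fps_const (p i) * (of_nat n + fps_X) ^ i * frobenius p lam n)"
proof -
  have "((of_nat (Suc n) + fps_X) :: complex fps) $ 0 \<noteq> 0"
    by (simp add: fps_of_nat[symmetric] del: of_nat_Suc)
  then have "((of_nat (Suc n) + fps_X) :: complex fps) * inverse (of_nat (Suc n) + fps_X) = 1"
    by (rule inverse_mult_eq_1')
  then have inv: "(of_nat (Suc n) + fps_X) ^ 4 * inverse (of_nat (Suc n) + fps_X) ^ 4 = (1 :: complex fps)"
    by (simp flip: power_mult_distrib)
  have lam: "fps_const lam * fps_const (1 / lam) = 1"
    using assms by simp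
  have "fps_const lam * ((of_nat (Suc n) + fps_X) ^ 4 * frobenius p lam (Suc n))
    = (fps_const lam * fps_const (1 / lam)) *
      ((of_nat (Suc n) + fps_X) ^ 4 * inverse (of_nat (Suc n) + fps_X) ^ 4) *
      ((\<Sum>i\<le>4. fps_const (p i) * (of_nat n + fps_X) ^ i) * frobenius p lam n)"
    by (simp only: frobenius.simps mult_ac)
  then show ?thesis
    by (simp only: inv lam mult_1_left sum_distrib_right)
qed

text \<open>The polynomial of degree four in n and the denominator (n + 1)^4 balance, so each step
  of the recursion costs at most a constant factor.\<close>

lemma trunc_norm_frobenius:
  obtains K where "K > 0" "\<And>n. trunc_norm (frobenius p lam n) \<le> K ^ n"
proof
  \<comment> \<open>The number 256 = 4^4 stems from \<open>trunc_norm_inverse\<close>; the added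
    ones make \<open>C\<close> and \<open>K\<close> positive.\<close>
  define C where "C = (\<Sum>i\<le>4. norm (p i)) + 1"
  define K where "K = norm (1 / lam) * C * 256 + 1"
  have C: "C > 0"
    by (simp add: C_def add_nonneg_pos sum_nonneg)
  then show "K > 0"
    by (simp add: K_def add_nonneg_pos)
  show "trunc_norm (frobenius p lam n) \<le> K ^ n" for n
  proof (induction n)
    case 0
    then show ?case
      using trunc_norm_const[of 1] by simp
  next
    case (Suc n)
    let ?P = "\<Sum>i\<le>4. fps_const (p i) * (of_nat n + fps_X) ^ i"
    have "trunc_norm ?P \<le> (\<Sum>i\<le>4. norm (p i) * real (Suc n) ^ 4)"
    proof (intro order.trans[OF trunc_norm_sum] sum_mono)
      fix i :: nat
      assume i: "i \<in> {..4}"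
      have "trunc_norm (fps_const (p i) * (of_nat n + fps_X) ^ i)
          \<le> norm (p i) * trunc_norm ((of_nat n + fps_X) ^ i)"
        using trunc_norm_mult[of "fps_const (p i)"] by (simp add: trunc_norm_const)
      also have "\<dots> \<le> norm (p i) * real (Suc n) ^ i"
        using trunc_norm_power[of "of_nat n + fps_X" i, unfolded trunc_norm_of_nat_plus_X]
        by (rule mult_left_mono) simp
      also have "\<dots> \<le> norm (p i) * real (Suc n) ^ 4"
        using i by (intro mult_left_mono power_increasing) auto
      finally show "trunc_norm (fps_const (p i) * (of_nat n + fps_X) ^ i) \<le> norm (p i) * real (Suc n) ^ 4" .
    qed
    also have "\<dots> \<le> C * real (Suc n) ^ 4"
      by (simp add: C_def sum_distrib_right[symmetric] mult_right_mono)
    finally have P: "trunc_norm ?P \<le> C * real (Suc n) ^ 4" .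
    have "trunc_norm (inverse (of_nat (Suc n) + fps_X) ^ 4) \<le> (4 / real (Suc n)) ^ 4"
      by (rule order.trans[OF trunc_norm_power power_mono[OF trunc_norm_inverse trunc_norm_nonneg]])
    then have "trunc_norm (frobenius p lam (Suc n))
        \<le> norm (1 / lam) * (C * real (Suc n) ^ 4) * K ^ n * (4 / real (Suc n)) ^ 4"
      unfolding frobenius.simps
      using C
      by (intro order.trans[OF trunc_norm_mult] mult_mono P Suc.IH trunc_norm_nonneg)
        (simp_all add: trunc_norm_const mult_nonneg_nonneg trunc_norm_nonneg \<open>K > 0\<close> less_imp_le del: of_nat_Suc)
    also have "\<dots> = norm (1 / lam) * C * 256 * K ^ n"
      by (simp add: field_simps del: of_nat_Suc)
    also have "\<dots> \<le> K * K ^ n"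
      using \<open>K > 0\<close> by (intro mult_right_mono) (simp_all add: K_def)
    finally show ?case
      by simp
  qed
qed

section \<open>Convergence in z and solutions with logarithms\<close>

definition column :: "(nat \<Rightarrow> complex fps) \<Rightarrow> nat \<Rightarrow> complex fps" where
  "column c j = Abs_fps (\<lambda>n. c n $ j)"

text \<open>The operator theta^i multiplies z^(n + eps) by (n + eps)^i; this is its effect on the
  coefficients.\<close>

definition theta_seq :: "nat \<Rightarrow> (nat \<Rightarrow> complex fps) \<Rightarrow> nat \<Rightarrow> complex fps" where
  "theta_seq i c n = (of_nat n + fps_X) ^ i * c n"

definition converges_within :: "real \<Rightarrow> (nat \<Rightarrow> complex fps) \<Rightarrow> bool" where
  "converges_within R c \<longleftrightarrow> (\<forall>j<4. fps_conv_radius (column c j) \<ge> ereal R)"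

lemma theta_seq_0 [simp]: "theta_seq 0 c = c"
  by (simp add: theta_seq_def fun_eq_iff)

lemma theta_seq_Suc: "theta_seq (Suc i) c = theta_seq 1 (theta_seq i c)"
  by (simp add: theta_seq_def fun_eq_iff mult.assoc)

lemma column_theta_seq_1:
  "column (theta_seq 1 c) j
    = fps_X * fps_deriv (column c j) + (if j = 0 then 0 else column c (j - 1))"
proof (rule fps_ext)
  fix n
  have "column (theta_seq 1 c) j $ n = of_nat n * c n $ j + (if j = 0 then 0 else c n $ (j - 1))"
    by (simp add: column_def theta_seq_def distrib_right fps_of_nat[symmetric])
  moreover have "(fps_X * fps_deriv (column c j)) $ n = of_nat n * c n $ j"
    by (cases n) (simp_all add: column_def)
  ultimately show "column (theta_seq 1 c) j $ n
      = (fps_X * fps_deriv (column c j) + (if j = 0 then 0 else column c (j - 1))) $ n"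
    by (simp add: column_def)
qed

lemma converges_within_theta_seq_1:
  assumes "converges_within R c"
  shows "converges_within R (theta_seq 1 c)"
  unfolding converges_within_def column_theta_seq_1
proof (intro allI impI fps_conv_radius_add_ge fps_conv_radius_mult_ge)
  fix j :: nat
  assume "j < 4"
  then show "ereal R \<le> fps_conv_radius (fps_deriv (column c j))"
    using assms order.trans[OF _ fps_conv_radius_deriv] by (auto simp: converges_within_def)
  show "ereal R \<le> fps_conv_radius (if j = 0 then 0 else column c (j - 1))"
    using assms \<open>j < 4\<close> by (auto simp: converges_within_def)
qed simp

lemma converges_within_theta_seq: "converges_within R c \<Longrightarrow> converges_within R (theta_seq i c)"
  by (induction i) (simp, simp only: theta_seq_Suc converges_within_theta_seq_1)

lemma converges_within_frobenius:
  obtains R where "R > 0" "converges_within R (frobenius p lam)"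
proof -
  obtain K where K: "K > 0" "\<And>n. trunc_norm (frobenius p lam n) \<le> K ^ n"
    using trunc_norm_frobenius[of p lam] by blast
  define R where "R = 1 / (2 * K)"
  have R: "R > 0" "K * R = 1 / 2"
    using K(1) by (simp_all add: R_def)
  have "fps_conv_radius (column (frobenius p lam) j) \<ge> ereal R" if "j < 4" for j
  proof -
    have "summable (\<lambda>n. column (frobenius p lam) j $ n * of_real R ^ n)"
    proof (rule summable_comparison_test')
      show "summable (\<lambda>n. (1 / 2 :: real) ^ n)"
        by (rule summable_geometric) simp
      fix n :: nat
      have "norm (column (frobenius p lam) j $ n) \<le> K ^ n"
        using norm_nth_le_trunc_norm[OF that, of "frobenius p lam n"] K(2)[of n]
        by (simp add: column_def)
      then have "norm (column (frobenius p lam) j $ n) * R ^ n \<le> K ^ n * R ^ n"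
        using R by (intro mult_right_mono) auto
      then show "norm (column (frobenius p lam) j $ n * of_real R ^ n) \<le> (1 / 2) ^ n"
        using R by (simp add: norm_mult norm_power flip: power_mult_distrib)
    qed
    then have "fps_conv_radius (column (frobenius p lam) j) \<ge> norm (of_real R :: complex)"
      unfolding fps_conv_radius_def by (rule conv_radius_geI)
    then show ?thesis
      using R by simp
  qed
  then show ?thesis
    using that[of R] R(1) by (auto simp: converges_within_def)
qed

text \<open>The series e^(eps s) H(eps, e^s) in eps. Using s = log z as the variable makes it single
  valued on a half plane Re s < log R, at least for the first four coefficients, whose columns
  converge.\<close>

definition frob_fun :: "(nat \<Rightarrow> complex fps) \<Rightarrow> complex \<Rightarrow> complex fps" where
  "frob_fun c s = fps_exp s * Abs_fps (\<lambda>j. eval_fps (column c j) (exp s))"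

text \<open>Only \<open>A\<close> modulo the fourth power of its variable matters; the monodromy will act on \<open>A\<close> by multiplication.\<close>

definition frob_sol :: "(nat \<Rightarrow> complex fps) \<Rightarrow> complex fps \<Rightarrow> complex \<Rightarrow> complex" where
  "frob_sol c A s = (A * frob_fun c s) $ 3"

lemma frob_fun_nth:
  "frob_fun c s $ 0 = eval_fps (column c 0) (exp s)"
  "frob_fun c s $ 1 = eval_fps (column c 1) (exp s) + s * eval_fps (column c 0) (exp s)"
  "frob_fun c s $ 2 = eval_fps (column c 2) (exp s) + s * eval_fps (column c 1) (exp s)
      + s\<^sup>2 / 2 * eval_fps (column c 0) (exp s)"
  "frob_fun c s $ 3 = eval_fps (column c 3) (exp s) + s * eval_fps (column c 2) (exp s)
      + s\<^sup>2 / 2 * eval_fps (column c 1) (exp s) + s ^ 3 / 6 * eval_fps (column c 0) (exp s)"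
  by (simp_all add: frob_fun_def fps_mult_nth eval_nat_numeral)

lemma frob_sol_eq:
  "frob_sol c A s = A $ 0 * frob_fun c s $ 3 + A $ 1 * frob_fun c s $ 2
    + A $ 2 * frob_fun c s $ 1 + A $ 3 * frob_fun c s $ 0"
  by (simp add: frob_sol_def fps_mult_nth eval_nat_numeral)

text \<open>Differentiating e^((n + eps) s) multiplies it by n + eps. For the single coefficients,
  the power of s produces the shifted column in \<open>column_theta_seq_1\<close>.\<close>

lemma frob_fun_has_field_derivative:
  assumes c: "converges_within R c" and s: "norm (exp s) < R" and j: "j < 4"
  shows "((\<lambda>s. frob_fun c s $ j) has_field_derivative frob_fun (theta_seq 1 c) s $ j) (at s)"
proof -
  define H where "H j s = eval_fps (column c j) (exp s)" for j s
  define H' where "H' j = eval_fps (fps_deriv (column c j)) (exp s) * exp s" for j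
  have rad: "ereal (norm (exp s)) < fps_conv_radius (column c j)" if "j < 4" for j
    using c s that less_le_trans[of "ereal (norm (exp s))" "ereal R"] by (auto simp: converges_within_def)
  have H: "(H j has_field_derivative H' j) (at s)" if "j < 4" for j
    unfolding H_def H'_def
    using rad[OF that] by (intro DERIV_chain2[OF has_field_derivative_eval_fps]) auto
  define c' where "c' = theta_seq 1 c"
  have eval: "eval_fps (column c' j) (exp s) = H' j + (if j = 0 then 0 else H (j - 1) s)"
    if "j < 4" for j
  proof -
    have "ereal (norm (exp s)) < fps_conv_radius (fps_deriv (column c j))"
      using rad[OF that] fps_conv_radius_deriv less_le_trans by blast
    moreover have "ereal (norm (exp s)) < fps_conv_radius (fps_X * fps_deriv (column c j))"
      using calculation fps_conv_radius_mult[of fps_X "fps_deriv (column c j)"] by (simp add: less_le_trans)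
    moreover have "ereal (norm (exp s)) < fps_conv_radius (if j = 0 then 0 else column c (j - 1))"
      using rad[of "j - 1"] that by auto
    ultimately show ?thesis
      unfolding c'_def column_theta_seq_1
      by (subst eval_fps_add) (auto simp: eval_fps_mult H'_def H_def)
  qed
  consider "j = 0" | "j = 1" | "j = 2" | "j = 3"
    using j by linarith
  then show ?thesis
  proof cases
    case 1
    show ?thesis
      unfolding 1 c'_def[symmetric] frob_fun_nth H_def[symmetric] using H[of 0] by (simp add: eval)
  next
    case 2
    show ?thesis
      unfolding 2 c'_def[symmetric] frob_fun_nth H_def[symmetric]
      by (auto intro!: derivative_eq_intros H simp: eval)
  next
    case 3
    show ?thesis
      unfolding 3 c'_def[symmetric] frob_fun_nth H_def[symmetric]
      by (auto intro!: derivative_eq_intros H simp: eval algebra_simps)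
  next
    case 4
    show ?thesis
      unfolding 4 c'_def[symmetric] frob_fun_nth H_def[symmetric]
      by (auto intro!: derivative_eq_intros H simp: eval field_simps power2_eq_square)
  qed
qed

lemma frob_sol_has_field_derivative:
  assumes "converges_within R c" "norm (exp s) < R"
  shows "(frob_sol c A has_field_derivative frob_sol (theta_seq 1 c) A s) (at s)"
proof -
  note D = frob_fun_has_field_derivative[OF assms]
  show ?thesis
    unfolding frob_sol_eq[abs_def]
    by (rule derivative_eq_intros D refl | simp)+
qed

text \<open>For each column the coefficients of z^(n+1) agree by \<open>frobenius_rec\<close>. The
  factor e^(eps s) does not depend on the operator and carries the identity over to
  \<open>frob_fun\<close>.\<close>

lemma frob_fun_ode:
  assumes c: "converges_within R (frobenius p lam)" and s: "norm (exp s) < R" and j: "j < 4" and "lam \<noteq> 0"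
  shows "lam * frob_fun (theta_seq 4 (frobenius p lam)) s $ j
    = exp s * (\<Sum>i\<le>4. p i * frob_fun (theta_seq i (frobenius p lam)) s $ j)"
proof -
  define z where "z = exp s"
  define f where "f i j = column (theta_seq i (frobenius p lam)) j" for i j
  have eval: "lam * eval_fps (f 4 j) z = z * (\<Sum>i\<le>4. p i * eval_fps (f i j) z)" if "j < 4" for j
  proof -
    have rad: "ereal (norm z) < fps_conv_radius (f i j)" for i
      using converges_within_theta_seq[OF c, of i] s that less_le_trans[of "ereal (norm z)" "ereal R"]
      by (auto simp: converges_within_def z_def f_def)
    have sums: "(\<lambda>n. f i j $ n * z ^ n) sums eval_fps (f i j) z" for i
      by (rule sums_eval_fps[OF rad])
    have "(\<lambda>n. \<Sum>i\<le>4. p i * (f i j $ n * z ^ n)) sums (\<Sum>i\<le>4. p i * eval_fps (f i j) z)"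
      by (intro sums_sum sums_mult sums)
    then have "(\<lambda>n. z * (\<Sum>i\<le>4. p i * (f i j $ n * z ^ n))) sums (z * (\<Sum>i\<le>4. p i * eval_fps (f i j) z))"
      by (rule sums_mult)
    moreover have "z * (\<Sum>i\<le>4. p i * (f i j $ n * z ^ n)) = lam * (f 4 j $ Suc n * z ^ Suc n)" for n
    proof -
      have "(fps_const lam * ((of_nat (Suc n) + fps_X) ^ 4 * frobenius p lam (Suc n))) $ j
        = (\<Sum>i\<le>4. fps_const (p i) * (of_nat n + fps_X) ^ i * frobenius p lam n) $ j"
        using frobenius_rec[OF \<open>lam \<noteq> 0\<close>] by simp
      then have "lam * f 4 j $ Suc n = (\<Sum>i\<le>4. p i * f i j $ n)"
        by (simp add: f_def column_def theta_seq_def fps_sum_nth mult.assoc del: of_nat_Suc frobenius.simps)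
      then have "lam * f 4 j $ Suc n * z ^ Suc n = (\<Sum>i\<le>4. p i * f i j $ n) * z ^ Suc n"
        by simp
      then show ?thesis
        by (simp add: sum_distrib_left sum_distrib_right mult_ac)
    qed
    ultimately have "(\<lambda>n. lam * (f 4 j $ Suc n * z ^ Suc n)) sums (z * (\<Sum>i\<le>4. p i * eval_fps (f i j) z))"
      by simp
    \<comment> \<open>The lowest term of theta^4 is eps^4 z^eps, invisible for j < 4. This is why
      one works modulo eps^4.\<close>
    moreover have "f 4 j $ 0 = 0"
      using that by (simp add: f_def column_def theta_seq_def)
    ultimately have "(\<lambda>n. lam * (f 4 j $ n * z ^ n)) sums (z * (\<Sum>i\<le>4. p i * eval_fps (f i j) z))"
      by (subst (asm) sums_Suc_iff) simp
    then show ?thesis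
      using sums_mult[OF sums[of 4], of lam] sums_unique2 by blast
  qed
  have "frob_fun c s $ j = (\<Sum>m\<le>j. s ^ m / fact m * eval_fps (column c (j - m)) (exp s))" for c
    by (simp add: frob_fun_def fps_mult_nth atLeast0AtMost)
  then have F: "frob_fun (theta_seq i (frobenius p lam)) s $ j = (\<Sum>m\<le>j. s ^ m / fact m * eval_fps (f i (j - m)) z)" for i
    by (simp add: f_def z_def)
  have "lam * (\<Sum>m\<le>j. s ^ m / fact m * eval_fps (f 4 (j - m)) z)
      = (\<Sum>m\<le>j. s ^ m / fact m * (lam * eval_fps (f 4 (j - m)) z))"
    by (simp add: sum_distrib_left mult_ac)
  also have "\<dots> = (\<Sum>m\<le>j. s ^ m / fact m * (z * (\<Sum>i\<le>4. p i * eval_fps (f i (j - m)) z)))"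
    using j by (intro sum.cong refl) (simp add: eval)
  also have "\<dots> = (\<Sum>m\<le>j. \<Sum>i\<le>4. z * (p i * (s ^ m / fact m * eval_fps (f i (j - m)) z)))"
    by (simp only: sum_distrib_left mult_ac)
  also have "\<dots> = (\<Sum>i\<le>4. \<Sum>m\<le>j. z * (p i * (s ^ m / fact m * eval_fps (f i (j - m)) z)))"
    by (rule sum.swap)
  also have "\<dots> = z * (\<Sum>i\<le>4. p i * (\<Sum>m\<le>j. s ^ m / fact m * eval_fps (f i (j - m)) z))"
    by (simp only: sum_distrib_left)
  finally show ?thesis
    unfolding F z_def .
qed

lemma frob_sol_ode:
  assumes "converges_within R (frobenius p lam)" "norm (exp s) < R" "lam \<noteq> 0"
  shows "lam * frob_sol (theta_seq 4 (frobenius p lam)) A s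
    = exp s * (\<Sum>i\<le>4. p i * frob_sol (theta_seq i (frobenius p lam)) A s)"
proof -
  have *: "frob_sol c A s = (\<Sum>j<4. A $ j * frob_fun c s $ (3 - j))" for c
    by (simp add: frob_sol_eq eval_nat_numeral)
  have "lam * frob_sol (theta_seq 4 (frobenius p lam)) A s
      = (\<Sum>j<4. A $ j * (lam * frob_fun (theta_seq 4 (frobenius p lam)) s $ (3 - j)))"
    by (simp only: * sum_distrib_left mult.left_commute)
  also have "\<dots> = (\<Sum>j<4. A $ j * (exp s * (\<Sum>i\<le>4. p i * frob_fun (theta_seq i (frobenius p lam)) s $ (3 - j))))"
    using assms by (intro sum.cong refl) (simp add: frob_fun_ode)
  also have "\<dots> = (\<Sum>j<4. \<Sum>i\<le>4. exp s * (p i * (A $ j * frob_fun (theta_seq i (frobenius p lam)) s $ (3 - j))))"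
    by (simp only: sum_distrib_left mult_ac)
  also have "\<dots> = (\<Sum>i\<le>4. \<Sum>j<4. exp s * (p i * (A $ j * frob_fun (theta_seq i (frobenius p lam)) s $ (3 - j))))"
    by (rule sum.swap)
  finally show ?thesis
    by (simp only: * sum_distrib_left)
qed

text \<open>The series in e^s does not change, and e^(eps s) acquires the factor e^(eps t).\<close>

lemma frob_sol_periodic:
  assumes "exp t = 1"
  shows "frob_sol c A (s + t) = frob_sol c (A * fps_exp t) s"
  using assms by (simp add: frob_sol_def frob_fun_def exp_add fps_exp_add_mult mult_ac)

section \<open>Uniqueness for linear systems\<close>

text \<open>The maximum of the unknowns over a small disc is at most half of itself.\<close>

lemma linear_system_unique_local:
  fixes y :: "nat \<Rightarrow> complex \<Rightarrow> complex" and M :: "nat \<Rightarrow> nat \<Rightarrow> complex \<Rightarrow> complex"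
  assumes S: "open S" "z0 \<in> S"
    and deriv: "\<And>i z. i < n \<Longrightarrow> z \<in> S \<Longrightarrow> (y i has_field_derivative (\<Sum>j<n. M i j z * y j z)) (at z)"
    and cont: "\<And>i j. i < n \<Longrightarrow> j < n \<Longrightarrow> continuous_on S (M i j)"
    and init: "\<And>i. i < n \<Longrightarrow> y i z0 = 0"
  obtains \<delta> where "\<delta> > 0" "\<And>i z. i < n \<Longrightarrow> z \<in> cball z0 \<delta> \<Longrightarrow> y i z = 0"
proof -
  obtain \<rho> where \<rho>: "\<rho> > 0" "cball z0 \<rho> \<subseteq> S"
    using S open_contains_cball by blast
  have "continuous_on (cball z0 \<rho>) (\<lambda>z. \<Sum>i<n. \<Sum>j<n. norm (M i j z))"
    using cont \<rho>(2) by (intro continuous_intros) (auto intro: continuous_on_subset)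
  then have "bounded ((\<lambda>z. \<Sum>i<n. \<Sum>j<n. norm (M i j z)) ` cball z0 \<rho>)"
    by (intro compact_imp_bounded compact_continuous_image compact_cball)
  then obtain C where "C > 0" and C': "\<forall>x \<in> (\<lambda>z. \<Sum>i<n. \<Sum>j<n. norm (M i j z)) ` cball z0 \<rho>. norm x \<le> C"
    unfolding bounded_pos by blast
  then have C: "\<And>z. z \<in> cball z0 \<rho> \<Longrightarrow> norm (\<Sum>i<n. \<Sum>j<n. norm (M i j z)) \<le> C" "C > 0"
    by blast+
  have entry: "norm (M i j z) \<le> C" if "i < n" "j < n" "z \<in> cball z0 \<rho>" for i j z
  proof -
    have "norm (M i j z) \<le> (\<Sum>j<n. norm (M i j z))"
      using that(2) by (intro member_le_sum[of j "{..<n}" "\<lambda>j. norm (M i j z)"]) auto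
    also have "\<dots> \<le> (\<Sum>i<n. \<Sum>j<n. norm (M i j z))"
      using that(1) by (intro member_le_sum[of i "{..<n}" "\<lambda>i. \<Sum>j<n. norm (M i j z)"]) (auto intro: sum_nonneg)
    also have "\<dots> \<le> C"
      using C(1)[OF that(3)] by simp
    finally show ?thesis .
  qed
  \<comment> \<open>Chosen such that n C \<delta> is at most 1/2; the added one covers n =
    0.\<close>
  define \<delta> where "\<delta> = min \<rho> (1 / (2 * (real n * C + 1)))"
  have nC: "real n * C + 1 > 0"
    using C(2) by (simp add: add_nonneg_pos)
  then have \<delta>: "\<delta> > 0" "\<delta> \<le> \<rho>" "real n * C * \<delta> \<le> 1 / 2"
  proof -
    show "\<delta> > 0" "\<delta> \<le> \<rho>"
      using \<rho>(1) nC by (simp_all add: \<delta>_def)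
    have "real n * C * \<delta> \<le> (real n * C + 1) * (1 / (2 * (real n * C + 1)))"
      using C(2) \<open>\<delta> > 0\<close> nC by (intro mult_mono) (simp_all add: \<delta>_def)
    also have "N * (1 / (2 * N)) = 1 / 2" if "N > 0" for N :: real
      using that by simp
    note this[OF nC]
    finally show "real n * C * \<delta> \<le> 1 / 2" .
  qed
  have "continuous_on (cball z0 \<delta>) (y i)" if "i < n" for i
  proof (intro continuous_at_imp_continuous_on ballI)
    fix z
    assume "z \<in> cball z0 \<delta>"
    then have "z \<in> S"
      using \<rho>(2) \<delta>(2) by auto
    then show "isCont (y i) z"
      by (rule DERIV_isCont[OF deriv[OF that]])
  qed
  then have "continuous_on (cball z0 \<delta>) (\<lambda>z. \<Sum>i<n. norm (y i z))"
    by (intro continuous_intros) auto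
  then obtain z1 where z1: "z1 \<in> cball z0 \<delta>"
    "\<And>z. z \<in> cball z0 \<delta> \<Longrightarrow> (\<Sum>i<n. norm (y i z)) \<le> (\<Sum>i<n. norm (y i z1))"
    using continuous_attains_sup[of "cball z0 \<delta>" "\<lambda>z. \<Sum>i<n. norm (y i z)"] \<delta>(1) by auto
  define m where "m = (\<Sum>i<n. norm (y i z1))"
  have "m \<ge> 0"
    by (simp add: m_def sum_nonneg)
  have "norm (y i z1) \<le> C * m * \<delta>" if i: "i < n" for i
  proof -
    have "norm (y i z1 - y i z0) \<le> C * m * norm (z1 - z0)"
    proof (rule field_differentiable_bound[of "cball z0 \<delta>" "y i" "\<lambda>z. \<Sum>j<n. M i j z * y j z"])
      fix z
      assume z: "z \<in> cball z0 \<delta>"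
      then have z': "z \<in> cball z0 \<rho>"
        using \<delta>(2) by simp
      then show "(y i has_field_derivative (\<Sum>j<n. M i j z * y j z)) (at z within cball z0 \<delta>)"
        using deriv[OF i] \<rho>(2) by (blast intro: has_field_derivative_at_within)
      have "norm (\<Sum>j<n. M i j z * y j z) \<le> (\<Sum>j<n. C * norm (y j z))"
        using entry[OF i _ z'] by (intro order.trans[OF norm_sum] sum_mono) (simp add: norm_mult mult_right_mono)
      also have "\<dots> \<le> C * m"
        using z1(2)[OF z] C(2) by (simp add: m_def mult_left_mono flip: sum_distrib_left)
      finally show "norm (\<Sum>j<n. M i j z * y j z) \<le> C * m" .
    qed (use z1 \<delta> in auto)
    also have "\<dots> \<le> C * m * \<delta>"
      using z1(1) C(2) \<open>m \<ge> 0\<close> by (intro mult_left_mono) (auto simp: dist_norm norm_minus_commute)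
    finally show ?thesis
      using init[OF i] by simp
  qed
  then have "m \<le> (\<Sum>i<n. C * m * \<delta>)"
    unfolding m_def by (intro sum_mono) auto
  also have "\<dots> = (real n * C * \<delta>) * m"
    by simp
  also have "\<dots> \<le> 1 / 2 * m"
    using \<delta>(3) \<open>m \<ge> 0\<close> by (rule mult_right_mono)
  finally have "m = 0"
    using \<open>m \<ge> 0\<close> by simp
  have "y i z = 0" if "i < n" "z \<in> cball z0 \<delta>" for i z
  proof -
    have "norm (y i z) \<le> (\<Sum>i<n. norm (y i z))"
      using that(1) by (intro member_le_sum[of i "{..<n}" "\<lambda>i. norm (y i z)"]) auto
    also have "\<dots> \<le> m"
      unfolding m_def by (rule z1(2)[OF that(2)])
    finally show ?thesis
      using \<open>m = 0\<close> by simp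
  qed
  with \<delta>(1) show ?thesis
    using that by blast
qed

text \<open>The unknowns are holomorphic, so vanishing near z0 spreads over the connected set by the
  identity theorem.\<close>

lemma linear_system_unique:
  fixes y :: "nat \<Rightarrow> complex \<Rightarrow> complex" and M :: "nat \<Rightarrow> nat \<Rightarrow> complex \<Rightarrow> complex"
  assumes S: "open S" "connected S" "z0 \<in> S"
    and deriv: "\<And>i z. i < n \<Longrightarrow> z \<in> S \<Longrightarrow> (y i has_field_derivative (\<Sum>j<n. M i j z * y j z)) (at z)"
    and cont: "\<And>i j. i < n \<Longrightarrow> j < n \<Longrightarrow> continuous_on S (M i j)"
    and init: "\<And>i. i < n \<Longrightarrow> y i z0 = 0"
    and "i < n" "z \<in> S"
  shows "y i z = 0"
proof -
  obtain \<delta> where \<delta>: "\<delta> > 0" "\<And>i z. i < n \<Longrightarrow> z \<in> cball z0 \<delta> \<Longrightarrow> y i z = 0"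
    using linear_system_unique_local[OF S(1,3) deriv cont init] by blast
  have "open (S \<inter> ball z0 \<delta>)" "S \<inter> ball z0 \<delta> \<noteq> {}"
    using S \<delta>(1) centre_in_ball[of z0 \<delta>] by blast+
  moreover have "y i holomorphic_on S"
    using deriv[OF \<open>i < n\<close>] S(1) by (auto simp: holomorphic_on_open)
  ultimately show ?thesis
    using analytic_continuation_open[of "S \<inter> ball z0 \<delta>" S "y i" "\<lambda>_. 0" z] S \<delta>(2)[OF \<open>i < n\<close>] \<open>z \<in> S\<close>
    by (auto simp: subset_iff less_imp_le)
qed

section \<open>Uniqueness of analytic continuation\<close>

text \<open>Agreement of the two germs at \<gamma> t is a locally constant property of t, hence
  passes from 0 to 1 in the connected interval.\<close>

lemma continues_along_unique:
  assumes \<gamma>: "continuous_on {0..1} \<gamma>" and g: "continues_along \<gamma> f g" and h: "continues_along \<gamma> f h"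
  shows "\<forall>\<^sub>F u in nhds (\<gamma> 1). g u = h u"
proof -
  obtain F where F: "\<And>t. t \<in> {0..1} \<Longrightarrow> F t analytic_on {\<gamma> t}"
    "\<And>t. t \<in> {0..1} \<Longrightarrow> \<forall>\<^sub>F s in at t within {0..1}. \<forall>\<^sub>F u in nhds (\<gamma> s). F s u = F t u"
    "\<forall>\<^sub>F u in nhds (\<gamma> 0). F 0 u = f u" "\<forall>\<^sub>F u in nhds (\<gamma> 1). F 1 u = g u"
    using g unfolding continues_along_def by blast
  obtain G where G: "\<And>t. t \<in> {0..1} \<Longrightarrow> G t analytic_on {\<gamma> t}"
    "\<And>t. t \<in> {0..1} \<Longrightarrow> \<forall>\<^sub>F s in at t within {0..1}. \<forall>\<^sub>F u in nhds (\<gamma> s). G s u = G t u"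
    "\<forall>\<^sub>F u in nhds (\<gamma> 0). G 0 u = f u" "\<forall>\<^sub>F u in nhds (\<gamma> 1). G 1 u = h u"
    using h unfolding continues_along_def by blast
  define P where "P t = (\<forall>\<^sub>F u in nhds (\<gamma> t). F t u = G t u)" for t
  have local: "\<exists>T. openin (top_of_set {0..1}) T \<and> t \<in> T \<and> (\<forall>x\<in>T. \<forall>y\<in>T. P x \<longrightarrow> P y)"
    if t: "t \<in> {0..1}" for t :: real
  proof -
    obtain e1 where e1: "e1 > 0" "F t holomorphic_on ball (\<gamma> t) e1"
      using F(1)[OF t] by (auto simp: analytic_on_def)
    obtain e2 where e2: "e2 > 0" "G t holomorphic_on ball (\<gamma> t) e2"
      using G(1)[OF t] by (auto simp: analytic_on_def)
    define U where "U = ball (\<gamma> t) (min e1 e2)"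
    have hol: "F t holomorphic_on U" "G t holomorphic_on U"
      using e1(2) e2(2) by (auto simp: U_def intro: holomorphic_on_subset)
    have U: "open U" "connected U" "\<gamma> t \<in> U"
      using e1(1) e2(1) by (auto simp: U_def)
    have "\<forall>\<^sub>F s in at t within {0..1}. \<gamma> s \<in> U"
      using \<gamma> t U by (intro topological_tendstoD) (auto simp: continuous_on_def)
    then have "\<forall>\<^sub>F s in at t within {0..1}. \<gamma> s \<in> U \<and> (\<forall>\<^sub>F u in nhds (\<gamma> s). F s u = F t u)
        \<and> (\<forall>\<^sub>F u in nhds (\<gamma> s). G s u = G t u)"
      using F(2)[OF t] G(2)[OF t] by eventually_elim blast
    then obtain V where V: "open V" "t \<in> V" "\<And>s. s \<in> V \<Longrightarrow> s \<noteq> t \<Longrightarrow> s \<in> {0..1} \<Longrightarrow>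
        \<gamma> s \<in> U \<and> (\<forall>\<^sub>F u in nhds (\<gamma> s). F s u = F t u) \<and> (\<forall>\<^sub>F u in nhds (\<gamma> s). G s u = G t u)"
      unfolding eventually_at_topological by blast
    \<comment> \<open>The filter leaves out s = t, where the three claims are trivial.\<close>
    have V': "\<gamma> s \<in> U" "\<forall>\<^sub>F u in nhds (\<gamma> s). F s u = F t u" "\<forall>\<^sub>F u in nhds (\<gamma> s). G s u = G t u"
      if "s \<in> V \<inter> {0..1}" for s
      using V(3)[of s] that U(3) by (cases "s = t"; auto)+
    \<comment> \<open>By the identity theorem on the disc \<open>U\<close>, agreement near any of
      its points is agreement on all of it, a condition without s.\<close>
    have iff: "P s \<longleftrightarrow> (\<forall>u\<in>U. F t u = G t u)" if s: "s \<in> V \<inter> {0..1}" for s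
    proof
      assume "P s"
      then have "\<forall>\<^sub>F u in nhds (\<gamma> s). F t u = G t u"
        unfolding P_def using V'(2,3)[OF s] by eventually_elim simp
      then obtain W where W: "open W" "\<gamma> s \<in> W" "\<And>u. u \<in> W \<Longrightarrow> F t u = G t u"
        unfolding eventually_nhds by blast
      show "\<forall>u\<in>U. F t u = G t u"
        using analytic_continuation_open[of "W \<inter> U" U "F t" "G t"] W U V'(1)[OF s] hol by blast
    next
      assume "\<forall>u\<in>U. F t u = G t u"
      then have "\<forall>\<^sub>F u in nhds (\<gamma> s). F t u = G t u"
        using U(1) V'(1)[OF s] unfolding eventually_nhds by blast
      then show "P s"
        unfolding P_def using V'(2,3)[OF s] by eventually_elim simp
    qed
    have "openin (top_of_set {0..1}) (V \<inter> {0..1})"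
      using V(1) unfolding openin_open by blast
    then show ?thesis
      using iff V(2) t by (intro exI[of _ "V \<inter> {0..1}"]) blast
  qed
  have "P 0"
    unfolding P_def using F(3) G(3) by eventually_elim simp
  then have "P 1"
    by (intro connected_induction_simple[of "{0..1::real}" 0 1 P] local) auto
  then show ?thesis
    unfolding P_def using F(4) G(4) by eventually_elim simp
qed

section \<open>Local solutions near zero\<close>

lemma theta_power_Suc: "(theta ^^ Suc n) f z = z * deriv ((theta ^^ n) f) z"
  unfolding funpow.simps comp_apply by (subst theta_def) (rule refl)

lemma theta_power_holomorphic:
  assumes "open S" "f holomorphic_on S"
  shows "(theta ^^ n) f holomorphic_on S"
proof (induction n)
  case (Suc n)
  then show ?case
    using assms(1) by (auto simp: theta_def intro!: holomorphic_intros)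
qed (use assms in simp)

section \<open>The loop around zero acting on coefficients\<close>

abbreviation loop_multiplier :: "complex fps" where
  "loop_multiplier \<equiv> fps_exp (2 * of_real pi * \<i>)"

lemma frob_sol_add: "frob_sol c (A + A') s = frob_sol c A s + frob_sol c A' s"
  and frob_sol_diff: "frob_sol c (A - A') s = frob_sol c A s - frob_sol c A' s"
  and frob_sol_scale: "frob_sol c (fps_const a * A) s = a * frob_sol c A s"
  by (simp_all add: frob_sol_eq algebra_simps)

lemma frob_sol_0: "frob_sol c 0 s = 0"
  by (simp add: frob_sol_eq)

lemma frob_sol_cong: "(\<And>j. j < 4 \<Longrightarrow> A $ j = A' $ j) \<Longrightarrow> frob_sol c A s = frob_sol c A' s"
  by (simp add: frob_sol_eq)

text \<open>The first factor has order at least j and the second has order 3 - j, so the coefficient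
  of eps^3 in the product is the product of the leading coefficients.\<close>

lemma frob_sol_leading:
  fixes A :: "complex fps"
  assumes "\<And>i. i < j \<Longrightarrow> A $ i = 0" "j \<le> 3"
  shows "frob_sol c (A * (loop_multiplier - 1) ^ (3 - j)) s
    = A $ j * (2 * of_real pi * \<i>) ^ (3 - j) * frob_fun c s $ 0"
proof -
  define V where "V = fps_shift 1 (loop_multiplier - 1)"
  have V: "loop_multiplier - 1 = fps_X * V"
    by (rule fps_ext) (simp add: V_def)
  define A' where "A' = fps_shift j A"
  have A: "A = fps_X ^ j * A'"
    using assms(1) by (intro fps_ext) (simp add: A'_def fps_X_power_mult_nth)
  have eq: "A * (loop_multiplier - 1) ^ (3 - j) * frob_fun c s
      = fps_X ^ (j + (3 - j)) * (A' * V ^ (3 - j) * frob_fun c s)"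
    unfolding A V by (simp only: power_add power_mult_distrib mult_ac)
  have "frob_sol c (A * (loop_multiplier - 1) ^ (3 - j)) s = (A' * V ^ (3 - j) * frob_fun c s) $ 0"
    using assms(2) unfolding frob_sol_def eq by (simp add: fps_X_power_mult_nth)
  also have "\<dots> = A $ j * (2 * of_real pi * \<i>) ^ (3 - j) * frob_fun c s $ 0"
    by (simp add: fps_nth_power_0 V_def A'_def)
  finally show ?thesis .
qed

text \<open>The bound by the modulus of lam keeps the singular point lam outside, and the conditions
  on z0 and r keep the disc inside norm z < R and away from 0. Column 0 is the holomorphic solution
  at zero; that it has no zeros makes \<open>frob_sol_leading\<close> effective.\<close>

locale frobenius_disc =
  fixes p :: "nat \<Rightarrow> complex" and lam z0 :: complex and R r :: real and k :: nat
  assumes lam: "lam \<noteq> 0" and R: "R > 0" "R \<le> norm lam"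
    and conv: "converges_within R (frobenius p lam)"
    and p4: "p 4 = 1"
    and B_eq: "\<And>z j. z \<noteq> lam \<Longrightarrow> j < 4 \<Longrightarrow> B k z j = p j * z / (z - lam)"
    and nonzero: "\<And>z. norm z < R \<Longrightarrow> eval_fps (column (frobenius p lam) 0) z \<noteq> 0"
    and z0: "z0 \<noteq> 0" "2 * norm z0 < R"
    and r: "0 < r" "r \<le> norm z0"
begin

abbreviation c :: "nat \<Rightarrow> complex fps" where
  "c \<equiv> frobenius p lam"

text \<open>Unlike \<open>Ln z\<close>, this branch never meets its cut on the disc, because z / z0
  has positive real part there.\<close>

definition log_branch :: "complex \<Rightarrow> complex" where
  "log_branch z = Ln z0 + Ln (z / z0)"

definition sol :: "complex fps \<Rightarrow> complex \<Rightarrow> complex" where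
  "sol A z = (if z \<in> ball z0 r then frob_sol c A (log_branch z) else 0)"

lemma disc:
  assumes "z \<in> ball z0 r"
  shows "z \<noteq> 0" "norm z < R" "z \<noteq> lam" "Re (z / z0) > 0"
proof -
  have d: "norm (z - z0) < norm z0"
    using assms r by (simp add: dist_norm norm_minus_commute)
  then show "z \<noteq> 0"
    by auto
  have "norm z \<le> norm (z - z0) + norm z0"
    using norm_triangle_ineq[of "z - z0" z0] by simp
  then show "norm z < R"
    using d z0 by simp
  then show "z \<noteq> lam"
    using R by auto
  have "norm (z / z0 - 1) = norm (z - z0) / norm z0"
    using z0 by (simp add: diff_divide_distrib flip: norm_divide)
  then have "norm (z / z0 - 1) < 1"
    using d z0 by simp
  then show "Re (z / z0) > 0"
    using abs_Re_le_cmod[of "z / z0 - 1"] by simp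
qed

lemma norm_z0: "norm z0 < R"
  using z0 zero_less_norm_iff[of z0] by linarith

lemma Re_pos_not_nonpos_Reals: "Re z > 0 \<Longrightarrow> z \<notin> \<real>\<^sub>\<le>\<^sub>0"
  by (auto simp: complex_nonpos_Reals_iff)

lemma exp_log_branch: "z \<noteq> 0 \<Longrightarrow> exp (log_branch z) = z"
  using z0 by (simp add: log_branch_def exp_add)

lemma log_branch_has_field_derivative:
  assumes "z \<in> ball z0 r"
  shows "(log_branch has_field_derivative 1 / z) (at z)"
proof -
  have "z / z0 \<notin> \<real>\<^sub>\<le>\<^sub>0"
    using disc(4)[OF assms] by (rule Re_pos_not_nonpos_Reals)
  then show ?thesis
    unfolding log_branch_def[abs_def]
    using z0 disc(1)[OF assms] by (auto intro!: derivative_eq_intros)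
qed

lemma theta_sol:
  assumes "z \<in> ball z0 r"
  shows "(theta ^^ n) (sol A) z = frob_sol (theta_seq n c) A (log_branch z)"
  using assms
proof (induction n arbitrary: z)
  case (Suc n)
  have "((\<lambda>z. frob_sol (theta_seq n c) A (log_branch z))
      has_field_derivative frob_sol (theta_seq 1 (theta_seq n c)) A (log_branch z) * (1 / z)) (at z)"
    by (rule DERIV_chain2[OF frob_sol_has_field_derivative[OF converges_within_theta_seq[OF conv]]
          log_branch_has_field_derivative[OF Suc.prems]])
      (use disc[OF Suc.prems] in \<open>simp add: exp_log_branch\<close>)
  then have "((theta ^^ n) (sol A) has_field_derivative
      frob_sol (theta_seq 1 (theta_seq n c)) A (log_branch z) * (1 / z)) (at z)"
    by (rule has_field_derivative_transform_within_open[OF _ open_ball Suc.prems]) (simp add: Suc.IH)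
  then have "deriv ((theta ^^ n) (sol A)) z = frob_sol (theta_seq (Suc n) c) A (log_branch z) * (1 / z)"
    unfolding theta_seq_Suc by (rule DERIV_imp_deriv)
  then show ?case
    using disc(1)[OF Suc.prems] by (simp only: theta_power_Suc) simp
qed (simp add: sol_def)

lemma sol_holomorphic: "sol A holomorphic_on ball z0 r"
proof -
  have "(\<lambda>z. frob_sol c A (log_branch z)) field_differentiable at z" if "z \<in> ball z0 r" for z
  proof -
    have "norm (exp (log_branch z)) < R"
      using disc[OF that] by (simp add: exp_log_branch)
    then show ?thesis
      using DERIV_chain2[OF frob_sol_has_field_derivative[OF conv] log_branch_has_field_derivative[OF that]]
      by (auto simp: field_differentiable_def)
  qed
  then have "(\<lambda>z. frob_sol c A (log_branch z)) holomorphic_on ball z0 r"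
    by (simp add: holomorphic_on_def field_differentiable_at_within)
  then show ?thesis
    by (rule holomorphic_transform) (simp add: sol_def)
qed

lemma sol_in_local_solutions: "sol A \<in> local_solutions k z0 r"
proof -
  have "(theta ^^ 4) (sol A) z + (\<Sum>j<4. B k z j * (theta ^^ j) (sol A) z) = 0" if z: "z \<in> ball z0 r" for z
  proof -
    define y where "y i = frob_sol (theta_seq i c) A (log_branch z)" for i
    have "lam * y 4 = z * (\<Sum>i\<le>4. p i * y i)"
      using frob_sol_ode[OF conv, of "log_branch z" A] lam disc[OF z] by (simp add: y_def exp_log_branch)
    also have "(\<Sum>i\<le>4. p i * y i) = (\<Sum>i<4. p i * y i) + y 4"
      using p4 by (simp add: eval_nat_numeral)
    finally have "(z - lam) * y 4 + z * (\<Sum>i<4. p i * y i) = 0"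
      by (simp add: algebra_simps)
    then have "y 4 + z / (z - lam) * (\<Sum>i<4. p i * y i) = 0"
      using disc(3)[OF z] by (simp add: field_simps)
    moreover have "(\<Sum>j<4. B k z j * y j) = z / (z - lam) * (\<Sum>i<4. p i * y i)"
      unfolding sum_distrib_left by (intro sum.cong refl) (simp add: B_eq disc(3)[OF z])
    ultimately show ?thesis
      by (simp add: theta_sol[OF z] y_def)
  qed
  then show ?thesis
    by (simp add: local_solutions_def sol_holomorphic) (simp add: sol_def)
qed

text \<open>The difference of the solutions and its first three theta-derivatives satisfy a linear
  system of first order with zero initial values.\<close>

lemma local_solutions_eqI:
  assumes f: "f \<in> local_solutions k z0 r" and g: "g \<in> local_solutions k z0 r"
    and init: "\<And>i. i < 4 \<Longrightarrow> (theta ^^ i) f z0 = (theta ^^ i) g z0"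
  shows "f = g"
proof
  fix z
  define y where "y i z = (theta ^^ i) f z - (theta ^^ i) g z" for i z
  \<comment> \<open>The companion matrix of the equation, divided by z since the ordinary derivative
    is theta / z.\<close>
  define M where "M i j z = (if i = 3 then - B k z j / z else if j = Suc i then 1 / z else 0)"
    for i j :: nat and z :: complex
  show "f z = g z"
  proof (cases "z \<in> ball z0 r")
    case True
    have "y 0 z = 0"
    proof (rule linear_system_unique[of "ball z0 r" z0 4 y M])
      fix i z
      assume i: "i < (4::nat)" and z: "z \<in> ball z0 r"
      have *: "((theta ^^ i) h has_field_derivative (theta ^^ Suc i) h z / z) (at z)"
        if "h \<in> local_solutions k z0 r" for h
      proof -
        have "(theta ^^ i) h holomorphic_on ball z0 r"
          using that by (intro theta_power_holomorphic) (auto simp: local_solutions_def)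
        then show ?thesis
          using disc(1)[OF z] holomorphic_derivI[OF _ open_ball z] by (simp only: theta_power_Suc) simp
      qed
      have "(y i has_field_derivative y (Suc i) z / z) (at z)"
        unfolding y_def[abs_def] diff_divide_distrib
        by (rule DERIV_diff[OF *[OF f] *[OF g]])
      moreover have "y (Suc i) z / z = (\<Sum>j<4. M i j z * y j z)"
      proof (cases "i = 3")
        case True
        have ode: "(theta ^^ 4) h z = - (\<Sum>j<4. B k z j * (theta ^^ j) h z)"
          if "h \<in> local_solutions k z0 r" for h
          using that z by (simp add: local_solutions_def eq_neg_iff_add_eq_0)
        have "y 4 z = - (\<Sum>j<4. B k z j * y j z)"
          by (simp add: y_def ode[OF f] ode[OF g] right_diff_distrib sum_subtractf)
        then show ?thesis
          using True by (simp add: M_def sum_divide_distrib sum_negf)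
      next
        case False
        have "(\<Sum>j<4. M i j z * y j z) = (\<Sum>j<4. if j = Suc i then y (Suc i) z / z else 0)"
          using False by (intro sum.cong) (auto simp: M_def)
        then show ?thesis
          using False i by simp
      qed
      ultimately show "(y i has_field_derivative (\<Sum>j<4. M i j z * y j z)) (at z)"
        by simp
    next
      fix i j
      assume "j < (4::nat)"
      then have "continuous_on (ball z0 r) (\<lambda>z. p j * z / (z - lam))"
        using disc(3) by (intro continuous_intros) auto
      then have "continuous_on (ball z0 r) (\<lambda>z. B k z j)"
        by (rule continuous_on_eq) (simp add: B_eq disc(3) \<open>j < 4\<close>)
      then show "continuous_on (ball z0 r) (M i j)"
        using disc(1) unfolding M_def[abs_def]
        by (cases "i = 3"; cases "j = Suc i") (simp_all del: mem_ball add: continuous_on_divide continuous_on_minus)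
    qed (use r True init in \<open>auto simp: y_def\<close>)
    then show ?thesis
      by (simp add: y_def)
  next
    case False
    then show ?thesis
      using f g by (simp add: local_solutions_def)
  qed
qed

text \<open>Once the lower coefficients are known to vanish, multiplication by
  \<open>(loop_multiplier - 1) ^ (3 - j)\<close> isolates the j-th one. Vanishing is assumed on the
  half plane, since the translations by 2 pi i must stay in the domain.\<close>

lemma frob_sol_eq_0_imp:
  fixes A :: "complex fps"
  assumes "\<And>s. norm (exp s) < R \<Longrightarrow> frob_sol c A s = 0" "j < 4"
  shows "A $ j = 0"
  using assms(2)
proof (induction j rule: less_induct)
  case (less j)
  \<comment> \<open>The domain is invariant under s -> s + 2 pi i, and the difference of the two
    values is multiplication by \<open>loop_multiplier - 1\<close>.\<close>
  have step: "frob_sol c (A * (loop_multiplier - 1) ^ m) s = 0" if "norm (exp s) < R" for m s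
    using that
  proof (induction m arbitrary: s)
    case (Suc m)
    have "A * (loop_multiplier - 1) ^ Suc m
        = A * (loop_multiplier - 1) ^ m * loop_multiplier - A * (loop_multiplier - 1) ^ m"
      by (simp add: algebra_simps)
    then have "frob_sol c (A * (loop_multiplier - 1) ^ Suc m) s
        = frob_sol c (A * (loop_multiplier - 1) ^ m) (s + 2 * of_real pi * \<i>)
          - frob_sol c (A * (loop_multiplier - 1) ^ m) s"
      by (simp only: frob_sol_diff frob_sol_periodic[OF exp_two_pi_i])
    also have "\<dots> = 0"
    proof -
      have "norm (exp (s + 2 * of_real pi * \<i>)) < R"
        using Suc.prems by (simp only: exp_add exp_two_pi_i mult_1_right)
      then show ?thesis
        using Suc.prems by (simp only: Suc.IH diff_zero)
    qed
    finally show ?case .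
  qed (use assms(1) in simp)
  have s: "norm (exp (Ln z0)) < R"
    using z0(1) norm_z0 by simp
  have "A $ j * (2 * of_real pi * \<i>) ^ (3 - j) * frob_fun c (Ln z0) $ 0 = 0"
    using frob_sol_leading[of j A c "Ln z0"] step[OF s] less by simp
  moreover have "frob_fun c (Ln z0) $ 0 \<noteq> 0"
    using nonzero[OF s] by (simp add: frob_fun_nth)
  ultimately show ?case
    by simp
qed

text \<open>Vanishing on the disc means vanishing of \<open>frob_sol\<close> on a small open set of
  logarithms, and the identity theorem extends this to the half plane.\<close>

lemma sol_eq_0_imp:
  fixes A :: "complex fps"
  assumes "sol A = 0" "j < 4"
  shows "A $ j = 0"
proof (rule frob_sol_eq_0_imp[OF _ assms(2)])
  fix s :: complex
  assume s: "norm (exp s) < R"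
  define H where "H = {s. Re s < ln R}"
  have H: "norm (exp s) < R \<longleftrightarrow> s \<in> H" for s :: complex
    using R(1) unfolding H_def mem_Collect_eq norm_exp_eq_Re by (metis exp_less_cancel_iff exp_ln)
  \<comment> \<open>Within distance 1 < pi of Ln z0 the branch \<open>log_branch\<close> really
    inverts exp.\<close>
  define W where "W = H \<inter> (exp -` ball z0 r \<inter> ball (Ln z0) 1)"
  have "open H" "connected H"
    by (simp_all add: H_def open_halfspace_Re_lt convex_halfspace_Re_lt convex_connected)
  have "open (exp -` ball z0 r :: complex set)"
    by (intro open_vimage open_ball continuous_intros)
  then have "open W"
    unfolding W_def using \<open>open H\<close> by (intro open_Int open_ball)
  have "W \<noteq> {}"
    using z0(1) norm_z0 r H[of "Ln z0"] by (auto simp: W_def intro!: exI[of _ "Ln z0"])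
  have "W \<subseteq> H"
    by (simp add: W_def)
  have "frob_sol c A holomorphic_on H"
    using frob_sol_has_field_derivative[OF conv] H \<open>open H\<close>
    by (auto simp: holomorphic_on_open)
  have zero: "frob_sol c A s = 0" if "s \<in> W" for s
  proof -
    have "norm (s - Ln z0) < 1" "exp s \<in> ball z0 r"
      using that by (auto simp: W_def dist_norm norm_minus_commute)
    moreover have "\<bar>Im (s - Ln z0)\<bar> < pi"
      using abs_Im_le_cmod[of "s - Ln z0"] calculation(1) pi_gt3 by linarith
    then have "Ln (exp (s - Ln z0)) = s - Ln z0"
      by (intro Ln_exp) (auto simp: abs_less_iff)
    then have "log_branch (exp s) = s"
      using z0 by (simp add: log_branch_def exp_diff)
    ultimately show ?thesis
      using fun_cong[OF assms(1), of "exp s"] by (simp add: sol_def)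
  qed
  from \<open>open W\<close> \<open>open H\<close> \<open>W \<noteq> {}\<close> \<open>connected H\<close> \<open>W \<subseteq> H\<close> \<open>frob_sol c A holomorphic_on H\<close>
    holomorphic_on_const zero
  show "frob_sol c A s = 0"
    by (rule analytic_continuation_open) (use s H[of s] in simp_all)
qed

lemma sol_add: "sol (A + A') = sol A + sol A'"
  and sol_diff: "sol (A - A') = sol A - sol A'"
  and sol_scale: "sol (fps_const a * A) = scale_fun a (sol A)"
  by (simp_all add: fun_eq_iff sol_def frob_sol_add frob_sol_diff frob_sol_scale scale_fun_def)

lemma sol_0: "sol 0 = 0"
  by (simp add: fun_eq_iff sol_def frob_sol_0)

lemma sol_cong: "(\<And>j. j < 4 \<Longrightarrow> A $ j = A' $ j) \<Longrightarrow> sol A = sol A'"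
  using frob_sol_cong[of A A' c] by (simp add: fun_eq_iff sol_def)

text \<open>The initial values at \<open>z0\<close> depend injectively, hence surjectively, on four coefficients.\<close>

lemma local_solutions_eq: "local_solutions k z0 r = range sol"
proof (intro equalityI subsetI)
  fix f
  assume f: "f \<in> local_solutions k z0 r"
  \<comment> \<open>C^4 is written as a nested product to have a Euclidean space. Real linearity is
    enough to pass from injective to surjective there.\<close>
  define P :: "complex \<times> complex \<times> complex \<times> complex \<Rightarrow> complex fps" where
    "P = (\<lambda>(a0, a1, a2, a3). fps_const a0 + fps_const a1 * fps_X + fps_const a2 * fps_X ^ 2 + fps_const a3 * fps_X ^ 3)"
  define Y where "Y A i = frob_sol (theta_seq i c) A (log_branch z0)" for A i
  have z0_in: "z0 \<in> ball z0 r"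
    using r by simp
  have Y: "(theta ^^ i) (sol A) z0 = Y A i" for A i
    by (simp add: Y_def theta_sol[OF z0_in])
  define L where "L v = (Y (P v) 0, Y (P v) 1, Y (P v) 2, Y (P v) 3)" for v
  have P_add: "P (v + v') = P v + P v'" for v v'
    by (cases v; cases v') (simp add: P_def algebra_simps flip: fps_const_add)
  have P_scale: "P (a *\<^sub>R v) = fps_const (of_real a) * P v" for a v
    by (cases v) (simp add: P_def algebra_simps scaleR_conv_of_real flip: fps_const_mult)
  have "linear L"
    by (rule linearI) (simp_all add: L_def P_add P_scale Y_def frob_sol_add frob_sol_scale scaleR_conv_of_real)
  moreover have "inj L"
  proof (subst linear_injective_0[OF \<open>linear L\<close>], intro allI impI)
    fix v
    assume "L v = 0"
    then have "Y (P v) i = 0" if "i < 4" for i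
      using that by (auto simp: L_def zero_prod_def less_Suc_eq eval_nat_numeral)
    then have "sol (P v) = sol 0"
      by (intro local_solutions_eqI sol_in_local_solutions) (simp add: Y, simp add: Y_def frob_sol_0)
    then have "P v $ j = 0" if "j < 4" for j
      using sol_eq_0_imp[of "P v" j] that by (simp add: sol_0)
    from this[of 0] this[of 1] this[of 2] this[of 3] show "v = 0"
      by (cases v) (simp add: P_def zero_prod_def fps_X_power_nth)
  qed
  ultimately have "surj L"
    by (rule linear_injective_imp_surjective) (rule refl)
  then obtain v where v: "L v = (f z0, (theta ^^ 1) f z0, (theta ^^ 2) f z0, (theta ^^ 3) f z0)"
    by (metis surjD)
  have "f = sol (P v)"
  proof (rule local_solutions_eqI[OF f sol_in_local_solutions])
    fix i :: nat
    assume "i < 4"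
    then consider "i = 0" | "i = 1" | "i = 2" | "i = 3"
      by linarith
    then show "(theta ^^ i) f z0 = (theta ^^ i) (sol (P v)) z0"
      using v unfolding Y L_def by cases simp_all
  qed
  then show "f \<in> range sol"
    by blast
qed (use sol_in_local_solutions in blast)

lemma subspace_local_solutions: "cfun.subspace (local_solutions k z0 r)"
  unfolding local_solutions_eq cfun.subspace_def
proof (intro conjI ballI allI)
  show "0 \<in> range sol"
    using sol_0 by (metis rangeI)
  show "f + g \<in> range sol" if "f \<in> range sol" "g \<in> range sol" for f g
    using that by (auto simp flip: sol_add)
  show "scale_fun a f \<in> range sol" if "f \<in> range sol" for a f
    using that by (auto simp flip: sol_scale)
qed

text \<open>The solutions belonging to 1, eps, eps^2, eps^3 form a basis: a combination is
  \<open>sol\<close> of a polynomial, which is determined modulo eps^4.\<close>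

lemma dim_local_solutions: "cfun.dim (local_solutions k z0 r) = 4"
proof -
  let ?b = "\<lambda>j. sol (fps_X ^ j)"
  have sum: "(\<Sum>j<n. scale_fun (a j) (?b j)) = sol (\<Sum>j<n. fps_const (a j) * fps_X ^ j)" for a and n :: nat
    by (induction n) (simp_all add: sol_0 sol_add sol_scale)
  have nth: "(\<Sum>j<4. fps_const (a j) * fps_X ^ j) $ i = a i" if "i < 4" for a :: "nat \<Rightarrow> complex" and i
  proof -
    have "(\<Sum>j<4. fps_const (a j) * fps_X ^ j) $ i = (\<Sum>j<4. if j = i then a i else 0)"
      unfolding fps_sum_nth by (intro sum.cong refl) (auto simp: fps_X_power_nth)
    then show ?thesis
      using that by simp
  qed
  have indep: "a i = 0" if "(\<Sum>j<4. scale_fun (a j) (?b j)) = 0" "i < 4" for a and i :: nat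
    using sol_eq_0_imp[of "\<Sum>j<4. fps_const (a j) * fps_X ^ j" i] that nth[of i a] by (simp add: sum)
  have inj: "inj_on ?b {..<4}"
  proof (rule inj_onI, rule ccontr)
    fix i j :: nat
    assume ij: "i \<in> {..<4}" "j \<in> {..<4}" "?b i = ?b j" "i \<noteq> j"
    have "(fps_X ^ i - fps_X ^ j) $ i = (0 :: complex)"
      using ij by (intro sol_eq_0_imp) (simp_all add: sol_diff)
    then show False
      using ij by (simp add: fps_X_power_nth)
  qed
  have ind: "cfun.independent (?b ` {..<4})"
  proof (rule cfun.independent_if_scalars_zero)
    fix u x
    assume u: "(\<Sum>x\<in>?b ` {..<4}. scale_fun (u x) x) = 0" and "x \<in> ?b ` {..<4}"
    then obtain i where "i < 4" "x = ?b i"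
      by blast
    moreover have "(\<Sum>j<4. scale_fun (u (?b j)) (?b j)) = 0"
      using u by (simp add: sum.reindex[OF inj])
    ultimately show "u x = 0"
      using indep[of "\<lambda>j. u (?b j)" i] by simp
  qed simp
  have span1: "cfun.span (?b ` {..<4}) = local_solutions k z0 r"
  proof (rule cfun.span_unique)
    show "?b ` {..<4} \<subseteq> local_solutions k z0 r"
      unfolding local_solutions_eq by blast
    show "cfun.subspace (local_solutions k z0 r)"
      by (rule subspace_local_solutions)
    fix V
    assume V: "?b ` {..<4} \<subseteq> V" "cfun.subspace V"
    have "sol A \<in> V" for A
    proof -
      have "sol A = (\<Sum>j<4. scale_fun (A $ j) (?b j))"
        unfolding sum using nth[of _ "($) A"] by (intro sol_cong) simp
      also have "\<dots> \<in> V"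
        using V by (intro cfun.subspace_sum cfun.subspace_scale) auto
      finally show ?thesis .
    qed
    then show "local_solutions k z0 r \<subseteq> V"
      unfolding local_solutions_eq by blast
  qed
  have span2: "cfun.span (local_solutions k z0 r) = local_solutions k z0 r"
    using subspace_local_solutions by (rule cfun.span_eq_iff[THEN iffD2])
  have "cfun.dim (local_solutions k z0 r) = card (?b ` {..<4})"
    by (rule cfun.dim_eq_card[OF trans[OF span1 span2[symmetric]] ind])
  also have "\<dots> = 4"
    by (simp add: card_image[OF inj])
  finally show ?thesis .
qed

lemma continues_along_sol: "continues_along (loop0 z0) (sol A) (sol (A * loop_multiplier))"
proof -
  \<comment> \<open>The branch of the logarithm is carried along: at the moving centre it takes the
    value Ln z0 + 2 pi i t, which has gained 2 pi i at the end.\<close>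
  define F where "F t u = frob_sol c A (Ln z0 + 2 * of_real pi * \<i> * of_real t + Ln (u / loop0 z0 t))" for t :: real and u
  have loop: "loop0 z0 t \<noteq> 0" "norm (loop0 z0 t) = norm z0" for t
    using z0(1) by (simp_all add: loop0_def norm_mult)
  have exp_loop: "exp (Ln z0 + 2 * of_real pi * \<i> * of_real t) = loop0 z0 t" for t
    using z0(1) by (simp add: exp_add loop0_def cis_conv_exp mult_ac)
  define U where "U t = {u. norm u < R \<and> Re (u / loop0 z0 t) > 0}" for t
  have U: "open (U t)" "loop0 z0 t \<in> U t" for t
  proof -
    show "open (U t)"
      unfolding U_def using loop by (intro open_Collect_conj open_Collect_less continuous_intros) auto
    show "loop0 z0 t \<in> U t"
      using loop[of t] norm_z0 by (simp add: U_def)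
  qed
  have "F t analytic_on {loop0 z0 t}" for t
  proof -
    have "F t field_differentiable at u" if u: "u \<in> U t" for u
    proof -
      have "u \<noteq> 0"
        using u by (auto simp: U_def)
      then have "exp (Ln z0 + 2 * of_real pi * \<i> * of_real t + Ln (u / loop0 z0 t)) = u"
        using loop[of t] by (simp add: exp_add[of "Ln z0 + 2 * of_real pi * \<i> * of_real t"] exp_loop)
      then have small: "norm (exp (Ln z0 + 2 * of_real pi * \<i> * of_real t + Ln (u / loop0 z0 t))) < R"
        using u by (simp add: U_def)
      have deriv: "((\<lambda>u. Ln z0 + 2 * of_real pi * \<i> * of_real t + Ln (u / loop0 z0 t))
          has_field_derivative 1 / u) (at u)"
        using loop[of t] u \<open>u \<noteq> 0\<close> Re_pos_not_nonpos_Reals[of "u / loop0 z0 t"]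
        by (auto simp: U_def intro!: derivative_eq_intros)
      show ?thesis
        unfolding F_def[abs_def] field_differentiable_def
        by (rule exI, rule DERIV_chain2[OF frob_sol_has_field_derivative[OF conv small] deriv])
    qed
    then have "F t holomorphic_on U t"
      by (simp add: holomorphic_on_def field_differentiable_at_within)
    then have "F t analytic_on U t"
      using U by (simp add: analytic_on_open)
    then show ?thesis
      by (rule analytic_on_subset) (use U(2)[of t] in simp)
  qed
  moreover have "\<forall>\<^sub>F s in at t within {0..1}. \<forall>\<^sub>F u in nhds (loop0 z0 s). F s u = F t u" for t
  proof -
    \<comment> \<open>For a quarter turn at most, the angle between the centres and the argument of
      u / loop0 z0 s are both below pi / 2. Their sum stays below pi, and the principal logarithms
      add up.\<close>
    have "F s u = F t u" if st: "\<bar>s - t\<bar> < 1 / 4" and u: "u \<in> U s" for s u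
    proof -
      let ?d = "2 * pi * (s - t)"
      have "\<bar>?d\<bar> < pi / 2"
        using st pi_gt_zero by (simp add: abs_mult)
      moreover have "Re (u / loop0 z0 s) > 0"
        using u by (simp add: U_def)
      then have "\<bar>Im (Ln (u / loop0 z0 s))\<bar> < pi / 2"
        by (subst Re_Ln_pos_lt) auto
      ultimately have "\<bar>Im (Ln (u / loop0 z0 s)) + ?d\<bar> < pi"
        by linarith
      then have "Ln (exp (Ln (u / loop0 z0 s) + \<i> * of_real ?d)) = Ln (u / loop0 z0 s) + \<i> * of_real ?d"
        by (intro Ln_exp) (auto simp: abs_less_iff)
      moreover have "exp (Ln (u / loop0 z0 s) + \<i> * of_real ?d) = u / loop0 z0 t"
      proof -
        have "u \<noteq> 0"
          using u by (auto simp: U_def)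
        have "loop0 z0 s = loop0 z0 t * cis ?d"
          by (simp add: loop0_def cis_mult mult.assoc right_diff_distrib)
        moreover have "exp (Ln (u / loop0 z0 s) + \<i> * of_real ?d) = u / loop0 z0 s * cis ?d"
          using \<open>u \<noteq> 0\<close> loop(1)[of s] by (simp only: exp_add cis_conv_exp) simp
        ultimately show ?thesis
          by simp
      qed
      ultimately have "Ln (u / loop0 z0 t) = Ln (u / loop0 z0 s) + \<i> * of_real ?d"
        by simp
      then show ?thesis
        by (simp add: F_def algebra_simps)
    qed
    then have "\<forall>\<^sub>F u in nhds (loop0 z0 s). F s u = F t u" if "\<bar>s - t\<bar> < 1 / 4" for s
      using U[of s] that eventually_nhds by blast
    then show ?thesis
      unfolding eventually_at by (intro exI[of _ "1/4"]) (auto simp: dist_real_def)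
  qed
  moreover have "\<forall>\<^sub>F u in nhds (loop0 z0 0). F 0 u = sol A u"
  proof (rule eventually_nhds_in_open[THEN eventually_mono])
    show "open (ball z0 r)" "loop0 z0 0 \<in> ball z0 r"
      using r by (simp_all add: loop0_def)
    show "F 0 u = sol A u" if "u \<in> ball z0 r" for u
      using that by (simp add: F_def sol_def log_branch_def loop0_def)
  qed
  moreover have "\<forall>\<^sub>F u in nhds (loop0 z0 1). F 1 u = sol (A * loop_multiplier) u"
  proof (rule eventually_nhds_in_open[THEN eventually_mono])
    show "open (ball z0 r)" "loop0 z0 1 \<in> ball z0 r"
      using r by (simp_all add: loop0_def)
    show "F 1 u = sol (A * loop_multiplier) u" if u: "u \<in> ball z0 r" for u
    proof -
      have "F 1 u = frob_sol c A (log_branch u + 2 * of_real pi * \<i>)"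
        by (simp add: F_def log_branch_def loop0_def add_ac)
      then show ?thesis
        using u by (simp add: frob_sol_periodic[OF exp_two_pi_i] sol_def del: exp_two_pi_i)
    qed
  qed
  ultimately show ?thesis
    unfolding continues_along_def by (intro exI[of _ F]) auto
qed

lemma continuation_eq_sol:
  assumes "g \<in> local_solutions k z0 r" "continues_along (loop0 z0) (sol A) g"
  shows "g = sol (A * loop_multiplier)"
proof
  fix z
  have loop: "loop0 z0 1 = z0"
    by (simp add: loop0_def)
  have "continuous_on {0..1} (loop0 z0)"
    unfolding loop0_def by (intro continuous_intros)
  then have "\<forall>\<^sub>F u in nhds z0. g u = sol (A * loop_multiplier) u"
    using continues_along_unique[OF _ assms(2) continues_along_sol] loop by simp
  then obtain W where W: "open W" "z0 \<in> W" "\<And>u. u \<in> W \<Longrightarrow> g u = sol (A * loop_multiplier) u"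
    unfolding eventually_nhds by blast
  show "g z = sol (A * loop_multiplier) z"
  proof (cases "z \<in> ball z0 r")
    case True
    have "open (W \<inter> ball z0 r)" "W \<inter> ball z0 r \<noteq> {}" "W \<inter> ball z0 r \<subseteq> ball z0 r"
      using W r by auto
    moreover have "g holomorphic_on ball z0 r"
      using assms(1) by (simp add: local_solutions_def)
    ultimately show ?thesis
      using analytic_continuation_open[OF _ open_ball _ connected_ball _ _ sol_holomorphic _ True]
        W(3) by (metis IntD1)
  next
    case False
    then show ?thesis
      using assms(1) by (simp add: local_solutions_def sol_def)
  qed
qed

lemma unique_continuation:
  assumes "f \<in> local_solutions k z0 r"
  shows "\<exists>!g. g \<in> local_solutions k z0 r \<and> continues_along (loop0 z0) f g"
proof -
  obtain A where f: "f = sol A"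
    using assms unfolding local_solutions_eq by blast
  show ?thesis
    unfolding f
    using sol_in_local_solutions continues_along_sol continuation_eq_sol by blast
qed

lemma monodromy_sol: "monodromy k z0 r (sol A) = sol (A * loop_multiplier)"
  unfolding monodromy_def
  using sol_in_local_solutions continues_along_sol continuation_eq_sol by (intro the_equality) blast+

text \<open>A solution determines its parameter modulo eps^4, so multiplication of parameters is
  well defined on solutions.\<close>

lemma sol_mult_cong:
  assumes "sol A = sol A'"
  shows "sol (A * V) = sol (A' * V)"
proof (rule sol_cong)
  fix j :: nat
  assume "j < 4"
  have "A $ i = A' $ i" if "i < 4" for i
    using sol_eq_0_imp[of "A - A'" i] assms that by (simp add: sol_diff)
  then show "(A * V) $ j = (A' * V) $ j"
    using \<open>j < 4\<close> by (simp add: fps_mult_nth)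
qed

lemma linear_automorphism_monodromy: "linear_automorphism (local_solutions k z0 r) (monodromy k z0 r)"
proof -
  \<comment> \<open>The parameter of the loop run backwards, which inverts the monodromy.\<close>
  let ?E = "fps_exp (- (2 * of_real pi * \<i>)) :: complex fps"
  have L1: "loop_multiplier * ?E = 1"
    by (simp flip: fps_exp_add_mult)
  then have L2: "?E * loop_multiplier = 1"
    by (simp only: mult.commute[of ?E])
  have inv: "A * loop_multiplier * ?E = A" "A * ?E * loop_multiplier = A" for A
    by (simp_all only: mult.assoc[of A loop_multiplier] mult.assoc[of A ?E] L1 L2 mult_1_right)
  have "bij_betw (monodromy k z0 r) (range sol) (range sol)"
  proof (rule bij_betw_imageI)
    show "inj_on (monodromy k z0 r) (range sol)"
    proof (rule inj_onI, elim rangeE)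
      fix f g A A'
      assume eq: "monodromy k z0 r f = monodromy k z0 r g" and fg: "f = sol A" "g = sol A'"
      have "sol (A * loop_multiplier * ?E) = sol (A' * loop_multiplier * ?E)"
        using eq unfolding fg monodromy_sol by (rule sol_mult_cong)
      then show "f = g"
        by (simp only: fg inv)
    qed
    have "sol A \<in> monodromy k z0 r ` range sol" for A
      by (rule image_eqI[of _ _ "sol (A * ?E)"]) (simp_all only: monodromy_sol inv rangeI)
    moreover have "monodromy k z0 r (sol A) \<in> range sol" for A
      by (simp only: monodromy_sol rangeI)
    ultimately show "monodromy k z0 r ` range sol = range sol"
      by blast
  qed
  then show ?thesis
    unfolding linear_automorphism_def local_solutions_eq
    by (auto simp: monodromy_sol distrib_right mult.assoc simp flip: sol_add sol_scale)
qed

lemma maximally_unipotent_monodromy: "maximally_unipotent (local_solutions k z0 r) (monodromy k z0 r)"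
proof -
  have pow: "((\<lambda>g. monodromy k z0 r g - g) ^^ n) (sol A) = sol (A * (loop_multiplier - 1) ^ n)" for n A
  proof (induction n)
    case (Suc n)
    have "monodromy k z0 r (sol A') - sol A' = sol (A' * (loop_multiplier - 1))" for A'
      by (simp only: monodromy_sol sol_diff[symmetric] right_diff_distrib mult_1_right)
    with Suc show ?case
      by (simp only: funpow.simps comp_apply power_Suc2 mult.assoc)
  qed simp
  \<comment> \<open>By \<open>frob_sol_leading\<close> with j = 0 the result is (2 pi i)^3 times the
    holomorphic solution, which is nonzero at z0.\<close>
  have "((\<lambda>g. monodromy k z0 r g - g) ^^ 3) (sol 1) \<noteq> 0"
  proof
    assume "((\<lambda>g. monodromy k z0 r g - g) ^^ 3) (sol 1) = 0"
    then have "sol (1 * (loop_multiplier - 1) ^ (3 - 0)) z0 = 0"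
      by (simp add: pow)
    then have "frob_fun c (log_branch z0) $ 0 = 0"
      using frob_sol_leading[of 0 1 c "log_branch z0"] r by (simp add: sol_def)
    then show False
      using nonzero[of z0] norm_z0 z0(1) by (simp add: frob_fun_nth exp_log_branch)
  qed
  moreover have "((\<lambda>g. monodromy k z0 r g - g) ^^ 4) (sol A) = 0" for A
  proof -
    define V where "V = fps_shift 1 (loop_multiplier - 1)"
    have V: "loop_multiplier - 1 = fps_X * V"
      by (rule fps_ext) (simp add: V_def)
    have "A * (loop_multiplier - 1) ^ 4 = fps_X ^ 4 * (A * V ^ 4)"
      unfolding V by (simp only: power_mult_distrib mult.left_commute)
    then have "sol (A * (loop_multiplier - 1) ^ 4) = sol 0"
      by (intro sol_cong) (simp only: fps_X_power_mult_nth if_True fps_zero_nth)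
    then show ?thesis
      by (simp add: pow sol_0)
  qed
  ultimately show ?thesis
    unfolding maximally_unipotent_def local_solutions_eq by blast
qed

end

section \<open>The four differential equations\<close>

lemma converges_within_mono:
  assumes "converges_within R c" "R' \<le> R"
  shows "converges_within R' c"
  using assms order.trans[of "ereal R'" "ereal R"] by (auto simp: converges_within_def)

lemma eventually_frobenius_disc:
  assumes lam: "lam \<noteq> 0" and p4: "p 4 = 1"
    and B: "\<And>z j. z \<noteq> lam \<Longrightarrow> j < 4 \<Longrightarrow> B k z j = p j * z / (z - lam)"
  shows "\<exists>R. \<forall>\<^sub>F z0 in at 0. \<forall>r. 0 < r \<and> r \<le> norm z0 \<longrightarrow> frobenius_disc p lam z0 R r k"
proof -
  obtain R0 where R0: "R0 > 0" "converges_within R0 (frobenius p lam)"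
    using converges_within_frobenius[of p lam] by blast
  define h where "h = eval_fps (column (frobenius p lam) 0)"
  have "ereal 0 < fps_conv_radius (column (frobenius p lam) 0)"
    using R0 less_le_trans[of "ereal 0" "ereal R0"] by (auto simp: converges_within_def)
  then have "isCont h 0"
    unfolding h_def by (intro DERIV_isCont[OF has_field_derivative_eval_fps]) (simp add: zero_ereal_def)
  moreover have "h 0 \<noteq> 0"
    by (simp add: h_def eval_fps_at_0 column_def)
  ultimately have "\<forall>\<^sub>F z in at 0. h z \<noteq> 0"
    by (intro tendsto_imp_eventually_ne) (auto simp: isCont_def)
  then obtain \<delta> where \<delta>: "\<delta> > 0" "\<And>z. z \<noteq> 0 \<Longrightarrow> norm z < \<delta> \<Longrightarrow> h z \<noteq> 0"
    by (auto simp: eventually_at dist_norm)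
  \<comment> \<open>The three bounds secure convergence, nonvanishing of the holomorphic solution,
    whose value at 0 is 1, and distance from lam.\<close>
  define R where "R = min R0 (min \<delta> (norm lam))"
  have R: "R > 0" "R \<le> norm lam" "R \<le> R0" "R \<le> \<delta>"
    using R0(1) \<delta>(1) lam by (simp_all add: R_def)
  have "frobenius_disc p lam z0 R r k" if "z0 \<noteq> 0" "norm z0 < R / 2" "0 < r" "r \<le> norm z0" for z0 r
  proof
    show "eval_fps (column (frobenius p lam) 0) z \<noteq> 0" if "norm z < R" for z
      using \<delta>(2)[of z] \<open>h 0 \<noteq> 0\<close> that R(4) by (cases "z = 0") (auto simp: h_def)
    show "converges_within R (frobenius p lam)"
      using R0(2) R(3) by (rule converges_within_mono)
  qed (use lam p4 B R that in auto)
  then have "\<forall>\<^sub>F z0 in at 0. \<forall>r. 0 < r \<and> r \<le> norm z0 \<longrightarrow> frobenius_disc p lam z0 R r k"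
    using R(1) unfolding eventually_at by (intro exI[of _ "R / 2"]) auto
  then show ?thesis
    by blast
qed

lemma all_less_4: "(\<forall>j<4. P j) \<longleftrightarrow> P 0 \<and> P 1 \<and> P 2 \<and> P (3::nat)"
  by (auto simp: eval_nat_numeral less_Suc_eq)

text \<open>The entries of \<open>p\<close> are the coefficients of \<open>(x + a) (x + b) (x + c) (x + d)\<close> for the
  hypergeometric parameters \<open>a, b, c, d\<close>, for example \<open>1/5, 2/5, 3/5, 4/5\<close> when \<open>k = 5\<close>.\<close>

lemma B_families:
  assumes "(k, w, lam) \<in> families"
  obtains p :: "nat \<Rightarrow> complex" where "p 4 = 1" "p 3 = 2"
    "\<And>z j. z \<noteq> of_nat lam \<Longrightarrow> j < 4 \<Longrightarrow> B k z j = p j * z / (z - of_nat lam)"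
proof -
  \<comment> \<open>In the variable t = z - lam the only nonconstant denominator is t.\<close>
  have "\<exists>p. p 4 = 1 \<and> p 3 = 2 \<and>
    (\<forall>t::complex. t \<noteq> 0 \<longrightarrow> (\<forall>j<4. B k (t + of_nat lam) j = p j * (t + of_nat lam) / t))"
  proof -
    consider "k = 5" "lam = 1" | "k = 6" "lam = 4" | "k = 8" "lam = 256" | "k = 10" "lam = 12500"
      using assms by (auto simp: families_def)
    then show ?thesis
    proof cases
      case 1
      show ?thesis
        unfolding 1
        by (rule exI[of _ "\<lambda>j. [24 / 625, 2 / 5, 7 / 5, 2, 1] ! j"])
          (auto simp: all_less_4 B_def eps_def field_simps)
    next
      case 2
      show ?thesis
        unfolding 2
        by (rule exI[of _ "\<lambda>j. [5 / 162, 13 / 36, 49 / 36, 2, 1] ! j"])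
          (auto simp: all_less_4 B_def eps_def field_simps)
    next
      case 3
      show ?thesis
        unfolding 3
        by (rule exI[of _ "\<lambda>j. [105 / 4096, 11 / 32, 43 / 32, 2, 1] ! j"])
          (auto simp: all_less_4 B_def eps_def field_simps)
    next
      case 4
      show ?thesis
        unfolding 4
        by (rule exI[of _ "\<lambda>j. [189 / 10000, 3 / 10, 13 / 10, 2, 1] ! j"])
          (auto simp: all_less_4 B_def eps_def field_simps)
    qed
  qed
  then obtain p where p: "p 4 = 1" "p 3 = 2"
    "\<And>t j. t \<noteq> 0 \<Longrightarrow> j < 4 \<Longrightarrow> B k (t + of_nat lam) j = p j * (t + of_nat lam) / (t::complex)"
    by blast
  show ?thesis
  proof (rule that[OF p(1,2)])
    fix z :: complex and j :: nat
    assume "z \<noteq> of_nat lam" "j < 4"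
    then show "B k z j = p j * z / (z - of_nat lam)"
      using p(3)[of "z - of_nat lam" j] by simp
  qed
qed

lemma families_admissible: "(k, w, lam) \<in> families \<Longrightarrow> admissible k w \<and> lam > 0"
  by (auto simp: families_def admissible_list)

theorem mainTheorem1:
  fixes k lam :: nat and w :: "nat list"
  assumes "(k, w, lam) \<in> families"
  shows "equiv_mod_exact k w (omega k w 5)
           (\<Sum>l = 1..4. eps k (inverse (psi ^ k)) l *\<^sub>F omega k w l)
    \<and> equiv_mod_exact k w
        ((theta_form k ^^ 4) (omega k w 1)
           + (\<Sum>j<4. B k (inverse (psi ^ k)) j *\<^sub>F (theta_form k ^^ j) (omega k w 1))) 0
    \<and> (\<forall>z::complex. z \<noteq> of_nat lam \<longrightarrow> B k z 3 = 2 * z / (z - of_nat lam))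
    \<and> (\<forall>j<4. B k (0::complex) j = 0)
    \<and> (\<forall>\<^sub>F z0 in at (0::complex). \<forall>r. 0 < r \<and> r \<le> norm z0 \<longrightarrow>
         cfun.subspace (local_solutions k z0 r)
         \<and> cfun.dim (local_solutions k z0 r) = 4
         \<and> (\<forall>f\<in>local_solutions k z0 r.
              \<exists>!g. g \<in> local_solutions k z0 r \<and> continues_along (loop0 z0) f g)
         \<and> linear_automorphism (local_solutions k z0 r) (monodromy k z0 r)
         \<and> maximally_unipotent (local_solutions k z0 r) (monodromy k z0 r))"
proof -
  have kw: "admissible k w" and lam: "lam > 0"
    using families_admissible[OF assms] by simp_all
  obtain cs where cs: "reduces k w [4, 4, 4, 4, 4] cs" "cs ! 4 = of_nat lam * psi ^ k"
    "\<And>l. l < 4 \<Longrightarrow> eps k (inverse (psi ^ k)) (Suc l) * ((-1) ^ l * psi ^ Suc l * (1 - cs ! 4)) = psi ^ 5 * cs ! l"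
    using reduces_families[OF assms] by blast
  have "cs ! 4 \<noteq> 1"
    using psi_power_times_of_nat_neq_1[OF admissible_pos[OF kw]] cs(2) by simp
  from equiv_mod_exact_omega5[OF kw cs(1) this cs(3)]
  have relation: "equiv_mod_exact k w (omega k w 5)
      (\<Sum>l = 1..4. eps k (inverse (psi ^ k)) l *\<^sub>F omega k w l)" .
  \<comment> \<open>The two statements concern literally the same form, by
    \<open>theta_form_omega1\<close>.\<close>
  then have equation: "equiv_mod_exact k w
      ((theta_form k ^^ 4) (omega k w 1)
        + (\<Sum>j<4. B k (inverse (psi ^ k)) j *\<^sub>F (theta_form k ^^ j) (omega k w 1))) 0"
    unfolding theta_form_omega1[OF kw] by (simp only: equiv_mod_exact_def diff_0_right)
  obtain p where p: "p 4 = 1" "p 3 = 2"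
    "\<And>z::complex. \<And>j. z \<noteq> of_nat lam \<Longrightarrow> j < 4 \<Longrightarrow> B k z j = p j * z / (z - of_nat lam)"
    using B_families[OF assms] by blast
  have lam': "of_nat lam \<noteq> (0::complex)"
    using lam by simp
  have B3: "B k z 3 = 2 * z / (z - of_nat lam)" if "z \<noteq> of_nat lam" for z :: complex
    using p(3)[OF that, of 3] p(2) by simp
  have B0: "B k (0::complex) j = 0" if "j < 4" for j
    using p(3)[of 0 j] lam' that by simp
  obtain R where "\<forall>\<^sub>F z0 in at 0. \<forall>r. 0 < r \<and> r \<le> norm z0 \<longrightarrow> frobenius_disc p (of_nat lam) z0 R r k"
    using eventually_frobenius_disc[OF lam' p(1,3)] by blast
  then have "\<forall>\<^sub>F z0 in at (0::complex). \<forall>r. 0 < r \<and> r \<le> norm z0 \<longrightarrow>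
         cfun.subspace (local_solutions k z0 r)
         \<and> cfun.dim (local_solutions k z0 r) = 4
         \<and> (\<forall>f\<in>local_solutions k z0 r.
              \<exists>!g. g \<in> local_solutions k z0 r \<and> continues_along (loop0 z0) f g)
         \<and> linear_automorphism (local_solutions k z0 r) (monodromy k z0 r)
         \<and> maximally_unipotent (local_solutions k z0 r) (monodromy k z0 r)"
    by (rule eventually_mono)
      (intro allI impI conjI ballI; drule spec, drule mp, assumption;
        erule frobenius_disc.subspace_local_solutions frobenius_disc.dim_local_solutions
          frobenius_disc.unique_continuation frobenius_disc.linear_automorphism_monodromy
          frobenius_disc.maximally_unipotent_monodromy, assumption?)
  then show ?thesis
    using relation equation B3 B0 by (intro conjI allI impI)
qed

end
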